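(* Let $n\ge2$, $p>1$, $K\in\mathcal{K}_o^n$, $u\in\mathbb{S}^{n-1}$, and let $\{K_t\}_{t\in[-1,1]}$ be the linear reflection shadow system of $K$ in the direction $u$. Then $\mathrm{Vol}_n(\Pi_p^{\ast}K_t)=\mathrm{Vol}_n(\Pi_p^{\ast}K_{-t})$, and the function $t\mapsto\mathrm{Vol}_n(\Pi_p^{\ast}K_t)$ is monotonically non-increasing on $[0,1]$.
   Context: $\mathcal{K}_o^n$ is the set of convex bodies (compact convex sets with nonempty interior) in $\mathbb{R}^n$ containing the origin in their interiors; $h_K$ is the support function and $S(K,\cdot)$ the surface area measure. With $\omega_r=\pi^{r/2}/\Gamma(1+r/2)$ and $c_{n,p}=\omega_{n+p}/(\omega_2\omega_n\omega_{p-1})$, the $L_p$-projection body $\Pi_pK$ has support function $$h_{\Pi_pK}(v)=\left(\frac{1}{n\omega_nc_{n-2,p}}\int_{\mathbb{S}^{n-1}}|\langle v,\theta\rangle|^p h_K(\theta)^{1-p}\,dS(K,\theta)\right)^{1/p},\qquad v\in\mathbb{S}^{n-1},$$ and $\Pi_p^{\ast}K=(\Pi_pK)^{\ast}$ is its polar body. Linear reflection shadow system: let $K_u'$ be the orthogonal projection of $K$ onto $u^{\perp}$ and write $K=\{x'+su: x'\in K_u',\ g(x')\le s\le f(x')\}$ with $f$ concave and $g$ convex on $K_u'$. Then $K_t=\{x'+su: x'\in K_u',\ g_t(x')\le s\le f_t(x')\}$ with $f_t=\frac t2(f+g)+\frac12(f-g)$ and $g_t=\frac t2(f+g)-\frac12(f-g)$.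 (Thus $K_1=K$, $K_{-1}$ is the reflection of $K$ in $u^\perp$, and $K_0$ is the Steiner symmetral $S_uK$.) *)

theory Defs
  imports "HOL-Analysis.Analysis"
begin

definition convex_bodies_o :: "'a::euclidean_space set set" where
  "convex_bodies_o = {K. convex K \<and> compact K \<and> 0 \<in> interior K}"

definition support_function :: "'a::euclidean_space set \<Rightarrow> 'a \<Rightarrow> real" where
  "support_function K v = (SUP x\<in>K. v \<bullet> x)"

definition polar_body :: "'a::euclidean_space set \<Rightarrow> 'a set" where
  "polar_body K = {y. \<forall>x\<in>K. y \<bullet> x \<le> 1}"

text \<open>Normalised so that the \<open>d\<close>-dimensional measure agrees with Lebesgue measure on
  \<open>d\<close>-dimensional subspaces. The covering sets are required to be bounded because
  \<^const>\<open>diameter\<close> is real-valued and carries no information on unbounded sets; the empty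
  set is singled out because of \<open>0 ^ 0 = 1\<close>.\<close>

definition hausdorff_gauge :: "nat \<Rightarrow> 'a::metric_space set \<Rightarrow> ennreal" where
  "hausdorff_gauge d C =
     (if C = {} then 0 else ennreal (unit_ball_vol (real d) * (diameter C / 2) ^ d))"

definition hausdorff_premeasure :: "nat \<Rightarrow> real \<Rightarrow> 'a::metric_space set \<Rightarrow> ennreal" where
  "hausdorff_premeasure d \<delta> A =
     (INF C \<in> {C :: nat \<Rightarrow> 'a set. A \<subseteq> (\<Union>i. C i) \<and> (\<forall>i. bounded (C i) \<and> diameter (C i) \<le> \<delta>)}.
        \<Sum>i. hausdorff_gauge d (C i))"

definition hausdorff_outer_measure :: "nat \<Rightarrow> 'a::metric_space set \<Rightarrow> ennreal" where
  "hausdorff_outer_measure d A = (SUP \<delta>\<in>{0<..}. hausdorff_premeasure d \<delta> A)"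

definition hausdorff_measure :: "nat \<Rightarrow> 'a::metric_space measure" where
  "hausdorff_measure d = measure_of UNIV (sets borel) (hausdorff_outer_measure d)"

definition outer_unit_normals :: "'a::euclidean_space set \<Rightarrow> 'a \<Rightarrow> 'a set" where
  "outer_unit_normals K x = {v. norm v = 1 \<and> (\<forall>y\<in>K. v \<bullet> y \<le> v \<bullet> x)}"

definition regular_boundary :: "'a::euclidean_space set \<Rightarrow> 'a set" where
  "regular_boundary K = {x \<in> frontier K. \<exists>!v. v \<in> outer_unit_normals K x}"

definition gauss_map :: "'a::euclidean_space set \<Rightarrow> 'a \<Rightarrow> 'a" where
  "gauss_map K x = (THE v. v \<in> outer_unit_normals K x)"

text \<open>\<open>S(K, \<cdot>)\<close> is the push-forward of the \<open>(n - 1)\<close>-dimensional Hausdorff measure on the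
  boundary under the Gauss map, as a Borel measure on the unit sphere. The Gauss map is defined
  on the boundary points with a unique outer unit normal; for a convex body the remaining
  boundary points form a null set.\<close>

definition surface_area_measure :: "'a::euclidean_space set \<Rightarrow> 'a measure" where
  "surface_area_measure K =
     distr (restrict_space (hausdorff_measure (DIM('a) - 1)) (regular_boundary K))
       (restrict_space borel (sphere 0 1)) (gauss_map K)"

text \<open>The first argument is real because the index \<open>n - 2\<close> is used; \<^const>\<open>unit_ball_vol\<close>
  is \<open>\<omega>\<^sub>r\<close> for real \<open>r\<close>.\<close>

definition Lp_const :: "real \<Rightarrow> real \<Rightarrow> real" where
  "Lp_const n p =
     unit_ball_vol (n + p) / (unit_ball_vol 2 * unit_ball_vol n * unit_ball_vol (p - 1))"

definition Lp_projection_function :: "real \<Rightarrow> 'a::euclidean_space set \<Rightarrow> 'a \<Rightarrow> real" where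
  "Lp_projection_function p K v =
     (1 / (real DIM('a) * unit_ball_vol (real DIM('a)) * Lp_const (real DIM('a) - 2) p) *
      (\<integral>\<theta>. \<bar>v \<bullet> \<theta>\<bar> powr p * support_function K \<theta> powr (1 - p) \<partial>surface_area_measure K))
     powr (1 / p)"

text \<open>A nonempty compact convex set is determined by its support function on the unit sphere.\<close>

definition Lp_projection_body :: "real \<Rightarrow> 'a::euclidean_space set \<Rightarrow> 'a set" where
  "Lp_projection_body p K =
     (THE L. convex L \<and> compact L \<and> L \<noteq> {} \<and>
        (\<forall>v\<in>sphere 0 1. support_function L v = Lp_projection_function p K v))"

definition hyperplane_proj :: "'a::euclidean_space \<Rightarrow> 'a set \<Rightarrow> 'a set" where
  "hyperplane_proj u K = (\<lambda>x. x - (x \<bullet> u) *\<^sub>R u) ` K"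

text \<open>Over \<open>hyperplane_proj u K\<close> the functions \<open>f\<close> (concave) and \<open>g\<close> (convex) bounding \<open>K\<close> are
  determined by \<open>K\<close>: they are the end points of its fibres in direction \<open>u\<close>.\<close>

definition upper_graph :: "'a::euclidean_space \<Rightarrow> 'a set \<Rightarrow> 'a \<Rightarrow> real" where
  "upper_graph u K x' = Sup {s. x' + s *\<^sub>R u \<in> K}"

definition lower_graph :: "'a::euclidean_space \<Rightarrow> 'a set \<Rightarrow> 'a \<Rightarrow> real" where
  "lower_graph u K x' = Inf {s. x' + s *\<^sub>R u \<in> K}"

definition shadow_upper :: "'a::euclidean_space \<Rightarrow> 'a set \<Rightarrow> real \<Rightarrow> 'a \<Rightarrow> real" where
  "shadow_upper u K t x' =
     t / 2 * (upper_graph u K x' + lower_graph u K x') +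
     1 / 2 * (upper_graph u K x' - lower_graph u K x')"

definition shadow_lower :: "'a::euclidean_space \<Rightarrow> 'a set \<Rightarrow> real \<Rightarrow> 'a \<Rightarrow> real" where
  "shadow_lower u K t x' =
     t / 2 * (upper_graph u K x' + lower_graph u K x') -
     1 / 2 * (upper_graph u K x' - lower_graph u K x')"

definition shadow_system :: "'a::euclidean_space \<Rightarrow> 'a set \<Rightarrow> real \<Rightarrow> 'a set" where
  "shadow_system u K t =
     {x' + s *\<^sub>R u | x' s. x' \<in> hyperplane_proj u K \<and>
        shadow_lower u K t x' \<le> s \<and> s \<le> shadow_upper u K t x'}"

end

theory Submission
  imports Defs
begin

text \<open>
  Write \<open>E\<^sub>t v\<close> for the integral of \<open>\<bar>v \<bullet> \<theta>\<bar> powr p * h(\<theta>) powr (1 - p)\<close> against the surface area measure of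
  \<open>K\<^sub>t\<close>, so that the polar projection body is a sublevel set of \<open>E\<^sub>t\<close>. Split the boundary according to the
  sign of the component of the normal in direction \<open>u\<close>. Over the upper graph \<open>f\<close> the integrand becomes
  \<open>\<bar>r - y \<bullet> \<nabla>f\<bar> powr p * (f - z \<bullet> \<nabla>f) powr (1 - p)\<close> with \<open>v = y + r u\<close>; this is jointly convex in \<open>r\<close> and \<open>f\<close>
  by convexity of the perspective of \<open>\<bar>x\<bar> powr p\<close>, and \<open>f\<close> is affine in \<open>t\<close>. The lower graph is the upper graph
  for \<open>- u\<close>, and the part with normals orthogonal to \<open>u\<close> contributes an amount depending on neither \<open>t\<close>
  nor \<open>r\<close>. So for fixed \<open>y\<close> the energy is jointly convex in \<open>(t, r)\<close>, while reflection in the hyperplane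
  exchanges \<open>t\<close> with \<open>- t\<close> and \<open>r\<close> with \<open>- r\<close>. Hence for \<open>0 \<le> s \<le> t\<close> each fibre in direction \<open>u\<close> of the
  sublevel set for \<open>s\<close> contains a translate of every bounded interval in the corresponding fibre for \<open>t\<close>, and
  the volume does not increase.

  The area formulas needed for this are obtained without Rademacher's theorem: near a regular point the
  boundary of a convex body is nearly isometric to its tangent hyperplane, both by radial projection and by
  projection along \<open>u\<close>, and on hyperplanes Hausdorff measure is a constant multiple of the cone volume because
  both are translation invariant. The value of the constant is irrelevant.
\<close>

subsection \<open>Hausdorff measure\<close>

text \<open>Normals are rescaled to the polar body: for a boundary point with unit normal \<theta>
  put \<open>w = \<theta> / h(\<theta>)\<close>. Then \<open>\<bar>v \<bullet> \<theta>\<bar> powr p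
  * h(\<theta>) powr (1 - p)\<close> becomes
  \<open>\<bar>v \<bullet> w\<bar> powr p / norm w\<close>, so the support function disappears. Over
  the upper graph the density becomes
  \<open>\<bar>v \<bullet> w\<bar> powr p / (w \<bullet> u)\<close>, and along the shadow system
  \<open>w\<close> is an explicit average of dual normals, which turns perspective convexity into
  convexity of \<open>\<bar>x\<bar> powr p\<close>. Integrals over a hyperplane are always expressed
  by Lebesgue measure of the whole space, over a unit slab or over a cone with apex 0, so every
  direction is treated without coordinates. The obstacle is that the convexity estimate compares
  three bodies above the same point of the hyperplane, whereas the surface area measure only sees
  regular points and its null sets live on three different boundaries. Hence regularity is proved
  for almost every point of the common projection. Boundary points with horizontal normals lie above
  the relative boundary of that projection and escape this description; their energy is computed
  from cone volumes instead.\<close>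

lemma hausdorff_gauge_empty [simp]: "hausdorff_gauge d {} = 0"
  by (simp add: hausdorff_gauge_def)

definition hausdorff_covers :: "real \<Rightarrow> 'a::metric_space set \<Rightarrow> (nat \<Rightarrow> 'a set) set" where
  "hausdorff_covers \<delta> A =
     {C. A \<subseteq> (\<Union>i. C i) \<and> (\<forall>i. bounded (C i) \<and> diameter (C i) \<le> \<delta>)}"

lemma hausdorff_premeasure_covers:
  "hausdorff_premeasure d \<delta> A = (INF C \<in> hausdorff_covers \<delta> A. \<Sum>i. hausdorff_gauge d (C i))"
  by (simp add: hausdorff_premeasure_def hausdorff_covers_def)

lemma hausdorff_premeasure_le:
  "C \<in> hausdorff_covers \<delta> A \<Longrightarrow> hausdorff_premeasure d \<delta> A \<le> (\<Sum>i. hausdorff_gauge d (C i))"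
  unfolding hausdorff_premeasure_covers by (rule INF_lower)

lemma hausdorff_premeasure_empty [simp]:
  assumes "\<delta> > 0" shows "hausdorff_premeasure d \<delta> {} = 0"
proof -
  have "(\<lambda>_. {}) \<in> hausdorff_covers \<delta> ({}::'a set)" using assms by (simp add: hausdorff_covers_def)
  from hausdorff_premeasure_le[OF this, of d] show ?thesis by simp
qed

lemma hausdorff_premeasure_mono:
  "A \<subseteq> B \<Longrightarrow> hausdorff_premeasure d \<delta> A \<le> hausdorff_premeasure d \<delta> B"
  unfolding hausdorff_premeasure_covers
  by (rule INF_superset_mono) (auto simp: hausdorff_covers_def)

lemma hausdorff_premeasure_antimono:
  "\<delta> \<le> \<delta>' \<Longrightarrow> hausdorff_premeasure d \<delta>' A \<le> hausdorff_premeasure d \<delta> A"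
  unfolding hausdorff_premeasure_covers
  by (rule INF_superset_mono) (auto simp: hausdorff_covers_def intro: order_trans)

lemma hausdorff_premeasure_UN_le:
  "hausdorff_premeasure d \<delta> (\<Union>i. A i) \<le> (\<Sum>i. hausdorff_premeasure d \<delta> (A i))"
proof (rule ennreal_le_epsilon)
  fix e :: real assume fin: "(\<Sum>i. hausdorff_premeasure d \<delta> (A i)) < top" and e: "0 < e"
  have "\<exists>C. C \<in> hausdorff_covers \<delta> (A i) \<and>
      (\<Sum>j. hausdorff_gauge d (C j)) \<le> hausdorff_premeasure d \<delta> (A i) + e * (1/2) ^ Suc i" for i
  proof -
    have "hausdorff_premeasure d \<delta> (A i) < top" using fin by (rule ennreal_suminf_lessD)
    then have "hausdorff_premeasure d \<delta> (A i) \<noteq> top" by simp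
    moreover have "0 < ennreal (e * (1/2) ^ Suc i)" using e by simp
    ultimately have "hausdorff_premeasure d \<delta> (A i) < hausdorff_premeasure d \<delta> (A i) + e * (1/2) ^ Suc i"
      using ennreal_add_left_cancel_less[of "hausdorff_premeasure d \<delta> (A i)" 0 "ennreal (e * (1/2) ^ Suc i)"]
      unfolding infinity_ennreal_def by (simp only: add_0_right) blast
    then show ?thesis
      unfolding hausdorff_premeasure_covers[of d \<delta> "A i"] INF_less_iff by (force simp: less_imp_le)
  qed
  then obtain C where C: "\<And>i. C i \<in> hausdorff_covers \<delta> (A i)"
    and le: "\<And>i. (\<Sum>j. hausdorff_gauge d (C i j)) \<le> hausdorff_premeasure d \<delta> (A i) + e * (1/2) ^ Suc i"
    by metis
  let ?D = "case_prod C \<circ> prod_decode"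
  have "?D \<in> hausdorff_covers \<delta> (\<Union>i. A i)"
    unfolding hausdorff_covers_def
  proof (safe, goal_cases)
    case (1 x i)
    then obtain j where "x \<in> C i j" using C[of i] by (auto simp: hausdorff_covers_def)
    then show ?case by (intro UN_I[of "prod_encode (i, j)"]) auto
  next
    case (2 i) then show ?case using C by (auto simp: hausdorff_covers_def split: prod.split)
  next
    case (3 i) then show ?case using C by (auto simp: hausdorff_covers_def split: prod.split)
  qed
  then have "hausdorff_premeasure d \<delta> (\<Union>i. A i) \<le> (\<Sum>i. hausdorff_gauge d (?D i))"
    by (rule hausdorff_premeasure_le)
  also have "\<dots> = (\<Sum>i. \<Sum>j. hausdorff_gauge d (C i j))"
    by (subst suminf_ennreal_2dimen[where f="hausdorff_gauge d \<circ> case_prod C", symmetric]) (auto simp: comp_def)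
  also have "\<dots> \<le> (\<Sum>i. hausdorff_premeasure d \<delta> (A i) + e * (1/2) ^ Suc i)"
    by (intro suminf_le le) auto
  also have "\<dots> = (\<Sum>i. hausdorff_premeasure d \<delta> (A i)) + (\<Sum>i. ennreal e * ennreal ((1 / 2) ^ Suc i))"
    using e by (subst suminf_add[symmetric]) (auto simp del: ennreal_suminf_cmult simp add: ennreal_mult[symmetric])
  also have "(\<Sum>i. ennreal e * ennreal ((1 / 2) ^ Suc i)) = ennreal e"
    unfolding ennreal_suminf_cmult
    by (subst suminf_ennreal_eq[OF zero_le_power power_half_series]) auto
  finally show "hausdorff_premeasure d \<delta> (\<Union>i. A i) \<le> (\<Sum>i. hausdorff_premeasure d \<delta> (A i)) + ennreal e" .
qed

section \<open>The outer measure: Borel measurability and Lipschitz images\<close>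

lemma hausdorff_premeasure_le_outer:
  "0 < \<delta> \<Longrightarrow> hausdorff_premeasure d \<delta> A \<le> hausdorff_outer_measure d A"
  unfolding hausdorff_outer_measure_def by (rule SUP_upper) simp

lemma hausdorff_outer_empty [simp]: "hausdorff_outer_measure d {} = 0"
proof -
  have "hausdorff_outer_measure d {} \<le> (0::ennreal)"
    unfolding hausdorff_outer_measure_def by (intro SUP_least) simp
  then show ?thesis by simp
qed

lemma hausdorff_outer_mono:
  "A \<subseteq> B \<Longrightarrow> hausdorff_outer_measure d A \<le> hausdorff_outer_measure d B"
  unfolding hausdorff_outer_measure_def by (intro SUP_mono' hausdorff_premeasure_mono)

lemma hausdorff_outer_UN_le:
  "hausdorff_outer_measure d (\<Union>i. A i) \<le> (\<Sum>i. hausdorff_outer_measure d (A i))"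
proof -
  have "hausdorff_premeasure d \<delta> (\<Union>i. A i) \<le> (\<Sum>i. hausdorff_outer_measure d (A i))" if "\<delta> > 0" for \<delta>
    using hausdorff_premeasure_UN_le
    by (rule order_trans) (intro suminf_le hausdorff_premeasure_le_outer that; simp)
  then show ?thesis unfolding hausdorff_outer_measure_def[of d "\<Union>i. A i"] by (intro SUP_least) auto
qed

lemma hausdorff_outer_Un_le:
  "hausdorff_outer_measure d (A \<union> B) \<le> hausdorff_outer_measure d A + hausdorff_outer_measure d B"
proof -
  let ?C = "\<lambda>i::nat. if i = 0 then A else if i = 1 then B else {}"
  have "A \<union> B \<subseteq> (\<Union>i. ?C i)" by (auto split: if_splits intro: exI[of _ "0::nat"] exI[of _ "1::nat"])
  then have "hausdorff_outer_measure d (A \<union> B) \<le> (\<Sum>i. hausdorff_outer_measure d (?C i))"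
    by (rule order_trans[OF hausdorff_outer_mono hausdorff_outer_UN_le])
  also have "\<dots> = (\<Sum>i\<in>{0,1}. hausdorff_outer_measure d (?C i))" by (rule suminf_finite) auto
  finally show ?thesis by simp
qed

text \<open>No set of diameter at most \<delta> < \<eta> meets both \<open>A\<close> and
  \<open>B\<close>, so every cover splits into a cover of \<open>A\<close> and a cover of
  \<open>B\<close> with no member in common.\<close>

lemma hausdorff_premeasure_separated:
  assumes \<delta>: "0 < \<delta>" "\<delta> < \<eta>" and sep: "\<And>x y. x \<in> A \<Longrightarrow> y \<in> B \<Longrightarrow> \<eta> \<le> dist x y"
  shows "hausdorff_premeasure d \<delta> A + hausdorff_premeasure d \<delta> B \<le> hausdorff_premeasure d \<delta> (A \<union> B)"
  unfolding hausdorff_premeasure_covers[of d \<delta> "A \<union> B"]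
proof (rule INF_greatest)
  fix C assume C: "C \<in> hausdorff_covers \<delta> (A \<union> B)"
  define CA where "CA i = (if C i \<inter> A = {} then {} else C i)" for i
  define CB where "CB i = (if C i \<inter> B = {} then {} else C i)" for i
  have disj: "CA i = {} \<or> CB i = {}" for i
  proof (rule ccontr)
    assume "\<not> ?thesis"
    then obtain x y where xy: "x \<in> C i" "y \<in> C i" "x \<in> A" "y \<in> B" by (auto simp: CA_def CB_def split: if_splits)
    have "dist x y \<le> diameter (C i)" using C xy by (intro diameter_bounded_bound) (auto simp: hausdorff_covers_def)
    also have "\<dots> \<le> \<delta>" using C by (auto simp: hausdorff_covers_def)
    finally show False using sep[OF xy(3,4)] \<delta> by simp
  qed
  have "CA \<in> hausdorff_covers \<delta> A" "CB \<in> hausdorff_covers \<delta> B"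
    using C \<delta> by (fastforce simp: hausdorff_covers_def CA_def CB_def)+
  then have "hausdorff_premeasure d \<delta> A + hausdorff_premeasure d \<delta> B
      \<le> (\<Sum>i. hausdorff_gauge d (CA i)) + (\<Sum>i. hausdorff_gauge d (CB i))"
    by (intro add_mono hausdorff_premeasure_le)
  also have "\<dots> = (\<Sum>i. hausdorff_gauge d (CA i) + hausdorff_gauge d (CB i))"
    by (rule suminf_add) auto
  also have "\<dots> \<le> (\<Sum>i. hausdorff_gauge d (C i))"
  proof (intro suminf_le)
    fix i show "hausdorff_gauge d (CA i) + hausdorff_gauge d (CB i) \<le> hausdorff_gauge d (C i)"
      using disj[of i] by (auto simp: CA_def CB_def split: if_splits)
  qed auto
  finally show "hausdorff_premeasure d \<delta> A + hausdorff_premeasure d \<delta> B \<le> (\<Sum>i. hausdorff_gauge d (C i))" .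
qed

lemma hausdorff_outer_separated:
  assumes \<eta>: "0 < \<eta>" and sep: "\<And>x y. x \<in> A \<Longrightarrow> y \<in> B \<Longrightarrow> \<eta> \<le> dist x y"
  shows "hausdorff_outer_measure d A + hausdorff_outer_measure d B \<le> hausdorff_outer_measure d (A \<union> B)"
proof -
  have *: "hausdorff_premeasure d \<delta>1 A + hausdorff_premeasure d \<delta>2 B \<le> hausdorff_outer_measure d (A \<union> B)"
    if "\<delta>1 > 0" "\<delta>2 > 0" for \<delta>1 \<delta>2
  proof -
    \<comment> \<open>Premeasures grow as the scale shrinks, so both scales may be replaced by a
      common one below \<eta>.\<close>
    define \<delta> where "\<delta> = min (min \<delta>1 \<delta>2) (\<eta> / 2)"
    have \<delta>: "0 < \<delta>" "\<delta> \<le> \<delta>1" "\<delta> \<le> \<delta>2" "\<delta> < \<eta>" using that \<eta> by (auto simp: \<delta>_def min_def)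
    have "hausdorff_premeasure d \<delta>1 A + hausdorff_premeasure d \<delta>2 B
        \<le> hausdorff_premeasure d \<delta> A + hausdorff_premeasure d \<delta> B"
      by (intro add_mono hausdorff_premeasure_antimono \<delta>)
    also have "\<dots> \<le> hausdorff_premeasure d \<delta> (A \<union> B)"
      by (rule hausdorff_premeasure_separated[OF \<delta>(1,4) sep])
    also have "\<dots> \<le> hausdorff_outer_measure d (A \<union> B)" by (rule hausdorff_premeasure_le_outer[OF \<delta>(1)])
    finally show ?thesis .
  qed
  have 2: "hausdorff_premeasure d \<delta>1 A + hausdorff_outer_measure d B \<le> hausdorff_outer_measure d (A \<union> B)"
    if "\<delta>1 > 0" for \<delta>1
  proof -
    have "hausdorff_premeasure d \<delta>1 A + hausdorff_outer_measure d B =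
        (SUP \<delta>2\<in>{0<..}. hausdorff_premeasure d \<delta>1 A + hausdorff_premeasure d \<delta>2 B)"
      unfolding hausdorff_outer_measure_def by (rule ennreal_SUP_add_right) simp
    also have "\<dots> \<le> hausdorff_outer_measure d (A \<union> B)" using * that by (intro SUP_least) auto
    finally show ?thesis .
  qed
  have "hausdorff_outer_measure d A + hausdorff_outer_measure d B =
      (SUP \<delta>1\<in>{0<..}. hausdorff_premeasure d \<delta>1 A + hausdorff_outer_measure d B)"
    unfolding hausdorff_outer_measure_def[of d A] by (rule ennreal_SUP_add_left[symmetric]) simp
  also have "\<dots> \<le> hausdorff_outer_measure d (A \<union> B)" using 2 by (intro SUP_least) auto
  finally show ?thesis .
qed


text \<open>The Caratheodory criterion for metric outer measures. The sets \<open>S n\<close> of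
  points at distance at least 1/(n+1) from \<open>F\<close> exhaust \<open>A - F\<close> and are
  separated from \<open>F\<close>. What remains is to show that the measures of the layers
  \<open>D n\<close> between them are summable.\<close>

lemma hausdorff_outer_closed_caratheodory:
  fixes F :: "'a::metric_space set"
  assumes F: "closed F"
  shows "hausdorff_outer_measure d (F \<inter> A) + hausdorff_outer_measure d (A - F) = hausdorff_outer_measure d A"
\<comment> \<open>The distance \<open>infdist\<close> to the empty set is 0, so the sets
  \<open>S n\<close> would be useless for \<open>F = {}\<close>. An infinite value could not be
  cancelled at the end.\<close>
proof (cases "F = {} \<or> hausdorff_outer_measure d A = top")
  case True
  then show ?thesis
  proof
    assume "hausdorff_outer_measure d A = top"
    moreover have "hausdorff_outer_measure d A \<le> hausdorff_outer_measure d (F \<inter> A) + hausdorff_outer_measure d (A - F)"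
      by (rule order_trans[OF hausdorff_outer_mono hausdorff_outer_Un_le]) auto
    ultimately show ?thesis by (simp add: top_unique)
  qed simp
next
  case False
  then have ne: "F \<noteq> {}" and fin: "hausdorff_outer_measure d A \<noteq> top" by auto
  let ?H = "hausdorff_outer_measure d"
  define S where "S n = {x \<in> A. 1 / real (Suc n) \<le> infdist x F}" for n
  define D where "D n = S (Suc n) - S n" for n
  have S_mono: "S m \<subseteq> S n" if "m \<le> n" for m n
    using that unfolding S_def by (auto elim!: order_trans[rotated] simp: frac_le)
  have infdist_F: "infdist x F = 0" if "x \<in> F" for x using that by simp
  have S_F: "?H (F \<inter> A) + ?H (S n) \<le> ?H A" for n
  proof -
    have "?H (F \<inter> A) + ?H (S n) \<le> ?H ((F \<inter> A) \<union> S n)"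
    proof (rule hausdorff_outer_separated[of "1 / real (Suc n)"])
      fix x y assume "x \<in> F \<inter> A" "y \<in> S n"
      then show "1 / real (Suc n) \<le> dist x y"
        using infdist_le[of x F y] by (auto simp: S_def dist_commute)
    qed simp
    also have "\<dots> \<le> ?H A" by (rule hausdorff_outer_mono) (auto simp: S_def)
    finally show ?thesis .
  qed
  have AF: "A - F \<subseteq> S n \<union> (\<Union>k. D (k + n))" for n
  proof
    fix x assume x: "x \<in> A - F"
    then have "infdist x F > 0"
      using F ne by (metis DiffD2 in_closed_iff_infdist_zero infdist_nonneg less_eq_real_def)
    then obtain m0 where m0: "1 / real (Suc m0) < infdist x F" using reals_Archimedean
      by (metis inverse_eq_divide)
    show "x \<in> S n \<union> (\<Union>k. D (k + n))"
    proof (cases "x \<in> S n")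
      case False
      define m where "m = (LEAST m. x \<in> S m)"
      have "x \<in> S m0" using x m0 by (auto simp: S_def)
      then have m: "x \<in> S m" unfolding m_def by (rule LeastI)
      have "n < m" using False m S_mono[of m n] by (meson in_mono not_le)
      then have "x \<notin> S (m - 1)" unfolding m_def by (intro not_less_Least) simp
      with \<open>n < m\<close> m have "x \<in> D ((m - 1 - n) + n)" by (auto simp: D_def)
      then show ?thesis by blast
    qed simp
  qed
  have sep: "?H X + ?H Y \<le> ?H (X \<union> Y)" if "X \<subseteq> S j" "Y \<subseteq> A - S (Suc j)" for X Y j
  proof (rule hausdorff_outer_separated[of "1 / real (Suc j) - 1 / real (Suc (Suc j))"])
    show "0 < 1 / real (Suc j) - 1 / real (Suc (Suc j))" by (simp add: frac_less2)
    fix x y assume "x \<in> X" "y \<in> Y"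
    then have "1 / real (Suc j) \<le> infdist x F" "infdist y F < 1 / real (Suc (Suc j))"
      using that by (auto simp: S_def)
    moreover have "infdist x F \<le> infdist y F + dist x y" by (rule infdist_triangle)
    ultimately show "1 / real (Suc j) - 1 / real (Suc (Suc j)) \<le> dist x y" by linarith
  qed
  \<comment> \<open>Adjacent layers may touch, but layers two apart are separated. Hence the sum is
    taken over indices of one parity, with offset \<open>e\<close>.\<close>
  have alt: "(\<Sum>k<n. ?H (D (2 * k + e))) \<le> ?H (\<Union>k<n. D (2 * k + e))" for n e
  proof (induction n)
    case (Suc n)
    show ?case
    proof (cases n)
      case (Suc n')
      have "(\<Sum>k<Suc n. ?H (D (2 * k + e))) \<le> ?H (\<Union>k<n. D (2 * k + e)) + ?H (D (2 * n + e))"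
        using Suc.IH by (simp add: add_right_mono)
      also have "\<dots> \<le> ?H ((\<Union>k<n. D (2 * k + e)) \<union> D (2 * n + e))"
      proof (rule sep[of _ "2 * n' + e + 1"])
        show "(\<Union>k<n. D (2 * k + e)) \<subseteq> S (2 * n' + e + 1)"
        proof (rule UN_least)
          fix k assume "k \<in> {..<n}"
          then have "S (Suc (2 * k + e)) \<subseteq> S (2 * n' + e + 1)" using Suc by (intro S_mono) auto
          then show "D (2 * k + e) \<subseteq> S (2 * n' + e + 1)" by (auto simp: D_def)
        qed
        show "D (2 * n + e) \<subseteq> A - S (Suc (2 * n' + e + 1))" using Suc by (auto simp: D_def S_def)
      qed
      also have "(\<Union>k<n. D (2 * k + e)) \<union> D (2 * n + e) = (\<Union>k<Suc n. D (2 * k + e))"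
        by (auto simp: lessThan_Suc)
      finally show ?thesis .
    qed (simp add: lessThan_Suc)
  qed simp
  have alt_A: "(\<Sum>k<n. ?H (D (2 * k + e))) \<le> ?H A" for n e
    using alt by (rule order_trans) (rule hausdorff_outer_mono, auto simp: D_def S_def)
  have sum2: "(\<Sum>k<2 * n. f k) = (\<Sum>k<n. f (2 * k)) + (\<Sum>k<n. f (2 * k + 1))" for n and f :: "nat \<Rightarrow> ennreal"
    by (induction n) (auto simp: algebra_simps)
  have "(\<Sum>k<n. ?H (D k)) \<le> ?H A + ?H A" for n
  proof -
    have "(\<Sum>k<n. ?H (D k)) \<le> (\<Sum>k<2 * n. ?H (D k))" by (rule sum_mono2) auto
    also have "\<dots> \<le> ?H A + ?H A" unfolding sum2 using alt_A[of 0 n] alt_A[of 1 n] by (intro add_mono) simp_all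
    finally show ?thesis .
  qed
  then have "(\<Sum>k. ?H (D k)) \<le> ?H A + ?H A" by (intro suminf_le_const) auto
  then have finD: "(\<Sum>k. ?H (D k)) \<noteq> top" using fin by (metis ennreal_add_eq_top top_unique)
  define L where "L = (SUP n. ?H (S n))"
  \<comment> \<open>A partial sum is added on both sides in place of letting the tail tend to 0; the
    finite total then cancels in one step.\<close>
  have "?H (A - F) + (\<Sum>k<n. ?H (D k)) \<le> L + (\<Sum>k. ?H (D k))" for n
  proof -
    have "?H (A - F) \<le> ?H (S n) + ?H (\<Union>k. D (k + n))"
      by (rule order_trans[OF hausdorff_outer_mono[OF AF] hausdorff_outer_Un_le])
    also have "\<dots> \<le> L + (\<Sum>k. ?H (D (k + n)))"
      unfolding L_def by (intro add_mono SUP_upper hausdorff_outer_UN_le) simp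
    finally have "?H (A - F) + (\<Sum>k<n. ?H (D k)) \<le> L + (\<Sum>k. ?H (D (k + n))) + (\<Sum>k<n. ?H (D k))"
      by (rule add_right_mono)
    also have "\<dots> = L + (\<Sum>k. ?H (D k))"
      by (simp add: suminf_offset[of "\<lambda>k. ?H (D k)" n] add.assoc)
    finally show ?thesis .
  qed
  then have "?H (A - F) + (\<Sum>k. ?H (D k)) \<le> L + (\<Sum>k. ?H (D k))"
    unfolding suminf_eq_SUP[of "\<lambda>k. ?H (D k)"]
    by (subst ennreal_SUP_add_right) (auto intro!: SUP_least)
  then have "?H (A - F) \<le> L" using finD by (simp add: add.commute ennreal_add_left_cancel_le)
  then have "?H (F \<inter> A) + ?H (A - F) \<le> ?H (F \<inter> A) + L" by (rule add_left_mono)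
  also have "\<dots> \<le> ?H A"
    unfolding L_def by (subst ennreal_SUP_add_right) (auto intro!: SUP_least S_F)
  finally have "?H (F \<inter> A) + ?H (A - F) \<le> ?H A" .
  moreover have "?H A \<le> ?H (F \<inter> A) + ?H (A - F)"
    by (rule order_trans[OF hausdorff_outer_mono hausdorff_outer_Un_le]) auto
  ultimately show ?thesis by (rule antisym)
qed

text \<open>The lambda system of the outer measure contains the closed sets and therefore the Borel
  sets. This is what gives \<open>hausdorff_measure\<close> its meaning: \<open>measure_of\<close>
  returns the zero measure unless its arguments form a measure space.\<close>

lemma measure_space_hausdorff:
  "measure_space UNIV (sets borel) (hausdorff_outer_measure d :: 'a::metric_space set \<Rightarrow> ennreal)"
proof -
  let ?H = "hausdorff_outer_measure d :: 'a set \<Rightarrow> ennreal"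
  interpret P: sigma_algebra UNIV "Pow UNIV :: 'a set set" by (rule sigma_algebra_Pow)
  let ?L = "lambda_system UNIV (Pow UNIV) ?H"
  have "outer_measure_space (Pow UNIV) ?H"
    unfolding outer_measure_space_def positive_def increasing_def countably_subadditive_def
    using hausdorff_outer_mono hausdorff_outer_UN_le by auto
  then have ms: "measure_space UNIV ?L ?H" by (rule P.caratheodory_lemma)
  then interpret L: sigma_algebra UNIV ?L by (simp add: measure_space_def)
  have "F \<in> ?L" if "closed F" for F
    using hausdorff_outer_closed_caratheodory[OF that, of d]
    by (simp add: lambda_system_def Compl_eq_Diff_UNIV[symmetric] Int_commute Diff_eq)
  then have "sets borel \<subseteq> ?L"
    using L.sigma_sets_subset[of "Collect closed"] sets_measure_of[of "Collect closed" UNIV]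
    unfolding borel_eq_closed by auto
  then show ?thesis
    using sets.sigma_algebra_axioms[of "borel :: 'a measure"] by (intro measure_down[OF ms]) simp_all
qed

lemma sets_hausdorff [simp, measurable_cong]: "sets (hausdorff_measure d) = sets borel"
  and space_hausdorff [simp]: "space (hausdorff_measure d) = UNIV"
  using sets.sigma_sets_eq[of borel] by (simp_all add: hausdorff_measure_def)

lemma emeasure_hausdorff:
  "A \<in> sets borel \<Longrightarrow> emeasure (hausdorff_measure d) A = hausdorff_outer_measure d A"
  unfolding hausdorff_measure_def using measure_space_hausdorff[of d] sets.sigma_sets_eq[of borel]
  by (intro emeasure_measure_of_sigma) (auto simp: measure_space_def)

lemma hausdorff_outer_Lipschitz:
  fixes f :: "'a::metric_space \<Rightarrow> 'b::metric_space"
  assumes L: "L > 0" and lip: "\<And>x y. x \<in> A \<Longrightarrow> y \<in> A \<Longrightarrow> dist (f x) (f y) \<le> L * dist x y"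
  shows "hausdorff_outer_measure d (f ` A) \<le> ennreal (L ^ d) * hausdorff_outer_measure d A"
proof -
  have "hausdorff_premeasure d \<delta> (f ` A) \<le> ennreal (L ^ d) * hausdorff_outer_measure d A" if \<delta>: "\<delta> > 0" for \<delta>
  proof -
    \<comment> \<open>The factor is finite and nonzero, so it can be carried across the infimum over
      covers by multiplying with its inverse and back.\<close>
    have inv: "ennreal (1 / L ^ d) * (ennreal (L ^ d) * a) = a" for a
      using L by (simp add: mult.assoc[symmetric] ennreal_mult'[symmetric])
    have *: "hausdorff_premeasure d \<delta> (f ` A) \<le> ennreal (L ^ d) * (\<Sum>i. hausdorff_gauge d (C i))"
      if C: "C \<in> hausdorff_covers (\<delta> / L) A" for C
    proof -
      \<comment> \<open>The covering sets are cut down to \<open>A\<close> first, because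
        \<open>f\<close> is Lipschitz only there.\<close>
      let ?D = "\<lambda>i. f ` (C i \<inter> A)"
      have bnd: "bounded (?D i) \<and> diameter (?D i) \<le> L * diameter (C i)" for i
      proof
        have Cb: "bounded (C i)" using C by (auto simp: hausdorff_covers_def)
        have le: "dist (f x) (f y) \<le> L * diameter (C i)" if "x \<in> C i \<inter> A" "y \<in> C i \<inter> A" for x y
        proof -
          have "dist (f x) (f y) \<le> L * dist x y" using that by (intro lip) auto
          also have "\<dots> \<le> L * diameter (C i)"
            using that L by (intro mult_left_mono diameter_bounded_bound Cb) auto
          finally show ?thesis .
        qed
        show "bounded (?D i)"
          unfolding bounded_two_points by (rule exI[of _ "L * diameter (C i)"]) (use le in auto)
        show "diameter (?D i) \<le> L * diameter (C i)"
        proof (cases "C i \<inter> A = {}")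
          case True then show ?thesis using L diameter_ge_0[OF Cb] by simp
        next
          case False
          have "(SUP (x, y)\<in>?D i \<times> ?D i. dist x y) \<le> L * diameter (C i)"
            using False by (intro cSUP_least) (auto intro!: le)
          with False show ?thesis by (simp add: diameter_def[of "?D i"])
        qed
      qed
      have gauge: "hausdorff_gauge d (?D i) \<le> ennreal (L ^ d) * hausdorff_gauge d (C i)" for i
      proof (cases "C i \<inter> A = {}")
        case False
        have "unit_ball_vol (real d) * (diameter (?D i) / 2) ^ d
            \<le> unit_ball_vol (real d) * (L * diameter (C i) / 2) ^ d"
          using bnd[of i] by (intro mult_left_mono power_mono divide_right_mono diameter_ge_0 divide_nonneg_pos) auto
        also have "\<dots> = L ^ d * (unit_ball_vol (real d) * (diameter (C i) / 2) ^ d)"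
          by (simp add: power_mult_distrib power_divide)
        finally show ?thesis using False L
          by (auto simp: hausdorff_gauge_def ennreal_mult'[symmetric] intro!: ennreal_leI)
      qed simp
      have "?D \<in> hausdorff_covers \<delta> (f ` A)"
        unfolding hausdorff_covers_def
      proof (safe, goal_cases)
        case (1 _ x)
        then obtain i where "x \<in> C i" using C by (auto simp: hausdorff_covers_def)
        then show ?case using 1 by blast
      next
        case (2 i) then show ?case using bnd by blast
      next
        case (3 i)
        have "diameter (?D i) \<le> L * diameter (C i)" using bnd by blast
        also have "\<dots> \<le> L * (\<delta> / L)" using C L by (intro mult_left_mono) (auto simp: hausdorff_covers_def)
        finally show ?case using L by simp
      qed
      then have "hausdorff_premeasure d \<delta> (f ` A) \<le> (\<Sum>i. hausdorff_gauge d (?D i))" by (rule hausdorff_premeasure_le)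
      also have "\<dots> \<le> (\<Sum>i. ennreal (L ^ d) * hausdorff_gauge d (C i))" by (intro suminf_le gauge) auto
      finally show ?thesis by simp
    qed
    then have "ennreal (1 / L ^ d) * hausdorff_premeasure d \<delta> (f ` A) \<le> hausdorff_premeasure d (\<delta> / L) A"
      unfolding hausdorff_premeasure_covers[of d "\<delta> / L"]
    proof (intro INF_greatest)
      fix C assume "C \<in> hausdorff_covers (\<delta> / L) A"
      from *[OF this]
      have "ennreal (1 / L ^ d) * hausdorff_premeasure d \<delta> (f ` A)
          \<le> ennreal (1 / L ^ d) * (ennreal (L ^ d) * (\<Sum>i. hausdorff_gauge d (C i)))"
        by (rule mult_left_mono) simp
      also have "\<dots> = (\<Sum>i. hausdorff_gauge d (C i))" by (rule inv)
      finally show "ennreal (1 / L ^ d) * hausdorff_premeasure d \<delta> (f ` A) \<le> (\<Sum>i. hausdorff_gauge d (C i))" .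
    qed
    then have "ennreal (L ^ d) * (ennreal (1 / L ^ d) * hausdorff_premeasure d \<delta> (f ` A))
        \<le> ennreal (L ^ d) * hausdorff_premeasure d (\<delta> / L) A" by (rule mult_left_mono) simp
    then have "hausdorff_premeasure d \<delta> (f ` A) \<le> ennreal (L ^ d) * hausdorff_premeasure d (\<delta> / L) A"
      by (simp only: mult.left_commute[of "ennreal (L ^ d)"] inv)
    also have "\<dots> \<le> ennreal (L ^ d) * hausdorff_outer_measure d A"
      using \<delta> L by (intro mult_left_mono hausdorff_premeasure_le_outer) auto
    finally show ?thesis .
  qed
  then show ?thesis unfolding hausdorff_outer_measure_def[of d "f ` A"] by (intro SUP_least) auto
qed

subsection \<open>Fibre integration and cone measures\<close>

definition hproj :: "'a::euclidean_space \<Rightarrow> 'a \<Rightarrow> 'a" where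
  "hproj u x = x - (x \<bullet> u) *\<^sub>R u"

lemma hproj_add: "hproj u (x + y) = hproj u x + hproj u y"
  and hproj_scaleR: "hproj u (c *\<^sub>R x) = c *\<^sub>R hproj u x"
  and hproj_diff: "hproj u (x - y) = hproj u x - hproj u y"
  and hproj_zero [simp]: "hproj u 0 = 0"
  by (simp_all add: hproj_def algebra_simps)

lemma hproj_self [simp]: "norm u = 1 \<Longrightarrow> hproj u u = 0"
  by (simp add: hproj_def dot_square_norm)

lemma inner_hproj_self [simp]: "norm u = 1 \<Longrightarrow> hproj u x \<bullet> u = 0"
  by (simp add: hproj_def algebra_simps dot_square_norm)

lemma hproj_hproj [simp]: "norm u = 1 \<Longrightarrow> hproj u (hproj u x) = hproj u x"
  by (simp add: hproj_def[of u "hproj u x"])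

lemma hproj_decomp: "x = hproj u x + (x \<bullet> u) *\<^sub>R u"
  by (simp add: hproj_def)

lemma hproj_idem: "x \<bullet> u = 0 \<Longrightarrow> hproj u x = x"
  by (simp add: hproj_def)

lemma continuous_hproj: "continuous_on S (hproj u)"
  unfolding hproj_def by (intro continuous_intros)

lemma measurable_hproj [measurable]: "hproj u \<in> borel_measurable borel"
  by (rule borel_measurable_continuous_onI[OF continuous_hproj])

lemma nn_integral_lborel_translate:
  fixes F :: "'a::euclidean_space \<Rightarrow> ennreal"
  assumes [measurable]: "F \<in> borel_measurable borel"
  shows "(\<integral>\<^sup>+x. F (x + c) \<partial>lborel) = (\<integral>\<^sup>+x. F x \<partial>lborel)"
proof -
  have "(\<integral>\<^sup>+x. F x \<partial>lborel) = (\<integral>\<^sup>+x. F x \<partial>distr lborel borel ((+) c))"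
    by (simp add: lborel_distr_plus)
  also have "\<dots> = (\<integral>\<^sup>+x. F (c + x) \<partial>lborel)" by (subst nn_integral_distr) simp_all
  finally show ?thesis by (simp add: add.commute)
qed

text \<open>Only translation invariance and Tonelli are used, so \<open>u\<close> need not be a coordinate direction.\<close>

lemma nn_integral_slab:
  fixes F :: "'a::euclidean_space \<Rightarrow> ennreal"
  assumes u: "norm u = 1" and [measurable]: "F \<in> borel_measurable borel"
  shows "(\<integral>\<^sup>+x. F x \<partial>lborel) =
    (\<integral>\<^sup>+x. indicator {x. 0 \<le> x \<bullet> u \<and> x \<bullet> u < 1} x * (\<integral>\<^sup>+s. F (hproj u x + s *\<^sub>R u) \<partial>lborel) \<partial>lborel)"
    (is "_ = ?R")
proof -
  let ?S = "{x. 0 \<le> x \<bullet> u \<and> x \<bullet> u < 1}"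
  have uu: "u \<bullet> u = 1" using u by (simp add: dot_square_norm)
  have [measurable]: "?S \<in> sets borel" by measurable
  have "?R = (\<integral>\<^sup>+x. indicator ?S x * (\<integral>\<^sup>+s. F (x + s *\<^sub>R u) \<partial>lborel) \<partial>lborel)"
  proof (rule nn_integral_cong)
    fix x
    have "(\<integral>\<^sup>+s. F (x + s *\<^sub>R u) \<partial>lborel) = (\<integral>\<^sup>+s. F (x + (s + - (x \<bullet> u)) *\<^sub>R u) \<partial>lborel)"
      by (subst nn_integral_lborel_translate[where F="\<lambda>s. F (x + s *\<^sub>R u)"]) auto
    then show "indicator ?S x * (\<integral>\<^sup>+s. F (hproj u x + s *\<^sub>R u) \<partial>lborel) =
        indicator ?S x * (\<integral>\<^sup>+s. F (x + s *\<^sub>R u) \<partial>lborel)"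
      by (simp add: hproj_def algebra_simps)
  qed
  also have "\<dots> = (\<integral>\<^sup>+x. \<integral>\<^sup>+s. indicator ?S x * F (x + s *\<^sub>R u) \<partial>lborel \<partial>lborel)"
    by (intro nn_integral_cong nn_integral_cmult[symmetric]) measurable
  also have "\<dots> = (\<integral>\<^sup>+s. \<integral>\<^sup>+x. indicator ?S x * F (x + s *\<^sub>R u) \<partial>lborel \<partial>lborel)"
    by (rule lborel_pair.Fubini') measurable
  also have "\<dots> = (\<integral>\<^sup>+s. \<integral>\<^sup>+x. indicator ?S (x - s *\<^sub>R u) * F x \<partial>lborel \<partial>lborel)"
  proof (rule nn_integral_cong)
    fix s :: real
    have "(\<integral>\<^sup>+x. indicator ?S (x - s *\<^sub>R u) * F x \<partial>lborel)
        = (\<integral>\<^sup>+x. indicator ?S (x + s *\<^sub>R u - s *\<^sub>R u) * F (x + s *\<^sub>R u) \<partial>lborel)"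
      by (subst nn_integral_lborel_translate[where F="\<lambda>x. indicator ?S (x - s *\<^sub>R u) * F x"]) auto
    then show "(\<integral>\<^sup>+x. indicator ?S x * F (x + s *\<^sub>R u) \<partial>lborel) = (\<integral>\<^sup>+x. indicator ?S (x - s *\<^sub>R u) * F x \<partial>lborel)"
      by simp
  qed
  also have "\<dots> = (\<integral>\<^sup>+x. \<integral>\<^sup>+s. indicator ?S (x - s *\<^sub>R u) * F x \<partial>lborel \<partial>lborel)"
    by (rule lborel_pair.Fubini'[symmetric]) measurable
  \<comment> \<open>For fixed \<open>x\<close> the slab indicator selects the \<open>s\<close> in a
    half-open interval of length 1.\<close>
  also have "\<dots> = (\<integral>\<^sup>+x. F x \<partial>lborel)"
  proof (rule nn_integral_cong)
    fix x
    have "(\<integral>\<^sup>+s. indicator ?S (x - s *\<^sub>R u) * F x \<partial>lborel) = (\<integral>\<^sup>+s. indicator {x \<bullet> u - 1<..x \<bullet> u} s \<partial>lborel) * F x"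
      by (subst nn_integral_multc[symmetric])
         (auto intro!: nn_integral_cong simp: indicator_def algebra_simps uu)
    also have "\<dots> = F x" by simp
    finally show "(\<integral>\<^sup>+s. indicator ?S (x - s *\<^sub>R u) * F x \<partial>lborel) = F x" .
  qed
  finally show ?thesis ..
qed

text \<open>Every line parallel to \<open>u\<close> is mapped to itself affinely with slope
  \<kappa>, so the one-dimensional substitution can be applied fibre by fibre. The cases \<kappa> =
  -1, \<kappa> = 1 and \<kappa> = \<open>w \<bullet> u\<close> give reflections, shears and the
  passage between two families of parallel hyperplanes.\<close>

lemma nn_integral_fibre_affine:
  fixes F :: "'a::euclidean_space \<Rightarrow> ennreal"
  assumes u: "norm u = 1" and [measurable]: "F \<in> borel_measurable borel" "\<tau> \<in> borel_measurable borel"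
    and \<kappa>: "\<kappa> \<noteq> 0"
  shows "ennreal \<bar>\<kappa>\<bar> * (\<integral>\<^sup>+x. F (hproj u x + (\<kappa> * (x \<bullet> u) + \<tau> (hproj u x)) *\<^sub>R u) \<partial>lborel) = (\<integral>\<^sup>+x. F x \<partial>lborel)"
proof -
  let ?S = "{x. 0 \<le> x \<bullet> u \<and> x \<bullet> u < 1}"
  have uu: "u \<bullet> u = 1" using u by (simp add: dot_square_norm)
  have [measurable]: "?S \<in> sets borel" by measurable
  let ?G = "\<lambda>x. F (hproj u x + (\<kappa> * (x \<bullet> u) + \<tau> (hproj u x)) *\<^sub>R u)"
  have "ennreal \<bar>\<kappa>\<bar> * (\<integral>\<^sup>+x. ?G x \<partial>lborel) =
      ennreal \<bar>\<kappa>\<bar> * (\<integral>\<^sup>+x. indicator ?S x * (\<integral>\<^sup>+s. ?G (hproj u x + s *\<^sub>R u) \<partial>lborel) \<partial>lborel)"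
    by (subst nn_integral_slab[OF u]) auto
  also have "\<dots> = (\<integral>\<^sup>+x. indicator ?S x * (ennreal \<bar>\<kappa>\<bar> * (\<integral>\<^sup>+s. ?G (hproj u x + s *\<^sub>R u) \<partial>lborel)) \<partial>lborel)"
    by (subst nn_integral_cmult[symmetric]) (auto intro!: nn_integral_cong simp: mult_ac)
  also have "\<dots> = (\<integral>\<^sup>+x. indicator ?S x * (\<integral>\<^sup>+s. F (hproj u x + s *\<^sub>R u) \<partial>lborel) \<partial>lborel)"
  proof (intro nn_integral_cong arg_cong2[where f="(*)"] refl)
    fix x
    have "(\<integral>\<^sup>+s. F (hproj u x + s *\<^sub>R u) \<partial>lborel) =
        ennreal \<bar>\<kappa>\<bar> * (\<integral>\<^sup>+s. F (hproj u x + (\<tau> (hproj u x) + \<kappa> * s) *\<^sub>R u) \<partial>lborel)"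
      by (rule nn_integral_real_affine) (use \<kappa> in auto)
    moreover have "?G (hproj u x + s *\<^sub>R u) = F (hproj u x + (\<tau> (hproj u x) + \<kappa> * s) *\<^sub>R u)" for s
      using u by (simp add: hproj_add hproj_scaleR inner_add_left uu add.commute)
    ultimately show "ennreal \<bar>\<kappa>\<bar> * (\<integral>\<^sup>+s. ?G (hproj u x + s *\<^sub>R u) \<partial>lborel) = (\<integral>\<^sup>+s. F (hproj u x + s *\<^sub>R u) \<partial>lborel)"
      by simp
  qed
  also have "\<dots> = (\<integral>\<^sup>+x. F x \<partial>lborel)" by (rule nn_integral_slab[OF u, symmetric]) simp
  finally show ?thesis .
qed

section \<open>Reflections in hyperplanes\<close>

definition reflection :: "'a::euclidean_space \<Rightarrow> 'a \<Rightarrow> 'a" where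
  "reflection u x = x - (2 * (x \<bullet> u)) *\<^sub>R u"

lemma linear_reflection: "linear (reflection u)"
  by (rule linearI) (simp_all add: reflection_def algebra_simps)

lemma reflection_reflection [simp]: "norm u = 1 \<Longrightarrow> reflection u (reflection u x) = x"
  by (simp add: reflection_def algebra_simps dot_square_norm)

lemma inner_reflection: "norm u = 1 \<Longrightarrow> reflection u x \<bullet> reflection u y = x \<bullet> y"
  by (simp add: reflection_def algebra_simps dot_square_norm inner_commute[of u y])

lemma inner_reflection': "reflection u x \<bullet> y = x \<bullet> reflection u y"
  unfolding reflection_def inner_diff_left inner_diff_right inner_scaleR_left inner_scaleR_right
  by (simp only: inner_commute[of u y] mult_ac)

lemma norm_reflection [simp]: "norm u = 1 \<Longrightarrow> norm (reflection u x) = norm x"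
  by (simp add: norm_eq_sqrt_inner inner_reflection)

lemma dist_reflection [simp]: "norm u = 1 \<Longrightarrow> dist (reflection u x) (reflection u y) = dist x y"
  by (simp add: dist_norm linear_diff[OF linear_reflection, symmetric])

lemma measurable_reflection [measurable]: "reflection u \<in> borel_measurable borel"
  unfolding reflection_def by measurable

lemma nn_integral_reflection:
  fixes F :: "'a::euclidean_space \<Rightarrow> ennreal"
  assumes u: "norm u = 1" and [measurable]: "F \<in> borel_measurable borel"
  shows "(\<integral>\<^sup>+x. F (reflection u x) \<partial>lborel) = (\<integral>\<^sup>+x. F x \<partial>lborel)"
proof -
  have "reflection u x = hproj u x + (-1 * (x \<bullet> u) + 0) *\<^sub>R u" for x
    unfolding reflection_def hproj_def mult_2 scaleR_add_left by simp
  then show ?thesis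
    using nn_integral_fibre_affine[OF u, of F "\<lambda>_. 0" "-1"] by simp
qed

text \<open>The mirror is orthogonal to \<open>u - v\<close>. This isometry carries the hyperplane
  with unit normal \<open>u\<close> to the one with unit normal \<open>v\<close>, and with it the
  constant comparing the two hyperplane measures.\<close>

lemma reflection_swap:
  fixes u v :: "'a::euclidean_space"
  assumes "norm u = norm v" "u \<noteq> v"
  shows "norm ((u - v) /\<^sub>R norm (u - v)) = 1" "reflection ((u - v) /\<^sub>R norm (u - v)) u = v"
proof -
  let ?m = "u - v"
  have n: "norm ?m > 0" using assms by simp
  show "norm (?m /\<^sub>R norm ?m) = 1" using n by simp
  have "2 * (u \<bullet> ?m) = ?m \<bullet> ?m"
    using assms(1) by (simp add: algebra_simps inner_commute norm_eq_sqrt_inner)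
  then have "2 * (u \<bullet> ?m) = (norm ?m)\<^sup>2" by (simp add: power2_norm_eq_inner)
  moreover have "(2 * (u \<bullet> (?m /\<^sub>R norm ?m))) *\<^sub>R (?m /\<^sub>R norm ?m) = (2 * (u \<bullet> ?m) / (norm ?m)\<^sup>2) *\<^sub>R ?m"
    by (simp add: power2_eq_square divide_inverse mult_ac del: inner_diff_right)
  ultimately have "(2 * (u \<bullet> (?m /\<^sub>R norm ?m))) *\<^sub>R (?m /\<^sub>R norm ?m) = ?m"
    using n by simp
  then show "reflection (?m /\<^sub>R norm ?m) u = v" unfolding reflection_def by simp
qed

text \<open>The measure on the hyperplane \<open>{y. w \<bullet> y = 1}\<close> that gives \<open>B\<close> the volume of the cone over
  \<open>B\<close> with apex \<open>0\<close>.\<close>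

definition cone_measure :: "'a::euclidean_space \<Rightarrow> 'a measure" where
  "cone_measure w = distr (restrict_space lborel {x. 0 < w \<bullet> x \<and> w \<bullet> x \<le> 1}) borel (\<lambda>x. x /\<^sub>R (w \<bullet> x))"

lemma sets_cone_measure [simp, measurable_cong]: "sets (cone_measure w) = sets borel"
  and space_cone_measure [simp]: "space (cone_measure w) = UNIV"
  by (simp_all add: cone_measure_def)

lemma nn_integral_cone_measure:
  assumes [measurable]: "F \<in> borel_measurable borel"
  shows "(\<integral>\<^sup>+y. F y \<partial>cone_measure w) =
    (\<integral>\<^sup>+x. indicator {x. 0 < w \<bullet> x \<and> w \<bullet> x \<le> 1} x * F (x /\<^sub>R (w \<bullet> x)) \<partial>lborel)"
proof -
  have [measurable]: "{x. 0 < w \<bullet> x \<and> w \<bullet> x \<le> 1} \<in> sets borel" by measurable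
  show ?thesis
    unfolding cone_measure_def
    by (subst nn_integral_distr)
       (auto simp: nn_integral_restrict_space mult.commute intro!: measurable_restrict_space1)
qed

lemma emeasure_cone_measure:
  assumes [measurable]: "B \<in> sets borel"
  shows "emeasure (cone_measure w) B = emeasure lborel {x. 0 < w \<bullet> x \<and> w \<bullet> x \<le> 1 \<and> x /\<^sub>R (w \<bullet> x) \<in> B}"
proof -
  have "emeasure (cone_measure w) B = (\<integral>\<^sup>+y. indicator B y \<partial>cone_measure w)" by simp
  also have "\<dots> = (\<integral>\<^sup>+x. indicator {x. 0 < w \<bullet> x \<and> w \<bullet> x \<le> 1} x * indicator B (x /\<^sub>R (w \<bullet> x)) \<partial>lborel)"
    by (rule nn_integral_cone_measure) simp
  also have "\<dots> = (\<integral>\<^sup>+x. indicator {x. 0 < w \<bullet> x \<and> w \<bullet> x \<le> 1 \<and> x /\<^sub>R (w \<bullet> x) \<in> B} x \<partial>lborel)"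
    by (intro nn_integral_cong) (auto split: split_indicator)
  also have "\<dots> = emeasure lborel {x. 0 < w \<bullet> x \<and> w \<bullet> x \<le> 1 \<and> x /\<^sub>R (w \<bullet> x) \<in> B}"
    by (rule nn_integral_indicator) measurable
  finally show ?thesis .
qed

lemma AE_cone_measure: "AE y in cone_measure w. w \<bullet> y = 1"
proof -
  have "{x. 0 < w \<bullet> x \<and> w \<bullet> x \<le> 1 \<and> x /\<^sub>R (w \<bullet> x) \<in> {y. w \<bullet> y \<noteq> 1}} = {}"
    by auto
  then have "emeasure (cone_measure w) {y. w \<bullet> y \<noteq> 1} = emeasure lborel ({}::'a set)"
    by (subst emeasure_cone_measure) (simp_all only:, measurable)
  then show ?thesis by (intro AE_I[of _ _ "{y. w \<bullet> y \<noteq> 1}"]) auto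
qed

text \<open>A translation by \<open>a\<close> within the hyperplane is induced by the shear
  \<open>x + (w \<bullet> x) *\<^sub>R a\<close>, which preserves both volume and the level
  \<open>w \<bullet> x\<close> and hence maps cones to cones. After normalising \<open>a\<close> it
  is a fibre map with \<kappa> = 1.\<close>

lemma cone_measure_translate:
  fixes F :: "'a::euclidean_space \<Rightarrow> ennreal"
  assumes [measurable]: "F \<in> borel_measurable borel" and a: "w \<bullet> a = 0"
  shows "(\<integral>\<^sup>+y. F (y + a) \<partial>cone_measure w) = (\<integral>\<^sup>+y. F y \<partial>cone_measure w)"
proof (cases "a = 0")
  case False
  define b where "b = a /\<^sub>R norm a"
  have b: "norm b = 1" and ab: "a = norm a *\<^sub>R b" using False by (simp_all add: b_def)
  have wb: "w \<bullet> b = 0" using a by (simp add: b_def)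
  let ?S = "{x. 0 < w \<bullet> x \<and> w \<bullet> x \<le> 1}"
  have [measurable]: "?S \<in> sets borel" by measurable
  define T where "T x = hproj b x + (1 * (x \<bullet> b) + norm a * (w \<bullet> hproj b x)) *\<^sub>R b" for x
  have wT: "w \<bullet> hproj b x = w \<bullet> x" for x using wb by (simp add: hproj_def inner_diff_right)
  have T: "T x = x + (w \<bullet> x) *\<^sub>R a" for x
  proof -
    have "T x = x + (w \<bullet> x) *\<^sub>R (norm a *\<^sub>R b)"
      unfolding T_def wT by (simp add: hproj_def algebra_simps)
    then show ?thesis unfolding ab[symmetric] .
  qed
  have "(\<integral>\<^sup>+y. F y \<partial>cone_measure w) = (\<integral>\<^sup>+x. indicator ?S x * F (x /\<^sub>R (w \<bullet> x)) \<partial>lborel)"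
    by (rule nn_integral_cone_measure) simp
  also have "\<dots> = (\<integral>\<^sup>+x. indicator ?S (T x) * F (T x /\<^sub>R (w \<bullet> T x)) \<partial>lborel)"
    using nn_integral_fibre_affine[OF b, of "\<lambda>x. indicator ?S x * F (x /\<^sub>R (w \<bullet> x))" "\<lambda>x. norm a * (w \<bullet> x)" 1]
    unfolding T_def by simp
  also have "\<dots> = (\<integral>\<^sup>+x. indicator ?S x * F (x /\<^sub>R (w \<bullet> x) + a) \<partial>lborel)"
    unfolding T using a by (intro nn_integral_cong) (auto simp: indicator_def inner_add_right scaleR_add_right)
  also have "\<dots> = (\<integral>\<^sup>+y. F (y + a) \<partial>cone_measure w)"
    by (subst nn_integral_cone_measure) auto
  finally show ?thesis ..
qed simp

text \<open>The linear map \<open>T\<close> keeps the projection along \<open>u\<close> and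
  satisfies \<open>u \<bullet> T x = w \<bullet> x\<close>, so it carries the cones of
  \<open>w\<close> to those of \<open>u\<close>. Its determinant is
  \<open>w \<bullet> u\<close>.\<close>

lemma cone_measure_change_direction:
  fixes F :: "'a::euclidean_space \<Rightarrow> ennreal"
  assumes u: "norm u = 1" and wu: "w \<bullet> u > 0" and [measurable]: "F \<in> borel_measurable borel"
  shows "ennreal (w \<bullet> u) * (\<integral>\<^sup>+y. F (hproj u y) \<partial>cone_measure w) = (\<integral>\<^sup>+y. F (hproj u y) \<partial>cone_measure u)"
proof -
  let ?S = "\<lambda>w. {x. 0 < w \<bullet> x \<and> w \<bullet> x \<le> 1}"
  have [measurable]: "?S w \<in> sets borel" for w :: 'a by measurable
  define T where "T x = hproj u x + ((w \<bullet> u) * (x \<bullet> u) + w \<bullet> hproj u x) *\<^sub>R u" for x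
  have T: "T x = hproj u x + (w \<bullet> x) *\<^sub>R u" for x
    by (simp add: T_def hproj_def algebra_simps)
  have uT: "u \<bullet> T x = w \<bullet> x" and hT: "hproj u (T x) = hproj u x" for x
    using u by (simp_all add: T inner_add_right inner_commute[of u "hproj u x"] dot_square_norm hproj_add hproj_scaleR)
  have "(\<integral>\<^sup>+y. F (hproj u y) \<partial>cone_measure u) = (\<integral>\<^sup>+x. indicator (?S u) x * F (hproj u (x /\<^sub>R (u \<bullet> x))) \<partial>lborel)"
    by (rule nn_integral_cone_measure) simp
  also have "\<dots> = ennreal (w \<bullet> u) * (\<integral>\<^sup>+x. indicator (?S u) (T x) * F (hproj u (T x /\<^sub>R (u \<bullet> T x))) \<partial>lborel)"
    using nn_integral_fibre_affine[OF u, of "\<lambda>x. indicator (?S u) x * F (hproj u (x /\<^sub>R (u \<bullet> x)))" "\<lambda>x. w \<bullet> x" "w \<bullet> u"] wu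
    unfolding T_def by simp
  also have "\<dots> = ennreal (w \<bullet> u) * (\<integral>\<^sup>+x. indicator (?S w) x * F (hproj u (x /\<^sub>R (w \<bullet> x))) \<partial>lborel)"
    by (simp only: uT hT hproj_scaleR indicator_def mem_Collect_eq)
  also have "\<dots> = ennreal (w \<bullet> u) * (\<integral>\<^sup>+y. F (hproj u y) \<partial>cone_measure w)"
    by (subst nn_integral_cone_measure[where F="\<lambda>y. F (hproj u y)"]) auto
  finally show ?thesis ..
qed

lemma emeasure_lborel_scale:
  fixes A :: "'a::euclidean_space set"
  assumes [measurable]: "A \<in> sets borel" and c: "c > 0"
  shows "emeasure lborel {x. x /\<^sub>R c \<in> A} = ennreal (c ^ DIM('a)) * emeasure lborel A"
proof -
  have "{x. x /\<^sub>R c \<in> A} = (\<lambda>x. 0 + c *\<^sub>R x) ` A"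
  proof (rule set_eqI)
    fix x show "x \<in> {x. x /\<^sub>R c \<in> A} \<longleftrightarrow> x \<in> (\<lambda>x. 0 + c *\<^sub>R x) ` A"
      using c by (auto simp: image_iff intro!: bexI[of _ "x /\<^sub>R c"])
  qed
  moreover have "{x. x /\<^sub>R c \<in> A} \<in> sets borel" by measurable
  ultimately show ?thesis
    using emeasure_lebesgue_affine[of c 0 A] c by (simp add: ennreal_power)
qed

lemma cone_measure_scale:
  fixes A :: "'a::euclidean_space set"
  assumes [measurable]: "A \<in> sets borel" and c: "c > 0"
  shows "emeasure (cone_measure (w /\<^sub>R c)) {y. y /\<^sub>R c \<in> A} = ennreal (c ^ DIM('a)) * emeasure (cone_measure w) A"
proof -
  have "emeasure (cone_measure (w /\<^sub>R c)) {y. y /\<^sub>R c \<in> A} =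
      emeasure lborel {x. x /\<^sub>R c \<in> {x. 0 < w \<bullet> x \<and> w \<bullet> x \<le> 1 \<and> x /\<^sub>R (w \<bullet> x) \<in> A}}"
    using c by (subst emeasure_cone_measure) (auto intro!: arg_cong[where f="emeasure lborel"] simp: mult_ac)
  also have "\<dots> = ennreal (c ^ DIM('a)) * emeasure (cone_measure w) A"
    using c by (subst emeasure_lborel_scale) (auto simp: emeasure_cone_measure)
  finally show ?thesis .
qed

lemma cone_measure_reflection:
  fixes A :: "'a::euclidean_space set"
  assumes m: "norm m = 1" and [measurable]: "A \<in> sets borel"
  shows "emeasure (cone_measure (reflection m w)) {y. reflection m y \<in> A} = emeasure (cone_measure w) A"
proof -
  let ?S = "\<lambda>w. {x. 0 < w \<bullet> x \<and> w \<bullet> x \<le> 1}"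
  have [measurable]: "?S w \<in> sets borel" for w :: 'a by measurable
  have "emeasure (cone_measure w) A = (\<integral>\<^sup>+y. indicator A y \<partial>cone_measure w)" by simp
  also have "\<dots> = (\<integral>\<^sup>+x. indicator (?S w) x * indicator A (x /\<^sub>R (w \<bullet> x)) \<partial>lborel)"
    by (rule nn_integral_cone_measure) simp
  also have "\<dots> = (\<integral>\<^sup>+x. indicator (?S w) (reflection m x) * indicator A (reflection m x /\<^sub>R (w \<bullet> reflection m x)) \<partial>lborel)"
    by (rule nn_integral_reflection[OF m, symmetric]) measurable
  also have "\<dots> = (\<integral>\<^sup>+x. indicator (?S (reflection m w)) x * indicator A (reflection m (x /\<^sub>R (reflection m w \<bullet> x))) \<partial>lborel)"
    by (intro nn_integral_cong)
       (simp add: indicator_def inner_reflection' linear_scale[OF linear_reflection])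
  also have "\<dots> = (\<integral>\<^sup>+y. indicator {y. reflection m y \<in> A} y \<partial>cone_measure (reflection m w))"
    by (subst nn_integral_cone_measure) (simp_all add: indicator_def)
  also have "\<dots> = emeasure (cone_measure (reflection m w)) {y. reflection m y \<in> A}"
    by (rule nn_integral_indicator) simp
  finally show ?thesis ..
qed

subsection \<open>Hausdorff measure on hyperplanes\<close>

text \<open>The uniqueness argument for Haar measure: integrate
  \<open>indicator A (x + (y - u)) * indicator B y\<close> in both orders and translate the inner
  variable. In an affine hyperplane only differences of points act as translations, so
  \<open>u\<close> plays the part of the origin and inversion becomes the point reflection
  \<open>2 *\<^sub>R u - x\<close>.\<close>

lemma translation_invariant_unique:
  fixes \<mu> \<nu> :: "'a::euclidean_space measure"
  assumes sf: "sigma_finite_measure \<mu>" "sigma_finite_measure \<nu>"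
    and [measurable_cong]: "sets \<mu> = sets borel" "sets \<nu> = sets borel"
    and ae: "AE x in \<mu>. w \<bullet> x = w \<bullet> u" "AE x in \<nu>. w \<bullet> x = w \<bullet> u"
    and inv: "\<And>F a. F \<in> borel_measurable borel \<Longrightarrow> w \<bullet> a = 0 \<Longrightarrow> (\<integral>\<^sup>+x. F (x + a) \<partial>\<mu>) = (\<integral>\<^sup>+x. F x \<partial>\<mu>)"
      "\<And>F a. F \<in> borel_measurable borel \<Longrightarrow> w \<bullet> a = 0 \<Longrightarrow> (\<integral>\<^sup>+x. F (x + a) \<partial>\<nu>) = (\<integral>\<^sup>+x. F x \<partial>\<nu>)"
    and [measurable]: "A \<in> sets borel" "B \<in> sets borel"
  shows "emeasure \<mu> A * emeasure \<nu> B = emeasure \<mu> {x. 2 *\<^sub>R u - x \<in> B} * emeasure \<nu> A"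
proof -
  interpret M: sigma_finite_measure \<mu> by fact
  interpret N: sigma_finite_measure \<nu> by fact
  interpret P: pair_sigma_finite \<mu> \<nu> ..
  let ?f = "\<lambda>S. indicator S :: 'a \<Rightarrow> ennreal"
  have "emeasure \<mu> A * emeasure \<nu> B = (\<integral>\<^sup>+y. (\<integral>\<^sup>+x. ?f A x \<partial>\<mu>) * ?f B y \<partial>\<nu>)"
    by (simp add: nn_integral_cmult)
  also have "\<dots> = (\<integral>\<^sup>+y. \<integral>\<^sup>+x. ?f A (x + (y - u)) * ?f B y \<partial>\<mu> \<partial>\<nu>)"
  proof (rule nn_integral_cong_AE, use ae(2) in eventually_elim)
    fix y assume y: "w \<bullet> y = w \<bullet> u"
    show "(\<integral>\<^sup>+x. ?f A x \<partial>\<mu>) * ?f B y = (\<integral>\<^sup>+x. ?f A (x + (y - u)) * ?f B y \<partial>\<mu>)"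
      using inv(1)[of "\<lambda>x. ?f A x" "y - u"] y
      by (subst nn_integral_multc) (auto simp: inner_diff_right)
  qed
  also have "\<dots> = (\<integral>\<^sup>+x. \<integral>\<^sup>+y. ?f A (x + (y - u)) * ?f B y \<partial>\<nu> \<partial>\<mu>)"
    by (rule P.Fubini') measurable
  also have "\<dots> = (\<integral>\<^sup>+x. \<integral>\<^sup>+y. ?f A y * ?f B (y - (x - u)) \<partial>\<nu> \<partial>\<mu>)"
  proof (rule nn_integral_cong_AE, use ae(1) in eventually_elim)
    fix x assume x: "w \<bullet> x = w \<bullet> u"
    show "(\<integral>\<^sup>+y. ?f A (x + (y - u)) * ?f B y \<partial>\<nu>) = (\<integral>\<^sup>+y. ?f A y * ?f B (y - (x - u)) \<partial>\<nu>)"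
      using inv(2)[of "\<lambda>y. ?f A y * ?f B (y - (x - u))" "x - u"] x
      by (simp add: inner_diff_right algebra_simps)
  qed
  also have "\<dots> = (\<integral>\<^sup>+y. \<integral>\<^sup>+x. ?f A y * ?f B (y - (x - u)) \<partial>\<mu> \<partial>\<nu>)"
    by (rule P.Fubini'[symmetric]) measurable
  also have "\<dots> = (\<integral>\<^sup>+y. emeasure \<mu> {x. 2 *\<^sub>R u - x \<in> B} * ?f A y \<partial>\<nu>)"
  proof (rule nn_integral_cong_AE, use ae(2) in eventually_elim)
    fix y assume y: "w \<bullet> y = w \<bullet> u"
    have "(\<integral>\<^sup>+x. ?f B (y - (x - u)) \<partial>\<mu>) = (\<integral>\<^sup>+x. ?f {x. 2 *\<^sub>R u - x \<in> B} x \<partial>\<mu>)"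
      using inv(1)[of "\<lambda>x. ?f B (y - (x - u))" "y - u"] y
      by (simp add: inner_diff_right algebra_simps scaleR_2 indicator_def)
    also have "\<dots> = emeasure \<mu> {x. 2 *\<^sub>R u - x \<in> B}" by (rule nn_integral_indicator) measurable
    finally show "(\<integral>\<^sup>+x. ?f A y * ?f B (y - (x - u)) \<partial>\<mu>) = emeasure \<mu> {x. 2 *\<^sub>R u - x \<in> B} * ?f A y"
      by (subst nn_integral_cmult) (auto simp: mult.commute)
  qed
  also have "\<dots> = emeasure \<mu> {x. 2 *\<^sub>R u - x \<in> B} * emeasure \<nu> A"
    by (simp add: nn_integral_cmult)
  finally show ?thesis .
qed

lemma hausdorff_premeasure_finite_cover:
  assumes I: "finite I" and cov: "A \<subseteq> (\<Union>i\<in>I. C i)"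
    and C: "\<And>i. i \<in> I \<Longrightarrow> bounded (C i)" "\<And>i. i \<in> I \<Longrightarrow> diameter (C i) \<le> \<delta>" and \<delta>: "\<delta> > 0"
  shows "hausdorff_premeasure d \<delta> A \<le> (\<Sum>i\<in>I. hausdorff_gauge d (C i))"
proof -
  from ex_bij_betw_nat_finite[OF I] obtain h where h: "bij_betw h {0..<card I} I" by blast
  define D where "D k = (if k < card I then C (h k) else {})" for k
  have hI: "h k \<in> I" if "k < card I" for k using h that by (auto simp: bij_betw_def)
  have "D \<in> hausdorff_covers \<delta> A"
    unfolding hausdorff_covers_def
  proof (intro CollectI conjI allI subsetI)
    fix x assume "x \<in> A"
    then obtain i where "i \<in> I" "x \<in> C i" using cov by blast
    moreover from \<open>i \<in> I\<close> obtain k where "k < card I" "h k = i"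
      using h unfolding bij_betw_def by (metis atLeastLessThan_iff imageE)
    ultimately show "x \<in> (\<Union>i. D i)" by (auto simp: D_def intro!: exI[of _ k])
  qed (use C hI \<delta> in \<open>auto simp: D_def\<close>)
  then have "hausdorff_premeasure d \<delta> A \<le> (\<Sum>k. hausdorff_gauge d (D k))" by (rule hausdorff_premeasure_le)
  also have "\<dots> = (\<Sum>k\<in>{0..<card I}. hausdorff_gauge d (D k))"
    by (rule suminf_finite) (auto simp: D_def)
  also have "\<dots> = (\<Sum>k\<in>{0..<card I}. hausdorff_gauge d (C (h k)))" by (rule sum.cong) (auto simp: D_def)
  also have "\<dots> = (\<Sum>i\<in>I. hausdorff_gauge d (C i))" by (rule sum.reindex_bij_betw[OF h])
  finally show ?thesis .
qed

text \<open>A grid of mesh \<open>2 * R / N\<close> covers the slice by \<open>N\<close> to the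
  power n-1 cubes. The gauge of each is at most a constant times \<open>1 / N\<close> to the same
  power, so the bound \<open>?c\<close> is the same at every scale.\<close>

lemma hausdorff_coordinate_slice_finite:
  fixes e :: "'a::euclidean_space"
  assumes e: "e \<in> Basis" and R: "R > 0"
  shows "hausdorff_outer_measure (DIM('a) - 1) {z. z \<bullet> e = 0 \<and> (\<forall>b\<in>Basis. \<bar>z \<bullet> b\<bar> < R)} < top"
    (is "hausdorff_outer_measure ?d ?Z < top")
proof -
  let ?n = "real DIM('a)"
  let ?B = "Basis - {e} :: 'a set"
  have cardB: "card ?B = ?d" using e by simp
  let ?c = "unit_ball_vol (real ?d) * (?n * R) ^ ?d"
  have "hausdorff_premeasure ?d \<delta> ?Z \<le> ennreal ?c" if \<delta>: "\<delta> > 0" for \<delta>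
  proof -
    obtain N :: nat where N: "?n * (2 * R) / \<delta> < real N" using reals_Archimedean2 by blast
    have "0 < ?n * (2 * R) / \<delta>" using \<delta> R by simp
    then have N0: "real N > 0" using N by linarith
    have Nd: "?n * (2 * R / real N) \<le> \<delta>" using N N0 \<delta> by (simp add: field_simps)
    define I where "I = Pi\<^sub>E ?B (\<lambda>_. {..<N})"
    define C where "C k = {z. z \<bullet> e = 0 \<and> (\<forall>b\<in>?B. - R + 2 * R / N * real (k b) \<le> z \<bullet> b \<and>
        z \<bullet> b \<le> - R + 2 * R / N * real (k b) + 2 * R / N)}" for k :: "'a \<Rightarrow> nat"
    have I: "finite I" "card I = N ^ ?d" by (auto simp: I_def card_PiE cardB intro!: finite_PiE)
    have dC: "norm (x - y) \<le> ?n * (2 * R / real N)" if "x \<in> C k" "y \<in> C k" for x y k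
    proof -
      have "norm (x - y) \<le> (\<Sum>b\<in>Basis. \<bar>(x - y) \<bullet> b\<bar>)" by (rule norm_le_l1)
      also have "\<dots> \<le> (\<Sum>b\<in>(Basis::'a set). 2 * R / real N)"
      proof (rule sum_mono)
        fix b :: 'a assume "b \<in> Basis"
        then show "\<bar>(x - y) \<bullet> b\<bar> \<le> 2 * R / real N"
        proof (cases "b = e")
          case False
          with \<open>b \<in> Basis\<close> have "b \<in> ?B" by simp
          with that have "- R + 2 * R / N * real (k b) \<le> x \<bullet> b" "x \<bullet> b \<le> - R + 2 * R / N * real (k b) + 2 * R / N"
            "- R + 2 * R / N * real (k b) \<le> y \<bullet> b" "y \<bullet> b \<le> - R + 2 * R / N * real (k b) + 2 * R / N"
            unfolding C_def by blast+
          then show ?thesis unfolding inner_diff_left abs_le_iff by linarith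
        qed (use that N0 R in \<open>simp add: C_def inner_diff_left\<close>)
      qed
      finally show ?thesis by simp
    qed
    have bC: "bounded (C k)" for k
      unfolding bounded_two_points dist_norm using dC by blast
    have diamC: "diameter (C k) \<le> ?n * (2 * R / real N)" for k
      using dC R N0 by (intro diameter_le) auto
    have cov: "?Z \<subseteq> (\<Union>k\<in>I. C k)"
    proof
      fix z assume z: "z \<in> ?Z"
      define k where "k = restrict (\<lambda>b. nat \<lfloor>(z \<bullet> b + R) * N / (2 * R)\<rfloor>) ?B"
      \<comment> \<open>The strict bound by \<open>R\<close> on the coordinates keeps the cell index
        below \<open>N\<close>.\<close>
      have zb: "0 \<le> (z \<bullet> b + R) * N / (2 * R) \<and> (z \<bullet> b + R) * N / (2 * R) < N" if "b \<in> ?B" for b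
      proof -
        have "- R < z \<bullet> b" "z \<bullet> b < R" using that z by (auto simp: abs_less_iff)
        then have "(z \<bullet> b + R) * N < (2 * R) * N" "0 \<le> (z \<bullet> b + R) * N" using N0 by auto
        then show ?thesis using R by (simp add: divide_less_eq mult.commute)
      qed
      have kb: "real (k b) \<le> (z \<bullet> b + R) * N / (2 * R)" "(z \<bullet> b + R) * N / (2 * R) < real (k b) + 1" if "b \<in> ?B" for b
        using zb[OF that] that by (auto simp: k_def)
      have "k \<in> I"
        unfolding I_def
      proof (rule PiE_I)
        fix b assume "b \<in> ?B"
        then have "real (k b) < real N" using kb(1) zb by fastforce
        then show "k b \<in> {..<N}" by simp
      qed (auto simp: k_def)
      moreover have "z \<in> C k"
      proof -
        have "- R + 2 * R / N * real (k b) \<le> z \<bullet> b \<and> z \<bullet> b \<le> - R + 2 * R / N * real (k b) + 2 * R / N" if "b \<in> ?B" for b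
        proof -
          have "2 * R / N * real (k b) \<le> 2 * R / N * ((z \<bullet> b + R) * N / (2 * R))"
            using kb(1)[OF that] R N0 by (intro mult_left_mono) auto
          moreover have "2 * R / N * ((z \<bullet> b + R) * N / (2 * R)) \<le> 2 * R / N * (real (k b) + 1)"
            using kb(2)[OF that] R N0 by (intro mult_left_mono) auto
          moreover have "2 * R / N * ((z \<bullet> b + R) * N / (2 * R)) = z \<bullet> b + R" using R N0 by simp
          moreover have "2 * R / N * (real (k b) + 1) = 2 * R / N * real (k b) + 2 * R / N"
            by (simp only: distrib_left mult_1_right)
          ultimately show ?thesis by linarith
        qed
        then show ?thesis using z by (simp add: C_def)
      qed
      ultimately show "z \<in> (\<Union>k\<in>I. C k)" by blast
    qed
    have "hausdorff_premeasure ?d \<delta> ?Z \<le> (\<Sum>k\<in>I. hausdorff_gauge ?d (C k))"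
      using Nd diamC by (intro hausdorff_premeasure_finite_cover I cov bC \<delta>) (meson order_trans)
    also have "\<dots> \<le> (\<Sum>k\<in>I. ennreal (unit_ball_vol (real ?d) * (?n * R / N) ^ ?d))"
    proof (rule sum_mono)
      fix k
      have "(diameter (C k) / 2) ^ ?d \<le> (?n * R / N) ^ ?d"
        using diamC[of k] by (intro power_mono divide_nonneg_pos diameter_ge_0 bC) (auto simp: field_simps)
      then show "hausdorff_gauge ?d (C k) \<le> ennreal (unit_ball_vol (real ?d) * (?n * R / N) ^ ?d)"
        by (auto simp: hausdorff_gauge_def intro!: ennreal_leI mult_left_mono)
    qed
    also have "\<dots> = ennreal (real (card I) * (unit_ball_vol (real ?d) * (?n * R / N) ^ ?d))"
      using R N0 by (subst sum_ennreal) (auto intro!: mult_nonneg_nonneg)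
    also have "real (card I) * (unit_ball_vol (real ?d) * (?n * R / N) ^ ?d) = ?c"
      using N0 by (simp add: I(2) power_divide)
    finally show ?thesis .
  qed
  then have "hausdorff_outer_measure ?d ?Z \<le> ennreal ?c"
    unfolding hausdorff_outer_measure_def by (intro SUP_least) auto
  also have "\<dots> < top" by simp
  finally show ?thesis .
qed

text \<open>Some coordinate of \<open>w\<close> is nonzero, so the hyperplane is the graph of a
  Lipschitz function over a coordinate hyperplane; \<open>g\<close> is the graph map and
  \<open>L\<close> its Lipschitz constant.\<close>

lemma hausdorff_hyperplane_bounded_finite:
  fixes w :: "'a::euclidean_space"
  assumes w: "w \<noteq> 0" and A: "bounded A" "A \<subseteq> {y. w \<bullet> y = c}"
  shows "hausdorff_outer_measure (DIM('a) - 1) A < top"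
proof -
  obtain e where e: "e \<in> Basis" "w \<bullet> e \<noteq> 0" using w euclidean_all_zero_iff[of w] by blast
  define g where "g z = z + ((c - w \<bullet> z) / (w \<bullet> e)) *\<^sub>R e" for z
  define L where "L = 1 + norm w / \<bar>w \<bullet> e\<bar>"
  obtain R where R: "R > 0" "\<And>x. x \<in> A \<Longrightarrow> norm x \<le> R" using A(1) bounded_pos by metis
  let ?Z = "{z. z \<bullet> e = 0 \<and> (\<forall>b\<in>Basis. \<bar>z \<bullet> b\<bar> < R + 1)}"
  have "A \<subseteq> g ` ?Z"
  proof
    fix x assume x: "x \<in> A"
    let ?z = "x - (x \<bullet> e) *\<^sub>R e"
    have ee: "e \<bullet> e = 1" using e by simp
    have "w \<bullet> x = c" using x A(2) by auto
    then have "c - w \<bullet> ?z = (x \<bullet> e) * (w \<bullet> e)" by (simp add: inner_diff_right)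
    then have "x = g ?z" using e(2) by (simp add: g_def)
    moreover have "?z \<in> ?Z"
    proof safe
      show "?z \<bullet> e = 0" by (simp add: inner_diff_left ee)
      fix b :: 'a assume b: "b \<in> Basis"
      have "\<bar>x \<bullet> b\<bar> \<le> R" using Basis_le_norm[OF b, of x] R(2)[OF x] by linarith
      then show "\<bar>?z \<bullet> b\<bar> < R + 1" using R(1) e(1) b
        by (cases "b = e") (simp_all add: inner_diff_left ee inner_not_same_Basis)
    qed
    ultimately show "x \<in> g ` ?Z" by blast
  qed
  then have "hausdorff_outer_measure (DIM('a) - 1) A \<le> hausdorff_outer_measure (DIM('a) - 1) (g ` ?Z)"
    by (rule hausdorff_outer_mono)
  also have "\<dots> \<le> ennreal (L ^ (DIM('a) - 1)) * hausdorff_outer_measure (DIM('a) - 1) ?Z"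
  proof (rule hausdorff_outer_Lipschitz)
    show "L > 0" unfolding L_def by (simp add: add_pos_nonneg)
    fix x y
    have "g x - g y = (x - y) - ((w \<bullet> (x - y)) / (w \<bullet> e)) *\<^sub>R e"
      by (simp add: g_def inner_diff_right algebra_simps diff_divide_distrib)
    then have "norm (g x - g y) \<le> norm (x - y) + norm (((w \<bullet> (x - y)) / (w \<bullet> e)) *\<^sub>R e)"
      by (metis norm_triangle_ineq4)
    also have "norm (((w \<bullet> (x - y)) / (w \<bullet> e)) *\<^sub>R e) \<le> norm w * norm (x - y) / \<bar>w \<bullet> e\<bar>"
      using e(1) Cauchy_Schwarz_ineq2[of w "x - y"] by (simp add: abs_div_pos divide_right_mono)
    finally show "dist (g x) (g y) \<le> L * dist x y" by (simp add: dist_norm L_def algebra_simps)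
  qed
  also have "\<dots> < top"
    using hausdorff_coordinate_slice_finite[OF e(1), of "R + 1"] R(1) by (simp add: ennreal_mult_less_top)
  finally show ?thesis .
qed

lemma hausdorff_outer_isometry:
  fixes f :: "'a::metric_space \<Rightarrow> 'b::metric_space"
  assumes "\<And>x y. dist (f x) (f y) = dist x y"
  shows "hausdorff_outer_measure d (f ` A) = hausdorff_outer_measure d A"
proof (rule antisym)
  show "hausdorff_outer_measure d (f ` A) \<le> hausdorff_outer_measure d A"
    using hausdorff_outer_Lipschitz[of 1 A f d] assms by simp
  have inj: "inj f" by (rule injI) (metis assms dist_eq_0_iff)
  have "dist (inv f x) (inv f y) = dist x y" if "x \<in> f ` A" "y \<in> f ` A" for x y
    using that assms by (auto simp: inv_f_f[OF inj])
  then have "hausdorff_outer_measure d (inv f ` f ` A) \<le> hausdorff_outer_measure d (f ` A)"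
    using hausdorff_outer_Lipschitz[of 1 "f ` A" "inv f" d] by simp
  then show "hausdorff_outer_measure d A \<le> hausdorff_outer_measure d (f ` A)"
    by (simp add: image_image inv_f_f[OF inj])
qed

lemma hausdorff_outer_scale:
  fixes A :: "'a::real_normed_vector set"
  assumes c: "c > 0"
  shows "hausdorff_outer_measure d ((\<lambda>x. c *\<^sub>R x) ` A) = ennreal (c ^ d) * hausdorff_outer_measure d A"
proof (rule antisym)
  have D: "dist (c *\<^sub>R x) (c *\<^sub>R y) = c * dist x y" if "c > 0" for c :: real and x y :: 'a
    using that by (simp add: dist_norm scaleR_diff_right[symmetric])
  show "hausdorff_outer_measure d ((\<lambda>x. c *\<^sub>R x) ` A) \<le> ennreal (c ^ d) * hausdorff_outer_measure d A"
    using c by (intro hausdorff_outer_Lipschitz) (auto simp: D)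
  have "hausdorff_outer_measure d ((\<lambda>x. (1/c) *\<^sub>R x) ` (\<lambda>x. c *\<^sub>R x) ` A)
      \<le> ennreal ((1/c) ^ d) * hausdorff_outer_measure d ((\<lambda>x. c *\<^sub>R x) ` A)"
    using c D[of "1/c"] by (intro hausdorff_outer_Lipschitz) auto
  then have "ennreal (c ^ d) * hausdorff_outer_measure d A
      \<le> ennreal (c ^ d) * (ennreal ((1/c) ^ d) * hausdorff_outer_measure d ((\<lambda>x. c *\<^sub>R x) ` A))"
    using c by (intro mult_left_mono) (simp_all add: image_image)
  also have "\<dots> = hausdorff_outer_measure d ((\<lambda>x. c *\<^sub>R x) ` A)"
    using c by (simp add: mult.assoc[symmetric] ennreal_mult[symmetric] power_mult_distrib[symmetric])
  finally show "ennreal (c ^ d) * hausdorff_outer_measure d A \<le> hausdorff_outer_measure d ((\<lambda>x. c *\<^sub>R x) ` A)" .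
qed

lemma emeasure_cone_measure_bounded:
  assumes w: "w \<noteq> 0" and [measurable]: "A \<in> sets borel" and A: "bounded A"
  shows "emeasure (cone_measure w) A < top"
proof -
  obtain R where R: "R > 0" "\<And>x. x \<in> A \<Longrightarrow> norm x \<le> R" using A(1) bounded_pos by metis
  have "{x. 0 < w \<bullet> x \<and> w \<bullet> x \<le> 1 \<and> x /\<^sub>R (w \<bullet> x) \<in> A} \<subseteq> cball 0 R"
  proof safe
    fix x assume x: "0 < w \<bullet> x" "w \<bullet> x \<le> 1" "x /\<^sub>R (w \<bullet> x) \<in> A"
    have "norm x = (w \<bullet> x) * norm (x /\<^sub>R (w \<bullet> x))" using x by simp
    also have "\<dots> \<le> 1 * R" using x R(2)[OF x(3)] by (intro mult_mono) simp_all
    finally show "x \<in> cball 0 R" by simp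
  qed
  then have "emeasure (cone_measure w) A \<le> emeasure lborel (cball (0::'a) R)"
    by (subst emeasure_cone_measure) (auto intro!: emeasure_mono)
  also have "\<dots> < top" using emeasure_bounded_finite[of "cball (0::'a) R"] by simp
  finally show ?thesis .
qed

lemma sigma_finite_bounded_borel:
  fixes M :: "'a::euclidean_space measure"
  assumes "sets M = sets borel" and "\<And>R. emeasure M (cball 0 R) < top"
  shows "sigma_finite_measure M"
proof
  have "space M = UNIV" using assms(1) sets_eq_imp_space_eq[of M borel] by simp
  moreover have "(\<Union>n::nat. cball (0::'a) (real n)) = UNIV"
    using real_arch_simple by (auto simp: dist_norm)
  ultimately show "\<exists>A. countable A \<and> A \<subseteq> sets M \<and> \<Union>A = space M \<and> (\<forall>a\<in>A. emeasure M a \<noteq> \<infinity>)"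
    using assms by (intro exI[of _ "range (\<lambda>n::nat. cball 0 (real n))"]) (auto simp: less_top)
qed

text \<open>Hausdorff measure restricted to the hyperplane and the cone measure are both
  \<sigma>-finite and invariant under translations within it. The reference set
  \<open>ball u 1\<close> is symmetric about \<open>u\<close>, so the point reflection in the
  uniqueness statement leaves it alone.\<close>

lemma hausdorff_hyperplane_unit:
  fixes u :: "'a::euclidean_space"
  assumes u: "norm u = 1" and [measurable]: "A \<in> sets borel"
  shows "hausdorff_outer_measure (DIM('a) - 1) (A \<inter> {y. u \<bullet> y = 1}) * emeasure (cone_measure u) (ball u 1)
    = hausdorff_outer_measure (DIM('a) - 1) (ball u 1 \<inter> {y. u \<bullet> y = 1}) * emeasure (cone_measure u) A"
proof -
  let ?H = "hausdorff_measure (DIM('a) - 1) :: 'a measure"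
  let ?P = "{y. u \<bullet> y = 1}"
  have u0: "u \<noteq> 0" using u by auto
  have [measurable]: "?P \<in> sets borel" by measurable
  define \<mu> where "\<mu> = density ?H (indicator ?P)"
  have mu: "emeasure \<mu> B = hausdorff_outer_measure (DIM('a) - 1) (B \<inter> ?P)" if [measurable]: "B \<in> sets borel" for B
    unfolding \<mu>_def using that
    by (subst emeasure_density) (auto simp: emeasure_hausdorff[symmetric] nn_integral_indicator[symmetric] indicator_inter_arith mult.commute
        simp del: nn_integral_indicator intro!: nn_integral_cong)
  have sets: "sets \<mu> = sets borel" by (simp add: \<mu>_def)
  have int: "(\<integral>\<^sup>+x. F (x + a) \<partial>\<mu>) = (\<integral>\<^sup>+x. F x \<partial>\<mu>)"
    if [measurable]: "F \<in> borel_measurable borel" and a: "u \<bullet> a = 0" for F :: "'a \<Rightarrow> ennreal" and a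
  proof -
    have "distr \<mu> borel (\<lambda>x. x + a) = \<mu>"
    proof (rule measure_eqI)
      fix B assume "B \<in> sets (distr \<mu> borel (\<lambda>x. x + a))"
      then have [measurable]: "B \<in> sets borel" by simp
      have S: "{x. x + a \<in> B} \<in> sets borel" by measurable
      have "emeasure (distr \<mu> borel (\<lambda>x. x + a)) B = emeasure \<mu> {x. x + a \<in> B}"
        using sets by (subst emeasure_distr) (auto simp: vimage_def \<mu>_def measurable_def)
      also have "\<dots> = hausdorff_outer_measure (DIM('a) - 1) ({x. x + a \<in> B} \<inter> ?P)" by (rule mu[OF S])
      also have "\<dots> = hausdorff_outer_measure (DIM('a) - 1) ((\<lambda>x. x + a) ` ({x. x + a \<in> B} \<inter> ?P))"
        by (rule hausdorff_outer_isometry[symmetric]) simp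
      also have "(\<lambda>x. x + a) ` ({x. x + a \<in> B} \<inter> ?P) = B \<inter> ?P"
        using a by (auto simp: inner_add_right image_iff intro!: bexI[of _ "_ - a"] simp: inner_diff_right)
      finally show "emeasure (distr \<mu> borel (\<lambda>x. x + a)) B = emeasure \<mu> B" by (simp add: mu)
    qed (simp add: sets)
    then have "(\<integral>\<^sup>+x. F x \<partial>\<mu>) = (\<integral>\<^sup>+x. F x \<partial>distr \<mu> borel (\<lambda>x. x + a))" by simp
    also have "\<dots> = (\<integral>\<^sup>+x. F (x + a) \<partial>\<mu>)"
      by (rule nn_integral_distr) (auto simp: measurable_cong_sets[OF sets])
    finally show ?thesis ..
  qed
  have "emeasure \<mu> A * emeasure (cone_measure u) (ball u 1) =
      emeasure \<mu> {x. 2 *\<^sub>R u - x \<in> ball u 1} * emeasure (cone_measure u) A"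
  proof (rule translation_invariant_unique[where w=u])
    show "sigma_finite_measure \<mu>"
    proof (rule sigma_finite_bounded_borel[OF sets])
      fix R show "emeasure \<mu> (cball 0 R) < top"
        unfolding mu[OF borel_closed[OF closed_cball]]
        by (rule hausdorff_hyperplane_bounded_finite[OF u0, of _ 1]) (auto intro: bounded_subset[OF bounded_cball])
    qed
    show "sigma_finite_measure (cone_measure u)"
      by (rule sigma_finite_bounded_borel) (auto intro!: emeasure_cone_measure_bounded u0)
    show "AE x in \<mu>. u \<bullet> x = u \<bullet> u"
      unfolding \<mu>_def using u by (subst AE_density) (auto simp: dot_square_norm indicator_def)
    show "AE x in cone_measure u. u \<bullet> x = u \<bullet> u" using AE_cone_measure[of u] u by (simp add: dot_square_norm)
  qed (auto simp: sets int cone_measure_translate)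
  moreover have "{x. 2 *\<^sub>R u - x \<in> ball u 1} = ball u 1"
    by (auto simp: dist_norm scaleR_2 algebra_simps norm_minus_commute)
  ultimately show ?thesis by (simp add: mu)
qed

lemma emeasure_lborel_open_pos:
  fixes x :: "'a::euclidean_space"
  assumes x: "x \<in> U" and U: "open U"
  shows "0 < emeasure lborel U"
proof -
  obtain e where e: "e > 0" "ball x e \<subseteq> U" using x U by (meson openE)
  have "0 < emeasure lborel (ball x e)" using e(1) by (simp add: emeasure_ball)
  also have "\<dots> \<le> emeasure lborel U" using e(2) U by (intro emeasure_mono) auto
  finally show ?thesis .
qed

text \<open>The cone contains an open neighbourhood of \<open>u / 2\<close>. Positivity allows
  division by the cone measure of the reference ball.\<close>

lemma cone_measure_ball_pos:
  fixes u :: "'a::euclidean_space"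
  assumes u: "norm u = 1"
  shows "emeasure (cone_measure u) (ball u 1) > 0"
proof -
  let ?U = "{x. 0 < u \<bullet> x \<and> u \<bullet> x < 1 \<and> norm (x - (u \<bullet> x) *\<^sub>R u) < u \<bullet> x}"
  have "(1/2) *\<^sub>R u \<in> ?U" using u by (simp add: dot_square_norm)
  moreover have "open ?U" by (intro open_Collect_conj open_Collect_less continuous_intros)
  ultimately have "0 < emeasure lborel ?U"
    by (rule emeasure_lborel_open_pos)
  also have "?U \<subseteq> {x. 0 < u \<bullet> x \<and> u \<bullet> x \<le> 1 \<and> x /\<^sub>R (u \<bullet> x) \<in> ball u 1}"
  proof safe
    fix x assume x: "0 < u \<bullet> x" "norm (x - (u \<bullet> x) *\<^sub>R u) < u \<bullet> x"
    have "norm (x /\<^sub>R (u \<bullet> x) - u) = norm ((x - (u \<bullet> x) *\<^sub>R u) /\<^sub>R (u \<bullet> x))"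
      using x(1) by (simp add: scaleR_diff_right)
    also have "\<dots> < 1" using x by (simp add: divide_simps)
    finally show "x /\<^sub>R (u \<bullet> x) \<in> ball u 1" by (simp add: dist_norm norm_minus_commute)
  qed simp
  then have "emeasure lborel ?U \<le> emeasure (cone_measure u) (ball u 1)"
    by (subst emeasure_cone_measure) (auto intro!: emeasure_mono)
  finally show ?thesis .
qed

lemma hausdorff_outer_reflection:
  "norm m = 1 \<Longrightarrow> hausdorff_outer_measure d {y. reflection m y \<in> A} = hausdorff_outer_measure d A"
proof -
  assume m: "norm m = 1"
  have "{y. reflection m y \<in> A} = reflection m ` A"
    using m by (auto simp: image_iff) (metis reflection_reflection)
  then show ?thesis using hausdorff_outer_isometry[of "reflection m" d A] m by simp
qed

text \<open>For unit vectors the ratio \<open>q\<close> of the two measures is the same in all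
  directions, because a reflection exchanges any two of them. Scaling by \<open>norm w\<close>
  multiplies Hausdorff measure by its power n-1 but cone volume by its power n; the surplus is the
  factor \<open>norm w\<close>.\<close>

lemma hausdorff_hyperplane:
  "\<exists>c<top. \<forall>w B. w \<noteq> (0::'a::euclidean_space) \<longrightarrow> B \<in> sets borel \<longrightarrow> B \<subseteq> {y. w \<bullet> y = 1} \<longrightarrow>
     hausdorff_outer_measure (DIM('a) - 1) B = c * ennreal (norm w) * emeasure (cone_measure w) B"
proof -
  let ?H = "hausdorff_outer_measure (DIM('a) - 1) :: 'a set \<Rightarrow> ennreal"
  let ?P = "\<lambda>u. {y. u \<bullet> y = 1}"
  define q where "q u = ?H (ball u 1 \<inter> ?P u) / emeasure (cone_measure u) (ball u 1)" for u
  have fin: "emeasure (cone_measure u) (ball u 1) \<noteq> top" "emeasure (cone_measure u) (ball u 1) \<noteq> 0"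
    if "norm u = 1" for u :: 'a
    using emeasure_cone_measure_bounded[of u "ball u 1"] cone_measure_ball_pos[OF that] that norm_zero by fastforce+
  have unit: "?H B = q u * emeasure (cone_measure u) B"
    if u: "norm u = 1" and B: "B \<in> sets borel" "B \<subseteq> ?P u" for u B
  proof -
    let ?b = "emeasure (cone_measure u) (ball u 1)"
    have "?H B * ?b = ?H (ball u 1 \<inter> ?P u) * emeasure (cone_measure u) B"
      using hausdorff_hyperplane_unit[OF u B(1)] B(2) by (simp add: Int_absorb2)
    then have "?H B * ?b / ?b = ?H (ball u 1 \<inter> ?P u) * emeasure (cone_measure u) B / ?b" by simp
    moreover have "?H B * ?b / ?b = ?H B" using fin[OF u] by (intro ennreal_mult_divide_eq)
    ultimately show ?thesis
      by (simp only: q_def divide_ennreal_def mult_ac)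
  qed
  have q_eq: "q u = q v" if u: "norm u = 1" and v: "norm v = 1" for u v
  proof (cases "u = v")
    case False
    define m where "m = (u - v) /\<^sub>R norm (u - v)"
    have m: "norm m = 1" and mu: "reflection m u = v"
      using reflection_swap[of u v] False u v by (auto simp: m_def)
    have b: "{y. reflection m y \<in> ball u 1} = ball v 1"
    proof -
      have "dist u (reflection m y) = dist v y" for y
        using dist_reflection[OF m, of u "reflection m y"] by (simp only: mu reflection_reflection[OF m])
      then show ?thesis by auto
    qed
    have P: "{y. reflection m y \<in> ball u 1 \<inter> ?P u} = ball v 1 \<inter> ?P v"
      using b mu inner_reflection'[of m u] by auto
    show ?thesis
      unfolding q_def using hausdorff_outer_reflection[OF m, of "DIM('a) - 1" "ball u 1 \<inter> ?P u"]
        cone_measure_reflection[OF m, of "ball u 1" u] b P mu by simp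
  qed simp
  obtain e :: 'a where e: "e \<in> Basis" by (meson nonempty_Basis ex_in_conv)
  have main: "?H B = q e * ennreal (norm w) * emeasure (cone_measure w) B"
    if w: "w \<noteq> 0" and [measurable]: "B \<in> sets borel" and B: "B \<subseteq> ?P w" for w B
  proof -
    let ?c = "norm w"
    have c: "?c > 0" using w by simp
    define u where "u = w /\<^sub>R ?c"
    have u: "norm u = 1" using w by (simp add: u_def)
    let ?B = "{y. y /\<^sub>R ?c \<in> B}"
    have im: "?B = (\<lambda>x. ?c *\<^sub>R x) ` B"
    proof (rule set_eqI)
      fix x show "x \<in> ?B \<longleftrightarrow> x \<in> (\<lambda>x. ?c *\<^sub>R x) ` B"
        using c by (auto simp: image_iff intro!: bexI[of _ "x /\<^sub>R ?c"])
    qed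
    have sub: "?B \<subseteq> ?P u"
    proof safe
      fix y assume "y /\<^sub>R ?c \<in> B"
      then have "w \<bullet> (y /\<^sub>R ?c) = 1" using B by blast
      then show "u \<bullet> y = 1" by (simp add: u_def)
    qed
    have Bm: "?B \<in> sets borel" by measurable
    have "ennreal (?c ^ (DIM('a) - 1)) * ?H B = ?H ?B"
      unfolding im by (rule hausdorff_outer_scale[OF c, symmetric])
    also have "\<dots> = q u * emeasure (cone_measure u) ?B" by (rule unit[OF u Bm sub])
    also have "emeasure (cone_measure u) ?B = ennreal (?c ^ DIM('a)) * emeasure (cone_measure w) B"
      unfolding u_def by (rule cone_measure_scale) (use c in auto)
    also have "q u = q e" by (rule q_eq) (use u e in auto)
    also have "?c ^ DIM('a) = ?c ^ (DIM('a) - 1) * ?c" by (simp add: power_eq_if mult.commute)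
    finally have "ennreal (?c ^ (DIM('a) - 1)) * ?H B =
        ennreal (?c ^ (DIM('a) - 1)) * (q e * ennreal ?c * emeasure (cone_measure w) B)"
      using c by (simp add: ennreal_mult mult_ac)
    then show ?thesis using c by (simp add: ennreal_mult_cancel_left)
  qed
  have ne: "norm e = 1" "e \<noteq> 0" using e nonzero_Basis by auto
  have "inverse (emeasure (cone_measure e) (ball e 1)) \<noteq> top"
    using fin(2)[OF ne(1)] by (simp add: ennreal_inverse_eq_top_iff)
  moreover have "?H (ball e 1 \<inter> ?P e) < top"
    by (rule hausdorff_hyperplane_bounded_finite[OF ne(2), of _ 1]) (auto intro: bounded_subset[OF bounded_ball])
  ultimately have "q e < top"
    unfolding q_def divide_ennreal_def ennreal_mult_less_top less_top by blast
  with main show ?thesis by blast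
qed

subsection \<open>Normals, gauge and regular boundary points\<close>

text \<open>The outer normals of \<open>K\<close> at \<open>x\<close>, scaled to lie on the boundary of the polar body.\<close>

definition dual_normals :: "'a::euclidean_space set \<Rightarrow> 'a \<Rightarrow> 'a set" where
  "dual_normals K x = {w. w \<bullet> x = 1 \<and> (\<forall>y\<in>K. w \<bullet> y \<le> 1)}"

definition dual_normal :: "'a::euclidean_space set \<Rightarrow> 'a \<Rightarrow> 'a" where
  "dual_normal K x = (THE w. w \<in> dual_normals K x)"

text \<open>Writing the gauge as the support function of the polar body makes its maximisers at a
  boundary point exactly the dual normals there.\<close>

definition minkowski_gauge :: "'a::euclidean_space set \<Rightarrow> 'a \<Rightarrow> real" where
  "minkowski_gauge K = support_function (polar_body K)"

definition radial :: "'a::euclidean_space set \<Rightarrow> 'a \<Rightarrow> 'a" where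
  "radial K x = x /\<^sub>R minkowski_gauge K x"

lemma dual_normals_polar: "w \<in> dual_normals K x \<longleftrightarrow> w \<in> polar_body K \<and> w \<bullet> x = 1"
  by (auto simp: dual_normals_def polar_body_def)

lemma support_function_attained:
  assumes "compact C" "C \<noteq> {}"
  obtains x where "x \<in> C" "v \<bullet> x = support_function C v" "\<And>y. y \<in> C \<Longrightarrow> v \<bullet> y \<le> support_function C v"
proof -
  have "continuous_on C (\<lambda>x. v \<bullet> x)" by (intro continuous_intros)
  from continuous_attains_sup[OF assms this] obtain x where x: "x \<in> C" "\<And>y. y \<in> C \<Longrightarrow> v \<bullet> y \<le> v \<bullet> x" by blast
  have "support_function C v = v \<bullet> x"
    unfolding support_function_def using x by (intro cSup_eq_maximum) auto
  with x that show thesis by metis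
qed

locale convex_body =
  fixes K :: "'a::euclidean_space set"
  assumes body: "K \<in> convex_bodies_o"
begin

lemma convex_K: "convex K" and compact_K: "compact K" and zero_interior: "0 \<in> interior K"
  using body by (auto simp: convex_bodies_o_def)

lemma closed_K: "closed K" using compact_K by (rule compact_imp_closed)

lemma zero_in: "0 \<in> K" using zero_interior interior_subset by blast

lemma inner_radius: obtains r where "r > 0" "cball 0 r \<subseteq> K"
  using zero_interior by (meson mem_interior_cball)

lemma outer_radius: obtains R where "R > 0" "\<And>x. x \<in> K \<Longrightarrow> norm x \<le> R"
  using compact_imp_bounded[OF compact_K] bounded_pos by metis

lemma polar_bounded: obtains B where "B > 0" "\<And>w. w \<in> polar_body K \<Longrightarrow> norm w \<le> B"
proof -
  obtain r where r: "r > 0" "cball 0 r \<subseteq> K" by (rule inner_radius)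
  have "norm w \<le> 1 / r" if w: "w \<in> polar_body K" for w
  proof (cases "w = 0")
    case False
    have "(r / norm w) *\<^sub>R w \<in> K" using r False by (intro subsetD[OF r(2)]) simp
    then have "w \<bullet> ((r / norm w) *\<^sub>R w) \<le> 1" using w by (auto simp: polar_body_def)
    then show ?thesis using False r(1) by (simp add: dot_square_norm power2_eq_square field_simps)
  qed (use r in simp)
  then show thesis using that[of "1 / r"] r(1) by simp
qed

lemma polar_compact: "compact (polar_body K)"
proof -
  have "polar_body K = (\<Inter>x\<in>K. {y. y \<bullet> x \<le> 1})" by (auto simp: polar_body_def)
  moreover have "closed (\<Inter>x\<in>K. {y. y \<bullet> x \<le> 1})"
    by (intro closed_INT ballI closed_Collect_le continuous_intros)
  moreover have "bounded (polar_body K)" by (metis bounded_iff polar_bounded)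
  ultimately show ?thesis by (simp add: compact_eq_bounded_closed)
qed

lemma zero_polar: "0 \<in> polar_body K" by (simp add: polar_body_def)

lemma gauge_attained: obtains w where "w \<in> polar_body K" "w \<bullet> x = minkowski_gauge K x"
  using support_function_attained[OF polar_compact, of x] zero_polar
  unfolding minkowski_gauge_def by (metis empty_iff inner_commute)

lemma gauge_ge: "w \<in> polar_body K \<Longrightarrow> w \<bullet> x \<le> minkowski_gauge K x"
  using support_function_attained[OF polar_compact, of x] zero_polar
  unfolding minkowski_gauge_def by (metis empty_iff inner_commute)

lemma gauge_scale: assumes "c \<ge> 0" shows "minkowski_gauge K (c *\<^sub>R x) = c * minkowski_gauge K x"
proof (rule antisym)
  obtain w where "w \<in> polar_body K" "w \<bullet> (c *\<^sub>R x) = minkowski_gauge K (c *\<^sub>R x)" by (rule gauge_attained)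
  then show "minkowski_gauge K (c *\<^sub>R x) \<le> c * minkowski_gauge K x" using gauge_ge[of w x] assms by (metis inner_scaleR_right mult_left_mono)
  obtain w where "w \<in> polar_body K" "w \<bullet> x = minkowski_gauge K x" by (rule gauge_attained)
  then show "c * minkowski_gauge K x \<le> minkowski_gauge K (c *\<^sub>R x)" using gauge_ge[of w "c *\<^sub>R x"] by simp
qed

lemma gauge_zero [simp]: "minkowski_gauge K 0 = 0" using gauge_scale[of 0 0] by simp

lemma gauge_pos: assumes "x \<noteq> 0" shows "minkowski_gauge K x > 0"
proof -
  obtain R where R: "R > 0" "\<And>x. x \<in> K \<Longrightarrow> norm x \<le> R" using outer_radius by blast
  let ?w = "(1 / (R * norm x)) *\<^sub>R x"
  have "?w \<in> polar_body K"
    unfolding polar_body_def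
  proof safe
    fix y assume y: "y \<in> K"
    have "x \<bullet> y \<le> norm x * norm y" by (rule norm_cauchy_schwarz)
    also have "\<dots> \<le> norm x * R" using R(2)[OF y] by (intro mult_left_mono) auto
    finally show "?w \<bullet> y \<le> 1" using assms R(1) by (simp add: field_simps)
  qed
  then have "?w \<bullet> x \<le> minkowski_gauge K x" by (rule gauge_ge)
  moreover have "?w \<bullet> x > 0" using assms R(1) by simp
  ultimately show ?thesis by linarith
qed

lemma gauge_nonneg: "minkowski_gauge K x \<ge> 0" using gauge_pos[of x] by (cases "x = 0") auto

lemma gauge_Lipschitz: obtains B where "B > 0" "\<And>x y. \<bar>minkowski_gauge K x - minkowski_gauge K y\<bar> \<le> B * norm (x - y)"
proof -
  obtain B where B: "B > 0" "\<And>w. w \<in> polar_body K \<Longrightarrow> norm w \<le> B" using polar_bounded by blast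
  have *: "minkowski_gauge K x - minkowski_gauge K y \<le> B * norm (x - y)" for x y
  proof -
    obtain w where w: "w \<in> polar_body K" "w \<bullet> x = minkowski_gauge K x" by (rule gauge_attained)
    have "minkowski_gauge K x - minkowski_gauge K y \<le> w \<bullet> (x - y)" using gauge_ge[OF w(1), of y] w by (simp add: inner_diff_right)
    also have "\<dots> \<le> norm w * norm (x - y)" by (rule norm_cauchy_schwarz)
    also have "\<dots> \<le> B * norm (x - y)" using B(2)[OF w(1)] by (intro mult_right_mono) auto
    finally show ?thesis .
  qed
  have "\<bar>minkowski_gauge K x - minkowski_gauge K y\<bar> \<le> B * norm (x - y)" for x y
    using *[of x y] *[of y x] by (simp add: abs_le_iff norm_minus_commute)
  with B(1) that show thesis by blast
qed

lemma continuous_gauge: "continuous_on S (minkowski_gauge K)"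
proof -
  obtain B where "B > 0" "\<And>x y. \<bar>minkowski_gauge K x - minkowski_gauge K y\<bar> \<le> B * norm (x - y)" using gauge_Lipschitz by blast
  then have "B-lipschitz_on S (minkowski_gauge K)" by (intro lipschitz_onI) (auto simp: dist_norm)
  then show ?thesis by (rule lipschitz_on_continuous_on)
qed

lemma measurable_gauge [measurable]: "minkowski_gauge K \<in> borel_measurable borel"
  by (rule borel_measurable_continuous_onI[OF continuous_gauge])

lemma measurable_radial [measurable]: "radial K \<in> borel_measurable borel"
  unfolding radial_def by measurable

text \<open>The bipolar theorem. A hyperplane separating \<open>x\<close> from \<open>K\<close> also
  separates it from 0, so \<open>b\<close> is negative and division by \<open>b\<close> turns the
  functional into an element of the polar body with value above 1 at \<open>x\<close>.\<close>

lemma in_iff_gauge: "x \<in> K \<longleftrightarrow> minkowski_gauge K x \<le> 1"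
proof
  assume x: "x \<in> K"
  obtain w where "w \<in> polar_body K" "w \<bullet> x = minkowski_gauge K x" by (rule gauge_attained)
  with x show "minkowski_gauge K x \<le> 1" by (auto simp: polar_body_def)
next
  assume g: "minkowski_gauge K x \<le> 1"
  show "x \<in> K"
  proof (rule ccontr)
    assume "x \<notin> K"
    then obtain a b where ab: "a \<bullet> x < b" "\<And>y. y \<in> K \<Longrightarrow> a \<bullet> y > b"
      using separating_hyperplane_closed_point[OF convex_K closed_K] by blast
    have b: "b < 0" using ab(2)[OF zero_in] by simp
    let ?w = "(1 / b) *\<^sub>R a"
    have "?w \<in> polar_body K" using ab(2) b by (auto simp: polar_body_def divide_simps less_imp_le)
    then have "?w \<bullet> x \<le> minkowski_gauge K x" by (rule gauge_ge)
    moreover have "?w \<bullet> x > 1" using ab(1) b by (simp add: divide_simps)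
    ultimately show False using g by linarith
  qed
qed

lemma frontier_gauge: "x \<in> frontier K \<longleftrightarrow> minkowski_gauge K x = 1"
proof
  assume x: "x \<in> frontier K"
  then have "x \<in> K" using closed_K by (auto simp: frontier_def)
  have "open {y. minkowski_gauge K y < 1}" by (intro open_Collect_less continuous_gauge continuous_on_const)
  moreover have "{y. minkowski_gauge K y < 1} \<subseteq> K" by (auto simp: in_iff_gauge)
  ultimately have "{y. minkowski_gauge K y < 1} \<subseteq> interior K" by (simp add: interior_maximal)
  with x \<open>x \<in> K\<close> show "minkowski_gauge K x = 1" by (force simp: frontier_def in_iff_gauge)
next
  assume g: "minkowski_gauge K x = 1"
  then have xK: "x \<in> K" by (simp add: in_iff_gauge)
  have "x \<notin> interior K"
  proof
    assume "x \<in> interior K"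
    then obtain e where e: "e > 0" "cball x e \<subseteq> K" by (meson mem_interior_cball)
    have x0: "x \<noteq> 0" using g by auto
    let ?y = "(1 + e / norm x) *\<^sub>R x"
    have "?y - x = (e / norm x) *\<^sub>R x" by (simp add: scaleR_add_left)
    then have "norm (?y - x) = e" using e(1) x0 by simp
    then have "?y \<in> K" using e(2) by (auto simp: dist_norm norm_minus_commute)
    then have "(1 + e / norm x) * minkowski_gauge K x \<le> 1"
      using e(1) gauge_scale[of "1 + e / norm x" x] by (simp add: in_iff_gauge)
    then show False using g e(1) x0 by (simp add: divide_le_0_iff)
  qed
  with xK show "x \<in> frontier K" using closed_K by (simp add: frontier_def)
qed

lemma frontier_in: "x \<in> frontier K \<Longrightarrow> x \<in> K" by (simp add: frontier_gauge in_iff_gauge)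

lemma dual_normals_ex: assumes "x \<in> frontier K" obtains w where "w \<in> dual_normals K x"
  using gauge_attained[of x] assms unfolding frontier_gauge dual_normals_polar by metis

lemma dual_normals_frontier: assumes "x \<in> K" "w \<in> dual_normals K x" shows "x \<in> frontier K"
  using assms gauge_ge[of w x] unfolding frontier_gauge dual_normals_polar in_iff_gauge by linarith

lemma radial_frontier: "x \<noteq> 0 \<Longrightarrow> radial K x \<in> frontier K"
  using gauge_pos[of x] gauge_scale[of "1 / minkowski_gauge K x" x] unfolding frontier_gauge radial_def
  by (simp add: divide_inverse)

lemma zero_not_frontier: "0 \<notin> frontier K" by (simp add: frontier_gauge)

lemma radial_frontier_iff: "radial K x \<in> frontier K \<longleftrightarrow> x \<noteq> 0"
  \<comment> \<open>At the origin the gauge is 0, and division by zero yields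
    \<open>radial K 0 = 0\<close>.\<close>
  using radial_frontier zero_not_frontier by (cases "x = 0") (auto simp: radial_def)

lemma dual_normal_nonzero: "w \<in> dual_normals K x \<Longrightarrow> w \<noteq> 0" by (auto simp: dual_normals_def)

text \<open>Since 0 is an interior point, \<open>v \<bullet> x\<close> is positive for every outer
  normal \<open>v\<close> at \<open>x\<close>, and dividing by it gives the dual normal.\<close>

lemma outer_unit_normals_eq:
  assumes x: "x \<in> frontier K"
  shows "outer_unit_normals K x = (\<lambda>w. w /\<^sub>R norm w) ` dual_normals K x"
proof (rule set_eqI, rule iffI)
  fix v assume v: "v \<in> outer_unit_normals K x"
  obtain r where r: "r > 0" "cball 0 r \<subseteq> K" by (rule inner_radius)
  have "r *\<^sub>R v \<in> K" using r v by (intro subsetD[OF r(2)]) (simp add: outer_unit_normals_def)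
  then have "v \<bullet> (r *\<^sub>R v) \<le> v \<bullet> x" using v by (auto simp: outer_unit_normals_def)
  then have vx: "v \<bullet> x > 0" using v r(1) by (simp add: outer_unit_normals_def dot_square_norm)
  let ?w = "v /\<^sub>R (v \<bullet> x)"
  have "?w \<in> dual_normals K x" using v vx by (auto simp: dual_normals_def outer_unit_normals_def divide_simps mult_ac)
  moreover have "v = ?w /\<^sub>R norm ?w" using v vx by (simp add: outer_unit_normals_def)
  ultimately show "v \<in> (\<lambda>w. w /\<^sub>R norm w) ` dual_normals K x" by blast
next
  fix v assume "v \<in> (\<lambda>w. w /\<^sub>R norm w) ` dual_normals K x"
  then obtain w where w: "w \<in> dual_normals K x" and v: "v = w /\<^sub>R norm w" by blast
  have "w \<noteq> 0" using w by (rule dual_normal_nonzero)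
  then show "v \<in> outer_unit_normals K x" using w unfolding v
    by (auto simp: outer_unit_normals_def dual_normals_def divide_simps)
qed

text \<open>The condition \<open>w \<bullet> x = 1\<close> recovers the length of \<open>w\<close>
  from its direction, so uniqueness of unit normals and of dual normals is the same thing.\<close>

lemma normalize_dual_inj: "inj_on (\<lambda>w. w /\<^sub>R norm w) (dual_normals K x)"
proof (rule inj_onI)
  fix w1 w2 assume w: "w1 \<in> dual_normals K x" "w2 \<in> dual_normals K x" and eq: "w1 /\<^sub>R norm w1 = w2 /\<^sub>R norm w2"
  have "(w1 /\<^sub>R norm w1) \<bullet> x = 1 / norm w1" "(w2 /\<^sub>R norm w2) \<bullet> x = 1 / norm w2"
    using w by (auto simp: dual_normals_def divide_inverse)
  then have "norm w1 = norm w2" using eq by simp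
  then show "w1 = w2" using eq dual_normal_nonzero[OF w(1)] dual_normal_nonzero[OF w(2)] by simp
qed

lemma regular_boundary_iff:
  "x \<in> regular_boundary K \<longleftrightarrow> x \<in> frontier K \<and> (\<exists>w. dual_normals K x = {w})"
proof -
  have "(\<exists>!v. v \<in> outer_unit_normals K x) \<longleftrightarrow> (\<exists>w. dual_normals K x = {w})" if x: "x \<in> frontier K"
  proof -
    have "(\<exists>!v. v \<in> outer_unit_normals K x) \<longleftrightarrow> is_singleton (outer_unit_normals K x)"
      unfolding is_singleton_def set_eq_iff by (simp add: Ex1_def) (metis)
    also have "\<dots> \<longleftrightarrow> is_singleton (dual_normals K x)"
      unfolding outer_unit_normals_eq[OF x] is_singleton_altdef by (simp add: card_image[OF normalize_dual_inj])
    finally show ?thesis by (simp add: is_singleton_def)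
  qed
  then show ?thesis by (auto simp: regular_boundary_def)
qed

lemma regular_frontier: "x \<in> regular_boundary K \<Longrightarrow> x \<in> frontier K" by (simp add: regular_boundary_def)

lemma regular_dual_normals: "x \<in> regular_boundary K \<Longrightarrow> dual_normals K x = {dual_normal K x}"
  unfolding regular_boundary_iff dual_normal_def by auto

lemma dual_normal_in: "x \<in> regular_boundary K \<Longrightarrow> dual_normal K x \<in> dual_normals K x"
  using regular_dual_normals by blast

lemma dual_normal_unique: "x \<in> regular_boundary K \<Longrightarrow> w \<in> dual_normals K x \<Longrightarrow> w = dual_normal K x"
  using regular_dual_normals by blast

lemma gauss_map_eq: assumes x: "x \<in> regular_boundary K"
  shows "gauss_map K x = dual_normal K x /\<^sub>R norm (dual_normal K x)"
proof -
  have "outer_unit_normals K x = {dual_normal K x /\<^sub>R norm (dual_normal K x)}"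
    using outer_unit_normals_eq[OF regular_frontier[OF x]] regular_dual_normals[OF x] by simp
  then show ?thesis unfolding gauss_map_def by simp
qed

lemma support_gauss_map: assumes x: "x \<in> regular_boundary K"
  shows "support_function K (gauss_map K x) = 1 / norm (dual_normal K x)"
proof -
  let ?w = "dual_normal K x"
  have w: "?w \<in> dual_normals K x" by (rule dual_normal_in[OF x])
  have xK: "x \<in> K" using frontier_in regular_frontier x by blast
  have "(SUP y\<in>K. gauss_map K x \<bullet> y) = gauss_map K x \<bullet> x"
    using xK w dual_normal_nonzero[OF w] unfolding gauss_map_eq[OF x]
    by (intro cSup_eq_maximum) (auto simp: dual_normals_def divide_simps)
  then show ?thesis using w unfolding support_function_def gauss_map_eq[OF x]
    by (simp add: dual_normals_def divide_inverse)
qed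

text \<open>The source of all semicontinuity and measurability of normals below: sets of boundary
  points defined by closed conditions on their normals are projections of compact sets.\<close>

lemma dual_normals_closed_graph:
  "compact {(x, w). x \<in> K \<and> w \<in> polar_body K \<and> w \<bullet> x = 1}"
proof -
  have "{(x, w). x \<in> K \<and> w \<in> polar_body K \<and> w \<bullet> x = 1} = (K \<times> polar_body K) \<inter> {p. snd p \<bullet> fst p = 1}"
    by auto
  moreover have "closed {p::'a \<times> 'a. snd p \<bullet> fst p = 1}" by (intro closed_Collect_eq continuous_intros)
  ultimately show ?thesis using compact_K polar_compact by (simp add: compact_Int_closed compact_Times)
qed

text \<open>The points having some dual normal at distance at least \<epsilon> from the one at
  \<open>x0\<close> form a compact set, and that set misses \<open>x0\<close>. The estimate covers
  all dual normals at nearby points, regular or not.\<close>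

lemma dual_normals_continuous:
  assumes x0: "x0 \<in> regular_boundary K" and \<epsilon>: "\<epsilon> > 0"
  obtains \<delta> where "\<delta> > 0"
    "\<And>x w. x \<in> K \<Longrightarrow> dist x x0 < \<delta> \<Longrightarrow> w \<in> dual_normals K x \<Longrightarrow> norm (w - dual_normal K x0) < \<epsilon>"
proof -
  let ?w0 = "dual_normal K x0"
  let ?G = "{(x, w). x \<in> K \<and> w \<in> polar_body K \<and> w \<bullet> x = 1}"
  let ?C = "?G \<inter> {p. \<epsilon> \<le> norm (snd p - ?w0)}"
  have "closed {p::'a \<times> 'a. \<epsilon> \<le> norm (snd p - ?w0)}" by (intro closed_Collect_le continuous_intros)
  then have cC: "compact (fst ` ?C)"
    by (intro compact_continuous_image compact_Int_closed dual_normals_closed_graph continuous_intros)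
  define C where "C = fst ` ?C"
  have C_iff: "x \<in> C \<longleftrightarrow> (\<exists>w. x \<in> K \<and> w \<in> dual_normals K x \<and> \<epsilon> \<le> norm (w - ?w0))" for x
    unfolding C_def dual_normals_polar by (force simp: image_iff)
  have "closed C" unfolding C_def using cC by (rule compact_imp_closed)
  moreover have "x0 \<notin> C"
    unfolding C_iff using dual_normal_unique[OF x0] \<epsilon> by (metis norm_zero not_le right_minus_eq)
  ultimately have "open (- C)" "x0 \<in> - C" by auto
  from openE[OF this] obtain \<delta> where \<delta>: "\<delta> > 0" "ball x0 \<delta> \<subseteq> - C" .
  show thesis
  proof (rule that[OF \<delta>(1)])
    fix x w assume x: "x \<in> K" "dist x x0 < \<delta>" "w \<in> dual_normals K x"
    then have "x \<notin> C" using \<delta>(2) by (auto simp: dist_commute)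
    then show "norm (w - ?w0) < \<epsilon>" unfolding C_iff using x by (meson not_le)
  qed
qed

lemma continuous_dual_normal: "continuous_on (regular_boundary K) (dual_normal K)"
  unfolding continuous_on_iff
proof safe
  fix x0 and e :: real assume x0: "x0 \<in> regular_boundary K" and e: "e > 0"
  from dual_normals_continuous[OF this] obtain \<delta> where "\<delta> > 0"
    "\<And>x w. x \<in> K \<Longrightarrow> dist x x0 < \<delta> \<Longrightarrow> w \<in> dual_normals K x \<Longrightarrow> norm (w - dual_normal K x0) < e" by blast
  then show "\<exists>d>0. \<forall>x\<in>regular_boundary K. dist x x0 < d \<longrightarrow> dist (dual_normal K x) (dual_normal K x0) < e"
    using dual_normal_in frontier_in regular_frontier by (metis dist_norm)
qed

text \<open>The non-regular frontier points are the union of the compact sets \<open>S m\<close> of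
  points with two dual normals at distance at least 1/(m+1).\<close>

lemma regular_borel [measurable]: "regular_boundary K \<in> sets borel"
proof -
  let ?G = "{(x, w). x \<in> K \<and> w \<in> polar_body K \<and> w \<bullet> x = 1}"
  define S where "S m = (\<lambda>p. fst (fst p)) `
    ((?G \<times> ?G) \<inter> {p. fst (fst p) = fst (snd p) \<and> 1 / real (Suc m) \<le> norm (snd (fst p) - snd (snd p))})" for m
  have S_mem: "x \<in> S m \<longleftrightarrow> (\<exists>w1 w2. x \<in> K \<and> w1 \<in> dual_normals K x \<and> w2 \<in> dual_normals K x \<and> 1 / real (Suc m) \<le> norm (w1 - w2))" for x m
    unfolding S_def dual_normals_polar by (force simp: image_iff)
  have "closed {p::('a \<times> 'a) \<times> ('a \<times> 'a). fst (fst p) = fst (snd p) \<and> 1 / real (Suc m) \<le> norm (snd (fst p) - snd (snd p))}" for m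
    by (intro closed_Collect_conj closed_Collect_le closed_Collect_eq continuous_intros)
  then have "compact (S m)" for m
    unfolding S_def
    by (intro compact_continuous_image compact_Int_closed compact_Times dual_normals_closed_graph continuous_intros)
  then have [measurable]: "S m \<in> sets borel" for m by (simp add: compact_imp_closed borel_closed)
  have "regular_boundary K = frontier K - (\<Union>m. S m)"
  proof (rule set_eqI, rule iffI)
    fix x assume x: "x \<in> regular_boundary K"
    have "x \<notin> S m" for m
    proof
      assume "x \<in> S m"
      then obtain w1 w2 where w: "w1 \<in> dual_normals K x" "w2 \<in> dual_normals K x" "1 / real (Suc m) \<le> norm (w1 - w2)"
        unfolding S_mem by blast
      then have "1 / real (Suc m) \<le> 0" using dual_normal_unique[OF x] by (metis norm_zero right_minus_eq)
      then show False by simp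
    qed
    then show "x \<in> frontier K - (\<Union>m. S m)" using regular_frontier[OF x] by blast
  next
    fix x assume x: "x \<in> frontier K - (\<Union>m. S m)"
    then obtain w where w: "w \<in> dual_normals K x" using dual_normals_ex by blast
    have "w' = w" if w': "w' \<in> dual_normals K x" for w'
    proof (rule ccontr)
      assume "w' \<noteq> w"
      then have "0 < norm (w - w')" by simp
      then obtain m where "1 / real (Suc m) < norm (w - w')" using reals_Archimedean by (metis inverse_eq_divide)
      then have "x \<in> S m" unfolding S_mem using w w' x frontier_in by (intro exI[of _ w] exI[of _ w']) auto
      then show False using x by blast
    qed
    then have "dual_normals K x = {w}" using w by blast
    then show "x \<in> regular_boundary K" unfolding regular_boundary_iff using x by blast
  qed
  moreover have "frontier K \<in> sets borel" by (simp add: borel_closed)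
  ultimately show ?thesis by simp
qed

text \<open>Off the regular boundary the definite description in \<open>dual_normal\<close> is
  unspecified; prescribing the value 0 there gives a Borel function on the whole space.\<close>

lemma measurable_dual_normal [measurable]:
  "(\<lambda>x. if x \<in> regular_boundary K then dual_normal K x else 0) \<in> borel_measurable borel"
  using borel_measurable_continuous_on_restrict[OF continuous_dual_normal]
  by (subst measurable_restrict_space_iff[symmetric]) auto

text \<open>A dual normal \<open>w\<close> at \<open>y\<close> satisfies
  \<open>w \<bullet> (x - y) \<le> 0\<close> for all \<open>x\<close> in \<open>K\<close> and is
  close to the one at \<open>x0\<close>; exchanging \<open>x\<close> and \<open>y\<close> gives the
  other sign. Because the estimate concerns pairs of points, it controls Lipschitz constants of
  projections to the tangent plane.\<close>

lemma boundary_flat: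
  assumes x0: "x0 \<in> regular_boundary K" and \<epsilon>: "\<epsilon> > 0"
  obtains \<delta> where "\<delta> > 0"
    "\<And>x y. x \<in> frontier K \<Longrightarrow> y \<in> frontier K \<Longrightarrow> dist x x0 < \<delta> \<Longrightarrow> dist y x0 < \<delta> \<Longrightarrow>
       \<bar>dual_normal K x0 \<bullet> (x - y)\<bar> \<le> \<epsilon> * norm (x - y)"
proof -
  let ?w = "dual_normal K x0"
  obtain \<delta> where \<delta>: "\<delta> > 0"
    "\<And>x w. x \<in> K \<Longrightarrow> dist x x0 < \<delta> \<Longrightarrow> w \<in> dual_normals K x \<Longrightarrow> norm (w - ?w) < \<epsilon>"
    using dual_normals_continuous[OF assms] by blast
  have *: "?w \<bullet> (x - y) \<le> \<epsilon> * norm (x - y)"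
    if x: "x \<in> frontier K" and y: "y \<in> frontier K" "dist y x0 < \<delta>" for x y
  proof -
    obtain w where w: "w \<in> dual_normals K y" using dual_normals_ex y by blast
    have "w \<bullet> (x - y) \<le> 0" using w frontier_in[OF x] by (auto simp: dual_normals_def inner_diff_right)
    moreover have "(?w - w) \<bullet> (x - y) \<le> norm (?w - w) * norm (x - y)" by (rule norm_cauchy_schwarz)
    moreover have "norm (?w - w) * norm (x - y) \<le> \<epsilon> * norm (x - y)"
      using \<delta>(2)[OF frontier_in[OF y(1)] y(2) w] by (intro mult_right_mono) (auto simp: norm_minus_commute)
    ultimately show ?thesis by (simp add: inner_diff_left)
  qed
  show thesis
  proof (rule that[OF \<delta>(1)])
    fix x y assume "x \<in> frontier K" "y \<in> frontier K" "dist x x0 < \<delta>" "dist y x0 < \<delta>"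
    then show "\<bar>?w \<bullet> (x - y)\<bar> \<le> \<epsilon> * norm (x - y)"
      using *[of x y] *[of y x] by (auto simp: abs_le_iff norm_minus_commute inner_diff_right)
  qed
qed

end

section \<open>Comparing two measures by local estimates\<close>

lemma ennreal_le_all_factors:
  fixes a b :: ennreal
  assumes "\<And>\<theta>::real. \<theta> > 1 \<Longrightarrow> a \<le> ennreal \<theta> * b"
  shows "a \<le> b"
proof (cases b rule: ennreal_cases)
  case (real v)
  show ?thesis
  proof (rule ennreal_le_epsilon)
    fix e :: real assume e: "e > 0"
    \<comment> \<open>The summand 1 in the denominator covers the case \<open>v = 0\<close>.\<close>
    let ?t = "1 + e / (v + 1)"
    have "a \<le> ennreal ?t * b" using e real by (intro assms) simp
    also have "\<dots> = ennreal (v + e * (v / (v + 1)))" using e real by (simp add: ennreal_mult[symmetric] algebra_simps)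
    also have "\<dots> \<le> ennreal (v + e * 1)" using e real by (intro ennreal_leI add_left_mono mult_left_mono) auto
    also have "\<dots> = b + ennreal e" using e real by simp
    finally show "a \<le> b + ennreal e" .
  qed
qed simp

text \<open>By Lindelof countably many of the neighbourhoods cover \<open>S\<close>. Cutting
  \<open>A\<close> into disjoint pieces along them preserves the factor \<theta>, which then tends
  to 1.\<close>

lemma local_measure_comparison:
  fixes \<mu> \<nu> :: "'a::second_countable_topology measure"
  assumes sets: "sets \<mu> = sets borel" "sets \<nu> = sets borel"
    and loc: "\<And>\<theta> x. \<theta> > 1 \<Longrightarrow> x \<in> S \<Longrightarrow>
      \<exists>N. open N \<and> x \<in> N \<and> (\<forall>A\<in>sets borel. A \<subseteq> S \<inter> N \<longrightarrow> emeasure \<mu> A \<le> ennreal \<theta> * emeasure \<nu> A)"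
    and A: "A \<in> sets borel" "A \<subseteq> S"
  shows "emeasure \<mu> A \<le> emeasure \<nu> A"
proof (rule ennreal_le_all_factors)
  fix \<theta> :: real assume "\<theta> > 1"
  then obtain N where N: "\<And>x. x \<in> S \<Longrightarrow> open (N x)" "\<And>x. x \<in> S \<Longrightarrow> x \<in> N x"
    "\<And>x A. x \<in> S \<Longrightarrow> A \<in> sets borel \<Longrightarrow> A \<subseteq> S \<inter> N x \<Longrightarrow> emeasure \<mu> A \<le> ennreal \<theta> * emeasure \<nu> A"
    using loc by metis
  show "emeasure \<mu> A \<le> ennreal \<theta> * emeasure \<nu> A"
  proof (cases "S = {}")
    case False
    obtain F where F: "F \<subseteq> N ` S" "countable F" "\<Union>F = \<Union>(N ` S)"
      using Lindelof[of "N ` S"] N(1) by blast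
    have "F \<noteq> {}" using F(3) False N(2) by auto
    define B where "B k = A \<inter> disjointed (from_nat_into F) k" for k
    have FN: "\<exists>x\<in>S. from_nat_into F k = N x" for k
      using from_nat_into[OF \<open>F \<noteq> {}\<close>, of k] F(1) by blast
    have "from_nat_into F k \<in> sets borel" for k using FN[of k] N(1) by (auto intro: borel_open)
    then have D: "disjointed (from_nat_into F) k \<in> sets borel" for k
      using sets.range_disjointed_sets[of "from_nat_into F" borel] by blast
    have Bm: "B k \<in> sets borel" for k unfolding B_def using A(1) D by auto
    then have Br: "range B \<subseteq> sets borel" by blast
    have disj: "disjoint_family B"
      using disjoint_family_disjointed[of "from_nat_into F"] unfolding B_def disjoint_family_on_def by blast
    have "(\<Union>k. B k) = A \<inter> (\<Union>k. from_nat_into F k)" by (simp add: B_def UN_disjointed_eq)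
    also have "(\<Union>k. from_nat_into F k) = \<Union>F" using range_from_nat_into[OF \<open>F \<noteq> {}\<close> F(2)] by simp
    also have "A \<inter> \<Union>F = A" using A(2) F(3) N(2) by blast
    finally have UB: "(\<Union>k. B k) = A" .
    have "emeasure \<mu> A = (\<Sum>k. emeasure \<mu> (B k))"
      using suminf_emeasure[of B \<mu>] Br disj sets UB by simp
    also have "\<dots> \<le> (\<Sum>k. ennreal \<theta> * emeasure \<nu> (B k))"
    proof (intro suminf_le)
      fix k
      obtain x where x: "x \<in> S" "from_nat_into F k = N x" using FN by blast
      have "B k \<subseteq> S \<inter> N x" using disjointed_subset[of "from_nat_into F" k] A(2) x(2) by (auto simp: B_def)
      then show "emeasure \<mu> (B k) \<le> ennreal \<theta> * emeasure \<nu> (B k)" by (rule N(3)[OF x(1) Bm])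
    qed auto
    also have "\<dots> = ennreal \<theta> * (\<Sum>k. emeasure \<nu> (B k))" by simp
    also have "(\<Sum>k. emeasure \<nu> (B k)) = emeasure \<nu> A"
      using suminf_emeasure[of B \<nu>] Br disj sets UB by simp
    finally show ?thesis .
  qed (use A in simp)
qed

subsection \<open>Surface measure as cone volume\<close>

text \<open>With the normalisation of the Hausdorff measure this number is the dimension: the cone
  over \<open>B\<close> has volume base times height divided by n, and its height is
  \<open>1 / norm w\<close>.\<close>

definition flat_const :: "'a::euclidean_space itself \<Rightarrow> ennreal" where
  "flat_const _ = (SOME c. c < top \<and> (\<forall>w B. w \<noteq> (0::'a) \<longrightarrow> B \<in> sets borel \<longrightarrow> B \<subseteq> {y. w \<bullet> y = 1} \<longrightarrow>
     hausdorff_outer_measure (DIM('a) - 1) B = c * ennreal (norm w) * emeasure (cone_measure w) B))"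

lemma flat_const_finite: "flat_const TYPE('a::euclidean_space) < top"
  and hausdorff_flat: "w \<noteq> (0::'a) \<Longrightarrow> B \<in> sets borel \<Longrightarrow> B \<subseteq> {y. w \<bullet> y = 1} \<Longrightarrow>
     hausdorff_outer_measure (DIM('a) - 1) B = flat_const TYPE('a) * ennreal (norm w) * emeasure (cone_measure w) B"
  using someI_ex[OF hausdorff_hyperplane[where 'a='a]] unfolding flat_const_def by blast+

text \<open>The deviation bound \<open>1 - 1 / \<eta>\<close> makes both \<open>Q\<close> and its
  inverse \<eta>-Lipschitz: \<open>Q\<close> expands by at most
  \<open>2 - 1 / \<eta> \<le> \<eta>\<close> and shrinks by a factor of at least
  \<open>1 / \<eta>\<close>.\<close>

lemma near_isometry_hausdorff:
  fixes Q :: "'a::real_normed_vector \<Rightarrow> 'a"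
  assumes \<eta>: "\<eta> > 1"
    and Q: "\<And>x y. x \<in> A \<Longrightarrow> y \<in> A \<Longrightarrow> norm (Q x - Q y - (x - y)) \<le> (1 - 1 / \<eta>) * norm (x - y)"
  shows "hausdorff_outer_measure d (Q ` A) \<le> ennreal (\<eta> ^ d) * hausdorff_outer_measure d A"
    and "hausdorff_outer_measure d A \<le> ennreal (\<eta> ^ d) * hausdorff_outer_measure d (Q ` A)"
proof -
  have \<eta>2: "2 - 1 / \<eta> \<le> \<eta>"
  proof -
    have "0 \<le> (\<eta> - 1)\<^sup>2 / \<eta>" using \<eta> by simp
    also have "(\<eta> - 1)\<^sup>2 / \<eta> = \<eta> - 2 + 1 / \<eta>" using \<eta> by (simp add: power2_eq_square field_simps)
    finally show ?thesis by simp
  qed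
  have up: "dist (Q x) (Q y) \<le> \<eta> * dist x y" if "x \<in> A" "y \<in> A" for x y
  proof -
    have "norm (Q x - Q y) \<le> norm (Q x - Q y - (x - y)) + norm (x - y)"
      using norm_triangle_ineq[of "Q x - Q y - (x - y)" "x - y"] by simp
    also have "\<dots> \<le> (1 - 1 / \<eta>) * norm (x - y) + norm (x - y)" using Q[OF that] by simp
    also have "\<dots> = (2 - 1 / \<eta>) * norm (x - y)" by (simp add: algebra_simps)
    also have "\<dots> \<le> \<eta> * norm (x - y)" using \<eta>2 by (intro mult_right_mono) auto
    finally show ?thesis by (simp add: dist_norm)
  qed
  then show "hausdorff_outer_measure d (Q ` A) \<le> ennreal (\<eta> ^ d) * hausdorff_outer_measure d A"
    using \<eta> by (intro hausdorff_outer_Lipschitz) auto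
  have low: "dist x y \<le> \<eta> * dist (Q x) (Q y)" if "x \<in> A" "y \<in> A" for x y
  proof -
    have "norm (x - y) \<le> norm (Q x - Q y) + norm (Q x - Q y - (x - y))" using norm_triangle_ineq4[of "Q x - Q y" "Q x - Q y - (x - y)"] by simp
    also have "\<dots> \<le> norm (Q x - Q y) + (1 - 1 / \<eta>) * norm (x - y)" using Q[OF that] by simp
    finally have "(1 / \<eta>) * norm (x - y) \<le> norm (Q x - Q y)" by (simp add: algebra_simps)
    then show ?thesis using \<eta> by (simp add: dist_norm field_simps)
  qed
  define g where "g = inv_into A Q"
  have inj: "inj_on Q A"
  proof (rule inj_onI)
    fix x y assume "x \<in> A" "y \<in> A" "Q x = Q y"
    then show "x = y" using low[of x y] by simp
  qed
  have gQ: "g (Q x) = x" if "x \<in> A" for x unfolding g_def using inj that by (rule inv_into_f_f)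
  have "dist (g p) (g q) \<le> \<eta> * dist p q" if "p \<in> Q ` A" "q \<in> Q ` A" for p q
    using that low by (auto simp: gQ)
  then have "hausdorff_outer_measure d (g ` Q ` A) \<le> ennreal (\<eta> ^ d) * hausdorff_outer_measure d (Q ` A)"
    using \<eta> by (intro hausdorff_outer_Lipschitz) auto
  moreover have "g ` Q ` A = A" using gQ by (force simp: image_image)
  ultimately show "hausdorff_outer_measure d A \<le> ennreal (\<eta> ^ d) * hausdorff_outer_measure d (Q ` A)" by simp
qed

text \<open>The same arithmetic for densities: a relative error below \<open>1 - 1 / \<eta>\<close>
  amounts to a factor \<eta> in either direction.\<close>

lemma near_factor:
  fixes q q0 \<eta> :: real
  assumes \<eta>: "\<eta> > 1" and q0: "q0 > 0" and q: "\<bar>q - q0\<bar> < q0 * (1 - 1 / \<eta>)"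
  shows "q \<le> \<eta> * q0" "q0 \<le> \<eta> * q"
proof -
  have "0 \<le> (\<eta> - 1)\<^sup>2 / \<eta>" using \<eta> by simp
  also have "(\<eta> - 1)\<^sup>2 / \<eta> = \<eta> - 2 + 1 / \<eta>" using \<eta> by (simp add: power2_eq_square field_simps)
  finally have "q0 * (2 - 1 / \<eta>) \<le> q0 * \<eta>" using q0 by (intro mult_left_mono) auto
  moreover have "q \<le> q0 * (2 - 1 / \<eta>)" using q by (simp add: algebra_simps abs_less_iff)
  ultimately show "q \<le> \<eta> * q0" by (simp add: mult.commute)
  have "q0 / \<eta> \<le> q" using q by (simp add: algebra_simps abs_less_iff)
  then show "q0 \<le> \<eta> * q" using \<eta> by (simp add: field_simps)
qed

context convex_body
begin

lemma radial_scale: "c > 0 \<Longrightarrow> radial K (c *\<^sub>R x) = radial K x"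
  by (simp add: radial_def gauge_scale)

lemma radial_on_frontier: "x \<in> frontier K \<Longrightarrow> radial K x = x"
  by (simp add: radial_def frontier_gauge)

text \<open>As \<open>1 / norm w\<close> is the support function in the direction of
  \<open>w\<close>, this expresses the classical relation dV = h dS / n between cone volume and
  surface area, with n in the guise of \<open>flat_const\<close>.\<close>

definition radial_density :: "'a \<Rightarrow> ennreal" where
  "radial_density x = (if x \<in> K \<and> radial K x \<in> regular_boundary K
     then flat_const TYPE('a) * ennreal (norm (dual_normal K (radial K x))) else 0)"

lemma borel_K [measurable]: "K \<in> sets borel" using closed_K by (rule borel_closed)

lemma measurable_radial_density [measurable]: "radial_density \<in> borel_measurable borel"
proof -
  have "radial_density = (\<lambda>x. indicator K x * (flat_const TYPE('a) *
      ennreal (norm ((\<lambda>x. if x \<in> regular_boundary K then dual_normal K x else 0) (radial K x)))))"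
    by (auto simp: radial_density_def fun_eq_iff)
  also have "\<dots> \<in> borel_measurable borel" by measurable
  finally show ?thesis .
qed

definition radial_measure :: "'a measure" where
  "radial_measure = distr (density lborel radial_density) borel (radial K)"

lemma sets_radial_measure [simp, measurable_cong]: "sets radial_measure = sets borel"
  by (simp add: radial_measure_def)

lemma nn_integral_radial_measure:
  "F \<in> borel_measurable borel \<Longrightarrow>
    (\<integral>\<^sup>+x. F x \<partial>radial_measure) = (\<integral>\<^sup>+x. radial_density x * F (radial K x) \<partial>lborel)"
  unfolding radial_measure_def by (simp add: nn_integral_distr nn_integral_density)

lemma emeasure_radial_measure:
  assumes [measurable]: "A \<in> sets borel"
  shows "emeasure radial_measure A = (\<integral>\<^sup>+x. radial_density x * indicator A (radial K x) \<partial>lborel)"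
  using nn_integral_radial_measure[of "indicator A"] by simp

lemma regular_flat_local:
  assumes x0: "x0 \<in> regular_boundary K" and \<epsilon>: "\<epsilon> > 0"
  obtains \<delta> where "\<delta> > 0"
    "\<And>x. x \<in> frontier K \<Longrightarrow> dist x x0 < \<delta> \<Longrightarrow> 1 - \<epsilon> \<le> dual_normal K x0 \<bullet> x \<and> dual_normal K x0 \<bullet> x \<le> 1"
    "\<And>x y. x \<in> frontier K \<Longrightarrow> y \<in> frontier K \<Longrightarrow> dist x x0 < \<delta> \<Longrightarrow> dist y x0 < \<delta> \<Longrightarrow>
       \<bar>dual_normal K x0 \<bullet> (x - y)\<bar> \<le> \<epsilon> * norm (x - y)"
proof -
  let ?w = "dual_normal K x0"
  have w: "?w \<in> dual_normals K x0" "?w \<noteq> 0" using dual_normal_in[OF x0] dual_normal_nonzero by blast+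
  obtain \<delta>1 where \<delta>1: "\<delta>1 > 0" "\<And>x y. x \<in> frontier K \<Longrightarrow> y \<in> frontier K \<Longrightarrow> dist x x0 < \<delta>1 \<Longrightarrow> dist y x0 < \<delta>1 \<Longrightarrow>
       \<bar>?w \<bullet> (x - y)\<bar> \<le> \<epsilon> * norm (x - y)" using boundary_flat[OF assms] by blast
  show thesis
  proof (rule that[of "min \<delta>1 (\<epsilon> / norm ?w)"])
    show "0 < min \<delta>1 (\<epsilon> / norm ?w)" using \<delta>1(1) \<epsilon> w(2) by simp
    fix x assume x: "x \<in> frontier K" "dist x x0 < min \<delta>1 (\<epsilon> / norm ?w)"
    have "?w \<bullet> (x0 - x) \<le> norm ?w * norm (x0 - x)" by (rule norm_cauchy_schwarz)
    also have "\<dots> \<le> \<epsilon>" using x(2) w(2) by (simp add: dist_norm norm_minus_commute field_simps)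
    finally show "1 - \<epsilon> \<le> ?w \<bullet> x \<and> ?w \<bullet> x \<le> 1"
      using w(1) frontier_in[OF x(1)] by (auto simp: dual_normals_def inner_diff_right)
  qed (use \<delta>1(2) in auto)
qed

text \<open>Near \<open>x0\<close> central projection to the tangent plane is almost an isometry of
  the boundary. The measure of the flat image is the volume of a cone ending at the tangent plane,
  which is nearly the cone ending at the boundary, and the length of the dual normal hardly
  varies.\<close>

lemma radial_local:
  assumes x0: "x0 \<in> regular_boundary K" and \<theta>: "\<theta> > 1"
  shows "\<exists>N. open N \<and> x0 \<in> N \<and> (\<forall>A\<in>sets borel. A \<subseteq> regular_boundary K \<inter> N \<longrightarrow>
    hausdorff_outer_measure (DIM('a) - 1) A \<le> ennreal \<theta> * emeasure radial_measure A \<and>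
    emeasure radial_measure A \<le> ennreal \<theta> * hausdorff_outer_measure (DIM('a) - 1) A)"
proof -
  let ?w = "dual_normal K x0" and ?c = "flat_const TYPE('a)"
  \<comment> \<open>The exponent counts the losses: n-1 factors from the near isometry, n from
    comparing the two cones, and one from the density.\<close>
  define m where "m = DIM('a) + (DIM('a) - 1) + 1"
  define \<eta> where "\<eta> = root m \<theta>"
  have \<theta>_eq: "ennreal \<theta> = ennreal (\<eta> ^ (DIM('a) - 1)) * ennreal (\<eta> ^ DIM('a)) * ennreal \<eta>"
  proof -
    have "\<eta> > 0" "\<eta> ^ m = \<theta>" using \<theta> by (simp_all add: \<eta>_def m_def)
    then have "\<theta> = \<eta> ^ (DIM('a) - 1) * \<eta> ^ DIM('a) * \<eta>" unfolding m_def power_add by (simp add: mult_ac)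
    then show ?thesis using \<open>\<eta> > 0\<close> by (simp add: ennreal_mult)
  qed
  have m0: "0 < m" by (simp add: m_def)
  have \<eta>: "\<eta> > 1" using \<theta> m0 by (simp add: \<eta>_def)
  have \<eta>m: "\<eta> ^ m = \<theta>" using \<theta> m0 by (simp add: \<eta>_def)
  obtain R where R: "R > 0" "\<And>x. x \<in> K \<Longrightarrow> norm x \<le> R" using outer_radius by blast
  \<comment> \<open>Chosen so that the bound \<open>2 * \<epsilon> + 4 * \<epsilon> * R\<close> for
    the deviation of \<open>Q\<close> from the identity is \<open>1 - 1 / \<eta>\<close>.\<close>
  define \<epsilon> where "\<epsilon> = (1 - 1 / \<eta>) / (2 + 4 * R)"
  have \<eta>1: "0 < 1 - 1 / \<eta>" "1 - 1 / \<eta> < 1" using \<eta> by auto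
  have \<epsilon>: "\<epsilon> > 0" using \<eta>1 R(1) by (simp add: \<epsilon>_def)
  have "\<epsilon> * 2 \<le> \<epsilon> * (2 + 4 * R)" using R(1) \<epsilon> by (intro mult_left_mono) auto
  also have \<epsilon>R: "\<epsilon> * (2 + 4 * R) = 1 - 1 / \<eta>" using R(1) by (simp add: \<epsilon>_def)
  finally have \<epsilon>2: "\<epsilon> * 2 \<le> 1 - 1 / \<eta>" .
  have w: "?w \<in> dual_normals K x0" "?w \<noteq> 0" using dual_normal_in[OF x0] dual_normal_nonzero by blast+
  obtain \<delta>1 where \<delta>1: "\<delta>1 > 0"
    "\<And>x. x \<in> frontier K \<Longrightarrow> dist x x0 < \<delta>1 \<Longrightarrow> 1 - \<epsilon> \<le> ?w \<bullet> x \<and> ?w \<bullet> x \<le> 1"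
    "\<And>x y. x \<in> frontier K \<Longrightarrow> y \<in> frontier K \<Longrightarrow> dist x x0 < \<delta>1 \<Longrightarrow> dist y x0 < \<delta>1 \<Longrightarrow>
       \<bar>?w \<bullet> (x - y)\<bar> \<le> \<epsilon> * norm (x - y)"
    using regular_flat_local[OF x0 \<epsilon>] by blast
  have "norm ?w * (1 - 1 / \<eta>) > 0" using w(2) \<eta>1 by simp
  from dual_normals_continuous[OF x0 this] obtain \<delta>2 where \<delta>2: "\<delta>2 > 0"
    "\<And>x w. x \<in> K \<Longrightarrow> dist x x0 < \<delta>2 \<Longrightarrow> w \<in> dual_normals K x \<Longrightarrow> norm (w - ?w) < norm ?w * (1 - 1 / \<eta>)" by blast
  define N where "N = ball x0 (min \<delta>1 \<delta>2)"
  have N: "dist x x0 < \<delta>1" "dist x x0 < \<delta>2" if "x \<in> N" for x using that by (auto simp: N_def dist_commute)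
  have dens: "norm (dual_normal K x) \<le> \<eta> * norm ?w" "norm ?w \<le> \<eta> * norm (dual_normal K x)"
    if x: "x \<in> regular_boundary K" "x \<in> N" for x
  proof -
    have "norm (dual_normal K x - ?w) < norm ?w * (1 - 1 / \<eta>)"
      by (rule \<delta>2(2)[OF _ N(2)[OF x(2)] dual_normal_in[OF x(1)]]) (use frontier_in regular_frontier x in blast)
    then have "\<bar>norm (dual_normal K x) - norm ?w\<bar> < norm ?w * (1 - 1 / \<eta>)"
      using norm_triangle_ineq3[of "dual_normal K x" ?w] by linarith
    then show "norm (dual_normal K x) \<le> \<eta> * norm ?w" "norm ?w \<le> \<eta> * norm (dual_normal K x)"
      using near_factor[OF \<eta>] w(2) by auto
  qed
  have main: "hausdorff_outer_measure (DIM('a) - 1) A \<le> ennreal \<theta> * emeasure radial_measure A \<and>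
    emeasure radial_measure A \<le> ennreal \<theta> * hausdorff_outer_measure (DIM('a) - 1) A"
    if A [measurable]: "A \<in> sets borel" and AN: "A \<subseteq> regular_boundary K \<inter> N" for A
  proof -
    let ?H = "hausdorff_outer_measure (DIM('a) - 1) :: 'a set \<Rightarrow> ennreal"
    define Q where "Q x = x /\<^sub>R (?w \<bullet> x)" for x
    have Afr: "x \<in> frontier K" "dist x x0 < \<delta>1" if "x \<in> A" for x
      using that AN regular_frontier N by blast+
    have wx: "1 - \<epsilon> \<le> ?w \<bullet> x" "?w \<bullet> x \<le> 1" "1 / 2 \<le> ?w \<bullet> x" "1 / \<eta> \<le> ?w \<bullet> x" if "x \<in> A" for x
    proof -
      have "1 - \<epsilon> \<le> ?w \<bullet> x" "?w \<bullet> x \<le> 1" using \<delta>1(2)[OF Afr[OF that]] by auto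
      then show "1 - \<epsilon> \<le> ?w \<bullet> x" "?w \<bullet> x \<le> 1" "1 / 2 \<le> ?w \<bullet> x" "1 / \<eta> \<le> ?w \<bullet> x"
        using \<epsilon>2 \<eta>1 \<epsilon> by linarith+
    qed
    have QA: "Q ` A = {y. ?w \<bullet> y = 1 \<and> radial K y \<in> A}"
    proof safe
      fix x assume x: "x \<in> A"
      have p: "?w \<bullet> x > 0" using wx(3)[OF x] by linarith
      then show "?w \<bullet> Q x = 1" by (simp add: Q_def)
      show "radial K (Q x) \<in> A" using p x radial_scale[of "inverse (?w \<bullet> x)" x] radial_on_frontier[OF Afr(1)[OF x]]
        by (simp add: Q_def)
    next
      fix y assume y: "?w \<bullet> y = 1" "radial K y \<in> A"
      then have "minkowski_gauge K y > 0" by (intro gauge_pos) auto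
      then have "Q (radial K y) = y" using y(1) by (simp add: Q_def radial_def)
      then show "y \<in> Q ` A" using y(2) by (metis imageI)
    qed
    have Qn: "norm (Q x - Q y - (x - y)) \<le> (1 - 1 / \<eta>) * norm (x - y)" if x: "x \<in> A" and y: "y \<in> A" for x y
    proof -
      let ?a = "?w \<bullet> x" and ?b = "?w \<bullet> y"
      have a: "1 - \<epsilon> \<le> ?a" "?a \<le> 1" "1/2 \<le> ?a" and b: "1/2 \<le> ?b" using wx x y by blast+
      have ne: "?a \<noteq> 0" "?b \<noteq> 0" using a b by auto
      have "\<bar>1 / ?a - 1\<bar> \<le> 2 * \<epsilon>"
      proof -
        have "\<bar>1 / ?a - 1\<bar> = (1 - ?a) / ?a" using a ne by (simp add: abs_if field_simps)
        also have "\<dots> \<le> \<epsilon> / (1/2)" using a \<epsilon> by (intro frac_le) auto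
        finally show ?thesis by simp
      qed
      moreover have "\<bar>1 / ?a - 1 / ?b\<bar> \<le> 4 * \<epsilon> * norm (x - y)"
      proof -
        have "\<bar>1 / ?a - 1 / ?b\<bar> = \<bar>?w \<bullet> (x - y)\<bar> / (?a * ?b)"
          using a b ne by (simp add: diff_frac_eq inner_diff_right abs_mult abs_minus_commute)
        also have "\<dots> \<le> (\<epsilon> * norm (x - y)) / (1/2 * (1/2))"
          using \<delta>1(3)[OF Afr(1)[OF x] Afr(1)[OF y] Afr(2)[OF x] Afr(2)[OF y]] a b \<epsilon>
          by (intro frac_le mult_mono) auto
        finally show ?thesis by simp
      qed
      \<comment> \<open>The first term is small because \<open>?w \<bullet> x\<close> is near 1, the
        second because the boundary is flat near \<open>x0\<close>.\<close>
      moreover have "Q x - Q y - (x - y) = (1 / ?a - 1) *\<^sub>R (x - y) + (1 / ?a - 1 / ?b) *\<^sub>R y"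
        by (simp add: Q_def algebra_simps divide_inverse)
      moreover have "norm y \<le> R" using R(2) frontier_in Afr(1) y by blast
      ultimately have "norm (Q x - Q y - (x - y)) \<le> 2 * \<epsilon> * norm (x - y) + (4 * \<epsilon> * norm (x - y)) * R"
        using \<epsilon> R(1) by (auto intro!: order_trans[OF norm_triangle_ineq] add_mono mult_mono)
      also have "\<dots> = (\<epsilon> * (2 + 4 * R)) * norm (x - y)" by (simp add: algebra_simps)
      finally show ?thesis unfolding \<epsilon>R .
    qed
    have iso: "?H (Q ` A) \<le> ennreal (\<eta> ^ (DIM('a) - 1)) * ?H A" "?H A \<le> ennreal (\<eta> ^ (DIM('a) - 1)) * ?H (Q ` A)"
      by (rule near_isometry_hausdorff[OF \<eta> Qn]; assumption)+
    \<comment> \<open>\<open>CP\<close> is the part of the cone over \<open>A\<close> below the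
      tangent plane, \<open>C\<close> the part inside \<open>K\<close>; they satisfy
      \<open>C \<subseteq> CP\<close>, and \<open>CP\<close> lies in the dilate of \<open>C\<close>
      by \<eta>.\<close>
    define CP where "CP = {x. 0 < ?w \<bullet> x \<and> ?w \<bullet> x \<le> 1 \<and> radial K x \<in> A}"
    define C where "C = {x \<in> K. radial K x \<in> A}"
    have [measurable]: "C \<in> sets borel" "CP \<in> sets borel" unfolding C_def CP_def by measurable
    have QAm: "Q ` A \<in> sets borel" unfolding QA by measurable
    have "emeasure (cone_measure ?w) (Q ` A) = emeasure lborel CP"
      unfolding CP_def QA emeasure_cone_measure[OF QAm[unfolded QA]]
      by (intro arg_cong[where f="emeasure lborel"]) (auto simp: radial_scale)
    moreover have "Q ` A \<subseteq> {y. ?w \<bullet> y = 1}" unfolding QA by blast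
    ultimately have HQ: "?H (Q ` A) = ?c * ennreal (norm ?w) * emeasure lborel CP"
      using hausdorff_flat[OF w(2) QAm] by simp
    have gw: "?w \<bullet> x = minkowski_gauge K x * (?w \<bullet> radial K x)" if "radial K x \<in> A" for x
    proof -
      have "x \<noteq> 0" using Afr(1)[OF that] by (simp add: radial_frontier_iff)
      then show ?thesis using gauge_pos[of x] by (simp add: radial_def)
    qed
    have "C \<subseteq> CP"
    proof
      fix x assume x: "x \<in> C"
      then have r: "radial K x \<in> A" "minkowski_gauge K x \<le> 1" by (auto simp: C_def in_iff_gauge)
      then have "minkowski_gauge K x > 0" using Afr(1)[OF r(1)] by (intro gauge_pos) (simp add: radial_frontier_iff)
      moreover have "?w \<bullet> radial K x > 0" using wx(3)[OF r(1)] by linarith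
      ultimately show "x \<in> CP" using r wx(2)[OF r(1)] gw[OF r(1)]
        by (auto simp: CP_def intro!: mult_le_one)
    qed
    then have le1: "emeasure lborel C \<le> emeasure lborel CP" by (intro emeasure_mono) auto
    have "CP \<subseteq> {x. x /\<^sub>R \<eta> \<in> C}"
    proof safe
      fix x assume x: "x \<in> CP"
      then have r: "radial K x \<in> A" "?w \<bullet> x \<le> 1" by (auto simp: CP_def)
      have "minkowski_gauge K x * (1 / \<eta>) \<le> minkowski_gauge K x * (?w \<bullet> radial K x)"
        using wx(4)[OF r(1)] gauge_nonneg by (intro mult_left_mono) auto
      then have "minkowski_gauge K x / \<eta> \<le> 1" using gw[OF r(1)] r(2) by simp
      then show "x /\<^sub>R \<eta> \<in> C" using \<eta> r(1)
        by (simp add: C_def in_iff_gauge gauge_scale radial_scale divide_inverse mult.commute)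
    qed
    then have "emeasure lborel CP \<le> emeasure lborel {x. x /\<^sub>R \<eta> \<in> C}" by (intro emeasure_mono) auto
    also have "\<dots> = ennreal (\<eta> ^ DIM('a)) * emeasure lborel C" using \<eta> by (intro emeasure_lborel_scale) auto
    finally have le2: "emeasure lborel CP \<le> ennreal (\<eta> ^ DIM('a)) * emeasure lborel C" .
    have RM: "emeasure radial_measure A = (\<integral>\<^sup>+x. (?c * ennreal (norm (dual_normal K (radial K x)))) * indicator C x \<partial>lborel)"
      unfolding emeasure_radial_measure[OF A] using AN
      by (intro nn_integral_cong) (auto simp: radial_density_def C_def split: split_indicator)
    have up: "emeasure radial_measure A \<le> ennreal \<eta> * (?c * ennreal (norm ?w) * emeasure lborel C)"
    proof -
      have "emeasure radial_measure A \<le> (\<integral>\<^sup>+x. (ennreal \<eta> * (?c * ennreal (norm ?w))) * indicator C x \<partial>lborel)"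
        unfolding RM
      proof (intro nn_integral_mono)
        fix x
        show "?c * ennreal (norm (dual_normal K (radial K x))) * indicator C x
            \<le> ennreal \<eta> * (?c * ennreal (norm ?w)) * indicator C x"
        proof (cases "x \<in> C")
          case True
          then have "norm (dual_normal K (radial K x)) \<le> \<eta> * norm ?w" using AN by (intro dens) (auto simp: C_def)
          then have "?c * ennreal (norm (dual_normal K (radial K x))) \<le> ?c * ennreal (\<eta> * norm ?w)"
            by (intro mult_left_mono ennreal_leI) auto
          then show ?thesis using \<eta> True by (simp add: ennreal_mult mult_ac)
        qed simp
      qed
      also have "\<dots> = (ennreal \<eta> * (?c * ennreal (norm ?w))) * emeasure lborel C"
        by (rule nn_integral_cmult_indicator) simp
      finally show ?thesis by (simp only: mult.assoc)
    qed
    have low: "?c * ennreal (norm ?w) * emeasure lborel C \<le> ennreal \<eta> * emeasure radial_measure A"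
    proof -
      have "?c * ennreal (norm ?w) * emeasure lborel C = (\<integral>\<^sup>+x. (?c * ennreal (norm ?w)) * indicator C x \<partial>lborel)"
        by (rule nn_integral_cmult_indicator[symmetric]) simp
      also have "\<dots> \<le> (\<integral>\<^sup>+x. ennreal \<eta> * (radial_density x * indicator A (radial K x)) \<partial>lborel)"
      proof (intro nn_integral_mono)
        fix x
        show "?c * ennreal (norm ?w) * indicator C x \<le> ennreal \<eta> * (radial_density x * indicator A (radial K x))"
        proof (cases "x \<in> C")
          case True
          then have x: "x \<in> K" "radial K x \<in> A" "radial K x \<in> regular_boundary K" using AN by (auto simp: C_def)
          then have "norm ?w \<le> \<eta> * norm (dual_normal K (radial K x))" using AN by (intro dens) auto
          then have "?c * ennreal (norm ?w) \<le> ?c * ennreal (\<eta> * norm (dual_normal K (radial K x)))"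
            by (intro mult_left_mono ennreal_leI) auto
          then show ?thesis using \<eta> True x by (simp add: ennreal_mult radial_density_def mult_ac)
        qed simp
      qed
      also have "\<dots> = ennreal \<eta> * emeasure radial_measure A"
        unfolding emeasure_radial_measure[OF A] by (rule nn_integral_cmult) measurable
      finally show ?thesis .
    qed
    have "?H A \<le> ennreal (\<eta> ^ (DIM('a) - 1)) * (?c * ennreal (norm ?w) * emeasure lborel CP)" using iso(2) HQ by simp
    also have "\<dots> \<le> ennreal (\<eta> ^ (DIM('a) - 1)) * (?c * ennreal (norm ?w) * (ennreal (\<eta> ^ DIM('a)) * emeasure lborel C))"
      by (intro mult_left_mono le2) auto
    also have "\<dots> = ennreal (\<eta> ^ (DIM('a) - 1)) * ennreal (\<eta> ^ DIM('a)) * (?c * ennreal (norm ?w) * emeasure lborel C)"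
      by (simp add: mult_ac)
    also have "\<dots> \<le> ennreal (\<eta> ^ (DIM('a) - 1)) * ennreal (\<eta> ^ DIM('a)) * (ennreal \<eta> * emeasure radial_measure A)"
      by (intro mult_left_mono low) auto
    also have "\<dots> = ennreal \<theta> * emeasure radial_measure A"
      unfolding \<theta>_eq by (simp only: mult.assoc)
    finally have 1: "?H A \<le> ennreal \<theta> * emeasure radial_measure A" .
    have "emeasure radial_measure A \<le> ennreal \<eta> * (?c * ennreal (norm ?w) * emeasure lborel CP)"
      by (rule order_trans[OF up]) (intro mult_left_mono le1; simp)
    also have "\<dots> \<le> ennreal \<eta> * (ennreal (\<eta> ^ (DIM('a) - 1)) * ?H A)"
      unfolding HQ[symmetric] by (intro mult_left_mono iso) auto
    also have "\<dots> = ennreal (\<eta> ^ ((DIM('a) - 1) + 1)) * ?H A"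
    proof -
      have "ennreal (\<eta> ^ ((DIM('a) - 1) + 1)) = ennreal \<eta> * ennreal (\<eta> ^ (DIM('a) - 1))"
        unfolding power_add power_one_right using \<eta> by (subst ennreal_mult) (auto simp: mult.commute)
      then show ?thesis by (simp only: mult.assoc)
    qed
    also have "\<dots> \<le> ennreal \<theta> * ?H A"
      using \<eta> unfolding \<eta>m[symmetric] m_def by (intro mult_right_mono ennreal_leI power_increasing) auto
    finally have 2: "emeasure radial_measure A \<le> ennreal \<theta> * ?H A" .
    from 1 2 show ?thesis by blast
  qed
  have "open N" "x0 \<in> N" using \<delta>1(1) \<delta>2(1) by (auto simp: N_def)
  with main show ?thesis by blast
qed

theorem hausdorff_regular_radial:
  assumes A: "A \<in> sets borel" "A \<subseteq> regular_boundary K"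
  shows "emeasure (hausdorff_measure (DIM('a) - 1)) A = emeasure radial_measure A"
proof -
  let ?H = "hausdorff_measure (DIM('a) - 1) :: 'a measure"
  have loc: "\<exists>N. open N \<and> x \<in> N \<and> (\<forall>A\<in>sets borel. A \<subseteq> regular_boundary K \<inter> N \<longrightarrow>
      emeasure ?H A \<le> ennreal \<theta> * emeasure radial_measure A \<and>
      emeasure radial_measure A \<le> ennreal \<theta> * emeasure ?H A)"
    if \<theta>: "\<theta> > 1" and x: "x \<in> regular_boundary K" for \<theta> x
  proof -
    obtain N where N: "open N" "x \<in> N" "\<And>A. A \<in> sets borel \<Longrightarrow> A \<subseteq> regular_boundary K \<inter> N \<Longrightarrow>
      hausdorff_outer_measure (DIM('a) - 1) A \<le> ennreal \<theta> * emeasure radial_measure A \<and>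
      emeasure radial_measure A \<le> ennreal \<theta> * hausdorff_outer_measure (DIM('a) - 1) A"
      using radial_local[OF x \<theta>] by blast
    show ?thesis
      by (intro exI[of _ N] conjI N(1,2) ballI impI; subst emeasure_hausdorff; use N(3) in blast)
  qed
  show ?thesis
  proof (rule antisym)
    show "emeasure ?H A \<le> emeasure radial_measure A"
    proof (rule local_measure_comparison[OF _ _ _ A])
      fix \<theta> :: real and x assume "\<theta> > 1" "x \<in> regular_boundary K"
      from loc[OF this] show "\<exists>N. open N \<and> x \<in> N \<and> (\<forall>A\<in>sets borel. A \<subseteq> regular_boundary K \<inter> N \<longrightarrow>
        emeasure ?H A \<le> ennreal \<theta> * emeasure radial_measure A)" by blast
    qed simp_all
    show "emeasure radial_measure A \<le> emeasure ?H A"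
    proof (rule local_measure_comparison[OF _ _ _ A])
      fix \<theta> :: real and x assume "\<theta> > 1" "x \<in> regular_boundary K"
      from loc[OF this] show "\<exists>N. open N \<and> x \<in> N \<and> (\<forall>A\<in>sets borel. A \<subseteq> regular_boundary K \<inter> N \<longrightarrow>
        emeasure radial_measure A \<le> ennreal \<theta> * emeasure ?H A)" by blast
    qed simp_all
  qed
qed

end

subsection \<open>Surface measure over a graph\<close>

definition top_boundary :: "'a::euclidean_space set \<Rightarrow> 'a \<Rightarrow> 'a set" where
  "top_boundary K u = {x \<in> regular_boundary K. dual_normal K x \<bullet> u > 0}"

definition top_point :: "'a::euclidean_space set \<Rightarrow> 'a \<Rightarrow> 'a \<Rightarrow> 'a" where
  "top_point K u z = z + upper_graph u K z *\<^sub>R u"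

text \<open>The measure \<open>cone_measure u\<close> lives on a copy of the orthogonal complement
  of \<open>u\<close> shifted by \<open>u\<close>, hence \<open>hproj u y\<close>. The quotient is
  the reciprocal cosine of the angle between normal and \<open>u\<close>. Outside the projection
  \<open>upper_graph\<close> is unspecified, but then the fibre is empty and the membership test
  fails.\<close>

definition top_density :: "'a::euclidean_space set \<Rightarrow> 'a \<Rightarrow> 'a \<Rightarrow> ennreal" where
  "top_density K u y = (let x = top_point K u (hproj u y) in if x \<in> top_boundary K u
     then flat_const TYPE('a) * ennreal (norm (dual_normal K x) / (dual_normal K x \<bullet> u)) else 0)"

definition top_measure :: "'a::euclidean_space set \<Rightarrow> 'a \<Rightarrow> 'a measure" where
  "top_measure K u =
     distr (density (cone_measure u) (top_density K u)) borel (\<lambda>y. top_point K u (hproj u y))"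

lemma nn_integral_density_sandwich:
  fixes q :: "'a \<Rightarrow> real"
  assumes [measurable]: "X \<in> sets M" "(\<lambda>x. ennreal (q x) * indicator X x) \<in> borel_measurable M"
    and \<eta>: "\<eta> > 0" and q0: "q0 \<ge> 0"
    and q: "\<And>x. x \<in> X \<Longrightarrow> q x \<le> \<eta> * q0" "\<And>x. x \<in> X \<Longrightarrow> q0 \<le> \<eta> * q x" "\<And>x. x \<in> X \<Longrightarrow> q x \<ge> 0"
  shows "(\<integral>\<^sup>+x. ennreal (q x) * indicator X x \<partial>M) \<le> ennreal \<eta> * (ennreal q0 * emeasure M X)"
    and "ennreal q0 * emeasure M X \<le> ennreal \<eta> * (\<integral>\<^sup>+x. ennreal (q x) * indicator X x \<partial>M)"
proof -
  have "(\<integral>\<^sup>+x. ennreal (q x) * indicator X x \<partial>M) \<le> (\<integral>\<^sup>+x. ennreal (\<eta> * q0) * indicator X x \<partial>M)"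
    using q by (intro nn_integral_mono) (auto split: split_indicator intro!: ennreal_leI)
  also have "\<dots> = ennreal (\<eta> * q0) * emeasure M X" by (rule nn_integral_cmult_indicator) simp
  also have "\<dots> = ennreal \<eta> * (ennreal q0 * emeasure M X)" using \<eta> q0 by (simp add: ennreal_mult mult.assoc)
  finally show "(\<integral>\<^sup>+x. ennreal (q x) * indicator X x \<partial>M) \<le> ennreal \<eta> * (ennreal q0 * emeasure M X)" .
  have "ennreal q0 * emeasure M X = (\<integral>\<^sup>+x. ennreal q0 * indicator X x \<partial>M)"
    by (rule nn_integral_cmult_indicator[symmetric]) simp
  also have "\<dots> \<le> (\<integral>\<^sup>+x. ennreal \<eta> * (ennreal (q x) * indicator X x) \<partial>M)"
  proof (intro nn_integral_mono)
    fix x show "ennreal q0 * indicator X x \<le> ennreal \<eta> * (ennreal (q x) * indicator X x)"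
      using q(2,3)[of x] \<eta> by (auto split: split_indicator simp: ennreal_mult[symmetric] intro!: ennreal_leI)
  qed
  also have "\<dots> = ennreal \<eta> * (\<integral>\<^sup>+x. ennreal (q x) * indicator X x \<partial>M)" by (rule nn_integral_cmult) simp
  finally show "ennreal q0 * emeasure M X \<le> ennreal \<eta> * (\<integral>\<^sup>+x. ennreal (q x) * indicator X x \<partial>M)" .
qed

context convex_body
begin

lemma fibre_compact: assumes u: "norm u = 1" shows "compact {s. z + s *\<^sub>R u \<in> K}"
proof -
  obtain R where R: "R > 0" "\<And>x. x \<in> K \<Longrightarrow> norm x \<le> R" using outer_radius by blast
  have "closed ((\<lambda>s. z + s *\<^sub>R u) -` K)" by (intro continuous_closed_vimage closed_K) (intro continuous_intros)
  moreover have "\<bar>s\<bar> \<le> R + norm z" if "z + s *\<^sub>R u \<in> K" for s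
  proof -
    have "\<bar>s\<bar> = norm ((z + s *\<^sub>R u) - z)" using u by simp
    also have "\<dots> \<le> norm (z + s *\<^sub>R u) + norm z" by (rule norm_triangle_ineq4)
    finally show ?thesis using R(2)[OF that] by linarith
  qed
  then have "bounded {s. z + s *\<^sub>R u \<in> K}" by (auto simp: bounded_iff)
  ultimately show ?thesis by (simp add: compact_eq_bounded_closed vimage_def)
qed

lemma upper_graph_attained:
  assumes u: "norm u = 1" and s: "z + s *\<^sub>R u \<in> K"
  shows "top_point K u z \<in> K" "s \<le> upper_graph u K z"
proof -
  let ?S = "{s. z + s *\<^sub>R u \<in> K}"
  have c: "compact ?S" "?S \<noteq> {}" using fibre_compact[OF u] s by auto
  then have "Sup ?S \<in> ?S" using closed_contains_Sup compact_imp_closed compact_imp_bounded bounded_imp_bdd_above by metis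
  then show "top_point K u z \<in> K" by (simp add: top_point_def upper_graph_def)
  show "s \<le> upper_graph u K z"
    unfolding upper_graph_def using s c by (intro cSup_upper) (auto intro: bounded_imp_bdd_above compact_imp_bounded)
qed

lemma measurable_upper_graph [measurable]:
  assumes u: "norm u = 1" shows "upper_graph u K \<in> borel_measurable borel"
proof -
  have uu: "u \<bullet> u = 1" using u by (simp add: dot_square_norm)
  define L where "L a = {z. \<exists>s\<ge>a. z + s *\<^sub>R u \<in> K}" for a
  define L' where "L' = {z. \<exists>s. z + s *\<^sub>R u \<in> K}"
  \<comment> \<open>The superlevel set is the sum of the compact body and a closed ray, hence
    closed.\<close>
  have "L a = (\<Union>x\<in>K. \<Union>y\<in>{y. y = (y \<bullet> u) *\<^sub>R u \<and> y \<bullet> u \<le> - a}. {x + y})" for a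
  proof safe
    fix z assume "z \<in> L a"
    then obtain s where s: "s \<ge> a" "z + s *\<^sub>R u \<in> K" by (auto simp: L_def)
    then show "z \<in> (\<Union>x\<in>K. \<Union>y\<in>{y. y = (y \<bullet> u) *\<^sub>R u \<and> y \<bullet> u \<le> - a}. {x + y})"
      by (intro UN_I[of "z + s *\<^sub>R u"] UN_I[of "- s *\<^sub>R u"]) (auto simp: uu)
  next
    fix x y assume x: "x \<in> K" and y: "y = (y \<bullet> u) *\<^sub>R u" "y \<bullet> u \<le> - a"
    have "(y \<bullet> u) *\<^sub>R u = y" using y(1) by (rule sym)
    then show "x + y \<in> L a" unfolding L_def
      using x y(2) by (intro CollectI exI[of _ "- (y \<bullet> u)"]) simp
  qed
  moreover have "closed {y. y = (y \<bullet> u) *\<^sub>R u \<and> y \<bullet> u \<le> - a}" for a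
    by (intro closed_Collect_conj closed_Collect_eq closed_Collect_le continuous_intros)
  ultimately have "closed (L a)" for a
    using compact_closed_sums[OF compact_K] by simp
  then have [measurable]: "L a \<in> sets borel" for a by (rule borel_closed)
  have "L' = (\<Union>n::nat. L (- real n))"
    unfolding L_def L'_def by (auto, metis minus_le_iff real_arch_simple)
  then have [measurable]: "L' \<in> sets borel" by simp
  \<comment> \<open>Off the projection \<open>upper_graph\<close> is the constant
    \<open>Sup {}\<close>, whose value is unknown; either way the complement of \<open>L'\<close> is
    included or omitted as a whole.\<close>
  have "{z. a \<le> upper_graph u K z} = L a \<union> (if a \<le> Sup ({}::real set) then - L' else {})" for a
  proof (rule set_eqI)
    fix z
    show "z \<in> {z. a \<le> upper_graph u K z} \<longleftrightarrow> z \<in> L a \<union> (if a \<le> Sup ({}::real set) then - L' else {})"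
    proof (cases "z \<in> L'")
      case True
      then obtain s where s: "z + s *\<^sub>R u \<in> K" by (auto simp: L'_def)
      have "z + upper_graph u K z *\<^sub>R u \<in> K" using upper_graph_attained(1)[OF u s] by (simp add: top_point_def)
      then have "a \<le> upper_graph u K z \<longleftrightarrow> z \<in> L a"
        using upper_graph_attained(2)[OF u] by (auto simp: L_def intro: order_trans)
      then show ?thesis using True by auto
    next
      case False
      then have "upper_graph u K z = Sup {}" "z \<notin> L a" by (auto simp: upper_graph_def L'_def L_def)
      then show ?thesis using False by auto
    qed
  qed
  then show ?thesis by (subst borel_measurable_iff_ge) auto
qed

lemma measurable_top_point [measurable]: "norm u = 1 \<Longrightarrow> top_point K u \<in> borel_measurable borel"
  unfolding top_point_def by measurable

lemma top_boundary_borel [measurable]: "top_boundary K u \<in> sets borel"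
proof -
  have "top_boundary K u =
      {x. (if x \<in> regular_boundary K then dual_normal K x else 0) \<bullet> u > 0}"
    by (auto simp: top_boundary_def)
  also have "\<dots> \<in> sets borel" by measurable
  finally show ?thesis .
qed

text \<open>Moving up from a point whose normal has a positive component along \<open>u\<close>
  leaves the supporting half-space, so the point is the upper end of its fibre.\<close>

lemma top_point_top_boundary:
  assumes u: "norm u = 1" and x: "x \<in> top_boundary K u"
  shows "top_point K u (hproj u x) = x"
proof -
  let ?w = "dual_normal K x"
  have r: "x \<in> regular_boundary K" and p: "?w \<bullet> u > 0" using x by (auto simp: top_boundary_def)
  have w: "?w \<bullet> x = 1" "\<And>y. y \<in> K \<Longrightarrow> ?w \<bullet> y \<le> 1" using dual_normal_in[OF r] by (auto simp: dual_normals_def)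
  have xK: "x \<in> K" using frontier_in regular_frontier r by blast
  have "upper_graph u K (hproj u x) = x \<bullet> u"
    unfolding upper_graph_def
  proof (rule cSup_eq_maximum)
    show "x \<bullet> u \<in> {s. hproj u x + s *\<^sub>R u \<in> K}" using xK by (simp add: hproj_decomp[symmetric])
    fix s assume "s \<in> {s. hproj u x + s *\<^sub>R u \<in> K}"
    then have "?w \<bullet> (hproj u x + s *\<^sub>R u) \<le> ?w \<bullet> x" using w by auto
    then have "(?w \<bullet> u) * (s - x \<bullet> u) \<le> 0" by (simp add: hproj_def inner_add_right inner_diff_right algebra_simps)
    then show "s \<le> x \<bullet> u" using p by (simp add: mult_le_0_iff)
  qed
  then show ?thesis by (simp add: top_point_def hproj_decomp[symmetric])
qed

lemma measurable_top_density [measurable]: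
  assumes u: "norm u = 1" shows "top_density K u \<in> borel_measurable borel"
proof -
  let ?f = "\<lambda>x. if x \<in> regular_boundary K then dual_normal K x else 0"
  note [measurable] = measurable_top_point[OF u]
  have "top_density K u = (\<lambda>y. flat_const TYPE('a) * ennreal (norm (?f (top_point K u (hproj u y))) /
      (?f (top_point K u (hproj u y)) \<bullet> u)) * indicator (top_boundary K u) (top_point K u (hproj u y)))"
    by (auto simp: top_density_def top_boundary_def fun_eq_iff Let_def)
  also have "\<dots> \<in> borel_measurable borel" by measurable
  finally show ?thesis .
qed

lemma sets_top_measure [simp, measurable_cong]: "sets (top_measure K u) = sets borel"
  by (simp add: top_measure_def)

lemma nn_integral_top_measure:
  assumes u: "norm u = 1" and [measurable]: "F \<in> borel_measurable borel"
  shows "(\<integral>\<^sup>+x. F x \<partial>top_measure K u) = (\<integral>\<^sup>+y. top_density K u y * F (top_point K u (hproj u y)) \<partial>cone_measure u)"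
proof -
  note [measurable] = measurable_top_point[OF u] measurable_top_density[OF u]
  show ?thesis unfolding top_measure_def by (simp add: nn_integral_distr nn_integral_density)
qed

text \<open>The scheme of \<open>radial_local\<close> with projection along \<open>u\<close> in
  place of central projection. This projection preserves \<open>hproj u\<close>, so the measure of
  the flat image is computed exactly by \<open>cone_measure_change_direction\<close>; only the near
  isometry and the density cost factors, which explains the exponent \<open>Suc d\<close>.\<close>

lemma top_local:
  assumes u: "norm u = 1" and x0: "x0 \<in> top_boundary K u" and \<theta>: "\<theta> > 1"
  shows "\<exists>N. open N \<and> x0 \<in> N \<and> (\<forall>A\<in>sets borel. A \<subseteq> top_boundary K u \<inter> N \<longrightarrow>
    emeasure (hausdorff_measure (DIM('a) - 1)) A \<le> ennreal \<theta> * emeasure (top_measure K u) A \<and>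
    emeasure (top_measure K u) A \<le> ennreal \<theta> * emeasure (hausdorff_measure (DIM('a) - 1)) A)"
proof -
  note [measurable] = measurable_top_point[OF u] measurable_top_density[OF u]
  let ?w = "dual_normal K x0" and ?c = "flat_const TYPE('a)"
  define d where "d = DIM('a) - 1"
  define \<kappa> where "\<kappa> = ?w \<bullet> u"
  define \<eta> where "\<eta> = root (Suc d) \<theta>"
  have \<eta>: "\<eta> > 1" using \<theta> by (simp add: \<eta>_def)
  have \<eta>m: "\<eta> ^ Suc d = \<theta>" using \<theta> by (simp add: \<eta>_def del: power_Suc)
  have x0r: "x0 \<in> regular_boundary K" and \<kappa>: "\<kappa> > 0" using x0 by (auto simp: top_boundary_def \<kappa>_def)
  have \<eta>1: "0 < 1 - 1 / \<eta>" using \<eta> by auto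
  define q where "q x = norm (dual_normal K x) / (dual_normal K x \<bullet> u)" for x
  define q0 where "q0 = q x0"
  have w: "?w \<in> dual_normals K x0" "?w \<noteq> 0" using dual_normal_in[OF x0r] dual_normal_nonzero by blast+
  have q0: "q0 > 0" and q0_eq: "q0 = norm ?w / \<kappa>" using w(2) \<kappa> by (auto simp: q0_def q_def \<kappa>_def)
  \<comment> \<open>Projecting along \<open>u\<close> divides the deviation from the tangent plane
    by \<kappa>, so \<kappa> is built into the flatness bound.\<close>
  have "(1 - 1 / \<eta>) * \<kappa> > 0" using \<eta>1 \<kappa> by simp
  from boundary_flat[OF x0r this] obtain \<delta>1 where \<delta>1: "\<delta>1 > 0"
    "\<And>x y. x \<in> frontier K \<Longrightarrow> y \<in> frontier K \<Longrightarrow> dist x x0 < \<delta>1 \<Longrightarrow> dist y x0 < \<delta>1 \<Longrightarrow>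
       \<bar>?w \<bullet> (x - y)\<bar> \<le> (1 - 1 / \<eta>) * \<kappa> * norm (x - y)" by blast
  have "continuous_on (top_boundary K u) q"
    unfolding q_def
    by (intro continuous_intros continuous_on_subset[OF continuous_dual_normal]) (auto simp: top_boundary_def)
  moreover have "q0 * (1 - 1 / \<eta>) > 0" using q0 \<eta>1 by simp
  ultimately obtain \<delta>2 where \<delta>2: "\<delta>2 > 0"
    "\<And>x. x \<in> top_boundary K u \<Longrightarrow> dist x x0 < \<delta>2 \<Longrightarrow> dist (q x) q0 < q0 * (1 - 1 / \<eta>)"
    unfolding continuous_on_iff using x0 q0_def by metis
  define N where "N = ball x0 (min \<delta>1 \<delta>2)"
  have N: "dist x x0 < \<delta>1" "dist x x0 < \<delta>2" if "x \<in> N" for x using that by (auto simp: N_def dist_commute)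
  have dens: "q x \<le> \<eta> * q0" "q0 \<le> \<eta> * q x" if x: "x \<in> top_boundary K u" "x \<in> N" for x
    using near_factor[OF \<eta> q0, of "q x"] \<delta>2(2)[OF x(1) N(2)[OF x(2)]] by (auto simp: dist_real_def)
  have main: "emeasure (hausdorff_measure d) A \<le> ennreal \<theta> * emeasure (top_measure K u) A \<and>
    emeasure (top_measure K u) A \<le> ennreal \<theta> * emeasure (hausdorff_measure d) A"
    if A [measurable]: "A \<in> sets borel" and AN: "A \<subseteq> top_boundary K u \<inter> N" for A
  proof -
    let ?H = "hausdorff_outer_measure d :: 'a set \<Rightarrow> ennreal"
    define Q where "Q x = x + ((1 - ?w \<bullet> x) / \<kappa>) *\<^sub>R u" for x
    have At: "x \<in> top_boundary K u" "x \<in> frontier K" "dist x x0 < \<delta>1" if "x \<in> A" for x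
      using that AN regular_frontier N by (auto simp: top_boundary_def)
    have hQ: "hproj u (Q x) = hproj u x" for x using u by (simp add: Q_def hproj_add hproj_scaleR)
    have wQ: "?w \<bullet> Q x = 1" for x using \<kappa> by (simp add: Q_def inner_add_right \<kappa>_def)
    have QA: "Q ` A = {y. ?w \<bullet> y = 1 \<and> top_point K u (hproj u y) \<in> A}"
    proof safe
      fix x assume x: "x \<in> A"
      then show "?w \<bullet> Q x = 1" "top_point K u (hproj u (Q x)) \<in> A"
        using wQ top_point_top_boundary[OF u At(1)[OF x]] by (auto simp: hQ)
    next
      fix y assume y: "?w \<bullet> y = 1" "top_point K u (hproj u y) \<in> A"
      let ?x = "top_point K u (hproj u y)"
      have "hproj u (Q ?x) = hproj u y" using u by (simp add: hQ) (simp add: top_point_def hproj_add hproj_scaleR)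
      then have e: "Q ?x = y + (Q ?x \<bullet> u - y \<bullet> u) *\<^sub>R u"
        by (simp add: hproj_def algebra_simps)
      have "?w \<bullet> Q ?x = ?w \<bullet> y + (Q ?x \<bullet> u - y \<bullet> u) * \<kappa>"
        by (subst e) (simp add: inner_add_right \<kappa>_def)
      then have "Q ?x \<bullet> u - y \<bullet> u = 0" using wQ[of ?x] y(1) \<kappa> by simp
      then have "Q ?x = y" using e by simp
      then show "y \<in> Q ` A" using y(2) by (metis imageI)
    qed
    have Qn: "norm (Q x - Q y - (x - y)) \<le> (1 - 1 / \<eta>) * norm (x - y)" if x: "x \<in> A" and y: "y \<in> A" for x y
    proof -
      have "Q x - Q y - (x - y) = (- (?w \<bullet> (x - y)) / \<kappa>) *\<^sub>R u"
        by (simp add: Q_def inner_diff_right algebra_simps diff_divide_distrib)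
      then have "norm (Q x - Q y - (x - y)) = \<bar>?w \<bullet> (x - y)\<bar> / \<kappa>" using u \<kappa> by simp
      also have "\<dots> \<le> ((1 - 1 / \<eta>) * \<kappa> * norm (x - y)) / \<kappa>"
        using \<delta>1(2)[OF At(2)[OF x] At(2)[OF y] At(3)[OF x] At(3)[OF y]] \<kappa> by (intro divide_right_mono) auto
      finally show ?thesis using \<kappa> by simp
    qed
    have iso: "?H (Q ` A) \<le> ennreal (\<eta> ^ d) * ?H A" "?H A \<le> ennreal (\<eta> ^ d) * ?H (Q ` A)"
      by (rule near_isometry_hausdorff[OF \<eta> Qn]; assumption)+
    define X where "X = {y. top_point K u (hproj u y) \<in> A}"
    have [measurable]: "X \<in> sets borel" unfolding X_def by measurable
    have QAm: "Q ` A \<in> sets borel" unfolding QA by measurable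
    have Xw: "emeasure (cone_measure u) X = ennreal \<kappa> * emeasure (cone_measure ?w) (Q ` A)"
    proof -
      have "emeasure (cone_measure ?w) (Q ` A) = (\<integral>\<^sup>+y. indicator (Q ` A) y \<partial>cone_measure ?w)" using QAm by simp
      also have "\<dots> = (\<integral>\<^sup>+y. indicator {z. top_point K u z \<in> A} (hproj u y) \<partial>cone_measure ?w)"
        using AE_cone_measure[of ?w] unfolding QA
        by (intro nn_integral_cong_AE) (auto elim!: eventually_mono split: split_indicator)
      finally have "ennreal \<kappa> * emeasure (cone_measure ?w) (Q ` A) =
          (\<integral>\<^sup>+y. indicator {z. top_point K u z \<in> A} (hproj u y) \<partial>cone_measure u)"
        using cone_measure_change_direction[OF u, of ?w "indicator {z. top_point K u z \<in> A}"] \<kappa>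
        by (simp add: \<kappa>_def)
      also have "\<dots> = (\<integral>\<^sup>+y. indicator X y \<partial>cone_measure u)"
        by (intro nn_integral_cong) (simp add: X_def indicator_def)
      finally show ?thesis by simp
    qed
    have "?H (Q ` A) = ?c * ennreal (norm ?w) * emeasure (cone_measure ?w) (Q ` A)"
      unfolding d_def using hausdorff_flat[OF w(2) QAm] QA by blast
    also have "norm ?w = q0 * \<kappa>" using \<kappa> by (simp add: q0_eq)
    finally have HQ: "?H (Q ` A) = ?c * (ennreal q0 * emeasure (cone_measure u) X)"
      unfolding Xw using q0 \<kappa> by (simp add: ennreal_mult mult_ac)
    let ?I = "\<integral>\<^sup>+y. ennreal (q (top_point K u (hproj u y))) * indicator X y \<partial>cone_measure u"
    let ?f = "\<lambda>x. if x \<in> regular_boundary K then dual_normal K x else 0"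
    have qm: "(\<lambda>y. ennreal (q (top_point K u (hproj u y))) * indicator X y) \<in> borel_measurable borel"
    proof -
      have "(\<lambda>y. ennreal (q (top_point K u (hproj u y))) * indicator X y) =
         (\<lambda>y. ennreal (norm (?f (top_point K u (hproj u y))) / (?f (top_point K u (hproj u y)) \<bullet> u)) * indicator X y)"
        using AN by (auto simp: fun_eq_iff q_def X_def top_boundary_def split: split_indicator)
      also have "\<dots> \<in> borel_measurable borel" by measurable
      finally show ?thesis .
    qed
    have "emeasure (top_measure K u) A = (\<integral>\<^sup>+y. top_density K u y * indicator A (top_point K u (hproj u y)) \<partial>cone_measure u)"
      using nn_integral_top_measure[OF u, of "indicator A"] by simp
    also have "\<dots> = (\<integral>\<^sup>+y. ?c * (ennreal (q (top_point K u (hproj u y))) * indicator X y) \<partial>cone_measure u)"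
      using AN by (intro nn_integral_cong) (auto simp: top_density_def X_def q_def Let_def mult.assoc split: split_indicator)
    also have "\<dots> = ?c * ?I" using qm by (intro nn_integral_cmult) simp
    finally have TM: "emeasure (top_measure K u) A = ?c * ?I" .
    have XN: "q (top_point K u (hproj u y)) \<le> \<eta> * q0" "q0 \<le> \<eta> * q (top_point K u (hproj u y))"
      "0 \<le> q (top_point K u (hproj u y))" if "y \<in> X" for y
    proof -
      have "top_point K u (hproj u y) \<in> top_boundary K u" "top_point K u (hproj u y) \<in> N" using that AN by (auto simp: X_def)
      then show "q (top_point K u (hproj u y)) \<le> \<eta> * q0" "q0 \<le> \<eta> * q (top_point K u (hproj u y))"
        "0 \<le> q (top_point K u (hproj u y))" using dens by (auto simp: q_def top_boundary_def)
    qed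
    have sand: "?I \<le> ennreal \<eta> * (ennreal q0 * emeasure (cone_measure u) X)"
      "ennreal q0 * emeasure (cone_measure u) X \<le> ennreal \<eta> * ?I"
      by (rule nn_integral_density_sandwich[where \<eta>=\<eta> and ?q0.0=q0]; use \<eta> q0 qm XN in \<open>simp\<close>)+
    have \<theta>_eq: "ennreal \<theta> = ennreal (\<eta> ^ d) * ennreal \<eta>"
      using \<eta> unfolding \<eta>m[symmetric] by (simp add: ennreal_mult[symmetric] mult.commute)
    have "?H A \<le> ennreal (\<eta> ^ d) * (?c * (ennreal q0 * emeasure (cone_measure u) X))" using iso(2) HQ by simp
    also have "\<dots> \<le> ennreal (\<eta> ^ d) * (?c * (ennreal \<eta> * ?I))" by (intro mult_left_mono sand) auto
    also have "\<dots> = ennreal \<theta> * (?c * ?I)" unfolding \<theta>_eq by (simp only: mult_ac)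
    finally have 1: "?H A \<le> ennreal \<theta> * emeasure (top_measure K u) A" unfolding TM .
    have "emeasure (top_measure K u) A \<le> ?c * (ennreal \<eta> * (ennreal q0 * emeasure (cone_measure u) X))"
      unfolding TM by (intro mult_left_mono sand) auto
    also have "\<dots> = ennreal \<eta> * ?H (Q ` A)" unfolding HQ by (simp only: mult_ac)
    also have "\<dots> \<le> ennreal \<eta> * (ennreal (\<eta> ^ d) * ?H A)" by (intro mult_left_mono iso) auto
    also have "\<dots> = ennreal \<theta> * ?H A" unfolding \<theta>_eq by (simp only: mult_ac)
    finally show ?thesis using 1 by (simp add: emeasure_hausdorff[OF A])
  qed
  have "open N" "x0 \<in> N" using \<delta>1(1) \<delta>2(1) by (auto simp: N_def)
  with main show ?thesis unfolding d_def by blast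
qed

theorem hausdorff_top:
  assumes u: "norm u = 1" and A: "A \<in> sets borel" "A \<subseteq> top_boundary K u"
  shows "emeasure (hausdorff_measure (DIM('a) - 1)) A = emeasure (top_measure K u) A"
proof (rule antisym)
  let ?H = "hausdorff_measure (DIM('a) - 1) :: 'a measure"
  show "emeasure ?H A \<le> emeasure (top_measure K u) A"
  proof (rule local_measure_comparison[OF _ _ _ A])
    fix \<theta> :: real and x assume "\<theta> > 1" "x \<in> top_boundary K u"
    from top_local[OF u this(2,1)] show "\<exists>N. open N \<and> x \<in> N \<and> (\<forall>A\<in>sets borel. A \<subseteq> top_boundary K u \<inter> N \<longrightarrow>
      emeasure ?H A \<le> ennreal \<theta> * emeasure (top_measure K u) A)" by blast
  qed simp_all
  show "emeasure (top_measure K u) A \<le> emeasure ?H A"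
  proof (rule local_measure_comparison[OF _ _ _ A])
    fix \<theta> :: real and x assume "\<theta> > 1" "x \<in> top_boundary K u"
    from top_local[OF u this(2,1)] show "\<exists>N. open N \<and> x \<in> N \<and> (\<forall>A\<in>sets borel. A \<subseteq> top_boundary K u \<inter> N \<longrightarrow>
      emeasure (top_measure K u) A \<le> ennreal \<theta> * emeasure ?H A)" by blast
  qed simp_all
qed

end

subsection \<open>The energy of a body\<close>

definition Lp_energy :: "real \<Rightarrow> 'a::euclidean_space set \<Rightarrow> 'a \<Rightarrow> ennreal" where
  "Lp_energy p K v =
     (\<integral>\<^sup>+\<theta>. ennreal (\<bar>v \<bullet> \<theta>\<bar> powr p * support_function K \<theta> powr (1 - p)) \<partial>surface_area_measure K)"

text \<open>At the point of the upper graph above \<open>z\<close> the dual normal is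
  \<open>(u - \<nabla>f) / (f - z \<bullet> \<nabla>f)\<close>, so this integrand is the expression
  of the overview in terms of \<open>f\<close>.\<close>

definition top_energy :: "real \<Rightarrow> 'a::euclidean_space set \<Rightarrow> 'a \<Rightarrow> 'a \<Rightarrow> ennreal" where
  "top_energy p K u v = (\<integral>\<^sup>+y. (let x = top_point K u (hproj u y) in if x \<in> top_boundary K u
     then flat_const TYPE('a) * ennreal (\<bar>v \<bullet> dual_normal K x\<bar> powr p / (dual_normal K x \<bullet> u)) else 0)
     \<partial>cone_measure u)"

text \<open>Horizontal normals cannot be seen as a density over the projection along
  \<open>u\<close>, so this part is written as an integral of cone volume.\<close>

definition side_energy :: "real \<Rightarrow> 'a::euclidean_space set \<Rightarrow> 'a \<Rightarrow> 'a \<Rightarrow> ennreal" where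
  "side_energy p K u v = (\<integral>\<^sup>+x. (if x \<in> K \<and> radial K x \<in> regular_boundary K \<and> dual_normal K (radial K x) \<bullet> u = 0
     then flat_const TYPE('a) * ennreal (\<bar>v \<bullet> dual_normal K (radial K x)\<bar> powr p) else 0) \<partial>lborel)"

lemma density_indicator_eqI:
  assumes sets: "sets N = sets M" and S: "S \<in> sets M"
    and eq: "\<And>A. A \<in> sets M \<Longrightarrow> A \<subseteq> S \<Longrightarrow> emeasure M A = emeasure N A"
    and ae: "AE x in N. x \<in> S"
  shows "density M (indicator S) = N"
proof (rule measure_eqI)
  fix A assume "A \<in> sets (density M (indicator S))"
  then have A: "A \<in> sets M" by simp
  have "emeasure (density M (indicator S)) A = (\<integral>\<^sup>+x. indicator (S \<inter> A) x \<partial>M)"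
    using S A by (simp add: emeasure_density indicator_inter_arith)
  also have "\<dots> = emeasure N (S \<inter> A)" using S A eq[of "S \<inter> A"] by simp
  also have "\<dots> = emeasure N A"
    using S A sets ae by (intro emeasure_eq_AE) auto
  finally show "emeasure (density M (indicator S)) A = emeasure N A" .
qed (simp add: sets)

context convex_body
begin

abbreviation (input) normal0 :: "'a \<Rightarrow> 'a" where
  "normal0 x \<equiv> (if x \<in> regular_boundary K then dual_normal K x else 0)"

lemma density_regular: "density (hausdorff_measure (DIM('a) - 1)) (indicator (regular_boundary K)) = radial_measure"
proof (rule density_indicator_eqI)
  show "AE x in radial_measure. x \<in> regular_boundary K"
  proof (rule AE_I[of _ _ "- regular_boundary K"])
    have "emeasure radial_measure (- regular_boundary K) =
        (\<integral>\<^sup>+x. radial_density x * indicator (- regular_boundary K) (radial K x) \<partial>lborel)"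
      by (rule emeasure_radial_measure) simp
    also have "\<dots> = (\<integral>\<^sup>+(x::'a). 0 \<partial>lborel)"
      by (rule nn_integral_cong) (simp add: radial_density_def)
    finally show "emeasure radial_measure (- regular_boundary K) = 0" by simp
  qed auto
qed (use hausdorff_regular_radial in auto)

lemma density_top:
  assumes u: "norm u = 1"
  shows "density (hausdorff_measure (DIM('a) - 1)) (indicator (top_boundary K u)) = top_measure K u"
proof (rule density_indicator_eqI)
  show "AE x in top_measure K u. x \<in> top_boundary K u"
  proof (rule AE_I[of _ _ "- top_boundary K u"])
    have "emeasure (top_measure K u) (- top_boundary K u) = (\<integral>\<^sup>+x. indicator (- top_boundary K u) x \<partial>top_measure K u)"
      by simp
    also have "\<dots> = (\<integral>\<^sup>+y. top_density K u y * indicator (- top_boundary K u) (top_point K u (hproj u y)) \<partial>cone_measure u)"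
      by (rule nn_integral_top_measure[OF u]) simp
    also have "\<dots> = (\<integral>\<^sup>+x. 0 \<partial>cone_measure u)"
      by (rule nn_integral_cong) (simp add: top_density_def Let_def)
    finally show "emeasure (top_measure K u) (- top_boundary K u) = 0" by simp
  qed auto
qed (use hausdorff_top[OF u] in auto)

lemma gauss_map_measurable:
  "gauss_map K \<in> restrict_space (hausdorff_measure d) (regular_boundary K) \<rightarrow>\<^sub>M restrict_space borel (sphere 0 1)"
proof (rule measurable_restrict_space2)
  show "gauss_map K \<in> space (restrict_space (hausdorff_measure d) (regular_boundary K)) \<rightarrow> sphere 0 1"
  proof
    fix x assume "x \<in> space (restrict_space (hausdorff_measure d) (regular_boundary K))"
    then have x: "x \<in> regular_boundary K" by (simp add: space_restrict_space)
    then show "gauss_map K x \<in> sphere 0 1"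
      using dual_normal_nonzero[OF dual_normal_in[OF x]] by (simp add: gauss_map_eq)
  qed
  have "continuous_on (regular_boundary K) (gauss_map K) \<longleftrightarrow>
      continuous_on (regular_boundary K) (\<lambda>x. dual_normal K x /\<^sub>R norm (dual_normal K x))"
    by (rule continuous_on_cong) (auto simp: gauss_map_eq)
  moreover have "continuous_on (regular_boundary K) (\<lambda>x. dual_normal K x /\<^sub>R norm (dual_normal K x))"
    using dual_normal_in dual_normal_nonzero by (intro continuous_intros continuous_dual_normal) auto
  ultimately have "gauss_map K \<in> borel_measurable (restrict_space borel (regular_boundary K))"
    by (simp add: borel_measurable_continuous_on_restrict)
  then show "gauss_map K \<in> restrict_space (hausdorff_measure d) (regular_boundary K) \<rightarrow>\<^sub>M borel"
    by (subst measurable_cong_sets[OF sets_restrict_space_cong[of _ borel] refl]) auto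
qed

lemma support_function_Lipschitz: obtains B where "B-lipschitz_on UNIV (support_function K)"
proof -
  obtain R where R: "R > 0" "\<And>x. x \<in> K \<Longrightarrow> norm x \<le> R" using outer_radius by blast
  have ne: "K \<noteq> {}" using zero_in by blast
  have *: "support_function K x - support_function K y \<le> R * norm (x - y)" for x y
  proof -
    obtain k where k: "k \<in> K" "x \<bullet> k = support_function K x"
      using support_function_attained[OF compact_K ne, of x] by blast
    have "y \<bullet> k \<le> support_function K y" using support_function_attained[OF compact_K ne, of y] k(1) by blast
    then have "support_function K x - support_function K y \<le> (x - y) \<bullet> k" using k by (simp add: inner_diff_left)
    also have "\<dots> \<le> norm (x - y) * norm k" by (rule norm_cauchy_schwarz)
    also have "\<dots> \<le> norm (x - y) * R" using R(2)[OF k(1)] by (intro mult_left_mono) auto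
    finally show ?thesis by (simp add: mult.commute)
  qed
  have "\<bar>support_function K x - support_function K y\<bar> \<le> R * norm (x - y)" for x y
    using *[of x y] *[of y x] by (simp add: abs_le_iff norm_minus_commute)
  then have "R-lipschitz_on UNIV (support_function K)" using R(1) by (intro lipschitz_onI) (auto simp: dist_norm)
  then show thesis by (rule that)
qed

lemma measurable_support_function [measurable]: "support_function K \<in> borel_measurable borel"
  using support_function_Lipschitz lipschitz_on_continuous_on borel_measurable_continuous_onI by metis

lemma nn_integral_surface:
  assumes [measurable]: "G \<in> borel_measurable borel"
  shows "(\<integral>\<^sup>+\<theta>. G \<theta> \<partial>surface_area_measure K) =
    (\<integral>\<^sup>+x. G (normal0 x /\<^sub>R norm (normal0 x)) * indicator (regular_boundary K) x \<partial>hausdorff_measure (DIM('a) - 1))"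
proof -
  have "(\<integral>\<^sup>+\<theta>. G \<theta> \<partial>surface_area_measure K) =
      (\<integral>\<^sup>+x. G (gauss_map K x) \<partial>restrict_space (hausdorff_measure (DIM('a) - 1)) (regular_boundary K))"
    unfolding surface_area_measure_def
    by (rule nn_integral_distr[OF gauss_map_measurable]) (auto intro: measurable_restrict_space1)
  also have "\<dots> = (\<integral>\<^sup>+x. G (gauss_map K x) * indicator (regular_boundary K) x \<partial>hausdorff_measure (DIM('a) - 1))"
    by (subst nn_integral_restrict_space) auto
  also have "\<dots> = (\<integral>\<^sup>+x. G (normal0 x /\<^sub>R norm (normal0 x)) * indicator (regular_boundary K) x \<partial>hausdorff_measure (DIM('a) - 1))"
    by (intro nn_integral_cong) (auto simp: gauss_map_eq split: split_indicator)
  finally show ?thesis .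
qed

text \<open>For the dual normal \<open>w\<close> at a regular point the unit normal is
  \<open>w / norm w\<close> and its support value \<open>1 / norm w\<close>; the powers of
  \<open>norm w\<close> combine to a single factor \<open>1 / norm w\<close>, whatever
  \<open>p\<close> is.\<close>

lemma Lp_energy_hausdorff:
  "Lp_energy p K v = (\<integral>\<^sup>+x. ennreal (\<bar>v \<bullet> normal0 x\<bar> powr p / norm (normal0 x)) * indicator (regular_boundary K) x
     \<partial>hausdorff_measure (DIM('a) - 1))"
  unfolding Lp_energy_def
proof (subst nn_integral_surface)
  show "(\<integral>\<^sup>+x. ennreal (\<bar>v \<bullet> (normal0 x /\<^sub>R norm (normal0 x))\<bar> powr p * support_function K (normal0 x /\<^sub>R norm (normal0 x)) powr (1 - p))
      * indicator (regular_boundary K) x \<partial>hausdorff_measure (DIM('a) - 1)) =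
    (\<integral>\<^sup>+x. ennreal (\<bar>v \<bullet> normal0 x\<bar> powr p / norm (normal0 x)) * indicator (regular_boundary K) x \<partial>hausdorff_measure (DIM('a) - 1))"
  proof (rule nn_integral_cong)
    fix x
    show "ennreal (\<bar>v \<bullet> (normal0 x /\<^sub>R norm (normal0 x))\<bar> powr p * support_function K (normal0 x /\<^sub>R norm (normal0 x)) powr (1 - p))
      * indicator (regular_boundary K) x = ennreal (\<bar>v \<bullet> normal0 x\<bar> powr p / norm (normal0 x)) * indicator (regular_boundary K) x"
    proof (cases "x \<in> regular_boundary K")
      case True
      let ?n = "dual_normal K x"
      have n: "norm ?n > 0" using dual_normal_nonzero[OF dual_normal_in[OF True]] by simp
      have s: "support_function K (?n /\<^sub>R norm ?n) = 1 / norm ?n"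
        using support_gauss_map[OF True] gauss_map_eq[OF True] by simp
      have "\<bar>v \<bullet> (?n /\<^sub>R norm ?n)\<bar> powr p * (1 / norm ?n) powr (1 - p) =
          (\<bar>v \<bullet> ?n\<bar> / norm ?n) powr p * (norm ?n) powr (p - 1)"
        using n powr_minus[of "norm ?n" "1 - p"]
        by (simp add: abs_mult divide_inverse mult.commute inverse_powr[symmetric])
      also have "\<dots> = \<bar>v \<bullet> ?n\<bar> powr p * (norm ?n powr (p - 1) / norm ?n powr p)"
        using n by (simp add: powr_divide)
      also have "norm ?n powr (p - 1) / norm ?n powr p = norm ?n powr (- 1)"
        by (simp add: powr_diff[symmetric])
      also have "\<dots> = 1 / norm ?n" using n by (simp add: powr_minus divide_inverse)
      finally show ?thesis using True by (simp add: s)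
    qed simp
  qed
qed measurable

text \<open>The density of \<open>radial_measure\<close> cancels the remaining
  \<open>1 / norm w\<close>. In this form homogeneity and convexity in \<open>v\<close> and
  invariance under reflections are evident.\<close>

lemma Lp_energy_radial:
  "Lp_energy p K v = (\<integral>\<^sup>+x. (if x \<in> K \<and> radial K x \<in> regular_boundary K
     then flat_const TYPE('a) * ennreal (\<bar>v \<bullet> dual_normal K (radial K x)\<bar> powr p) else 0) \<partial>lborel)"
proof -
  let ?F = "\<lambda>x. ennreal (\<bar>v \<bullet> normal0 x\<bar> powr p / norm (normal0 x))"
  have "Lp_energy p K v = (\<integral>\<^sup>+x. ?F x \<partial>radial_measure)"
    unfolding Lp_energy_hausdorff density_regular[symmetric]
    by (subst nn_integral_density) (auto simp: mult.commute)
  also have "\<dots> = (\<integral>\<^sup>+x. radial_density x * ?F (radial K x) \<partial>lborel)"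
    by (rule nn_integral_radial_measure) measurable
  also have "\<dots> = (\<integral>\<^sup>+x. (if x \<in> K \<and> radial K x \<in> regular_boundary K
     then flat_const TYPE('a) * ennreal (\<bar>v \<bullet> dual_normal K (radial K x)\<bar> powr p) else 0) \<partial>lborel)"
  proof (rule nn_integral_cong)
    fix x
    show "radial_density x * ?F (radial K x) = (if x \<in> K \<and> radial K x \<in> regular_boundary K
     then flat_const TYPE('a) * ennreal (\<bar>v \<bullet> dual_normal K (radial K x)\<bar> powr p) else 0)"
    proof (cases "x \<in> K \<and> radial K x \<in> regular_boundary K")
      case True
      then have "norm (dual_normal K (radial K x)) > 0" using dual_normal_nonzero[OF dual_normal_in] by auto
      then show ?thesis using True by (simp add: radial_density_def mult.assoc ennreal_mult[symmetric])
    qed (auto simp: radial_density_def)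
  qed
  finally show ?thesis .
qed

lemma Lp_energy_decomposition:
  assumes u: "norm u = 1"
  shows "Lp_energy p K v = top_energy p K u v + top_energy p K (- u) v + side_energy p K u v"
proof -
  let ?H = "hausdorff_measure (DIM('a) - 1) :: 'a measure" and ?c = "flat_const TYPE('a)"
  let ?F = "\<lambda>x. ennreal (\<bar>v \<bullet> normal0 x\<bar> powr p / norm (normal0 x))"
  define S where "S = {x \<in> regular_boundary K. dual_normal K x \<bullet> u = 0}"
  have "S = regular_boundary K \<inter> {x. normal0 x \<bullet> u = 0}" by (auto simp: S_def)
  also have "\<dots> \<in> sets borel" by measurable
  finally have [measurable]: "S \<in> sets borel" .
  have top: "(\<integral>\<^sup>+x. ?F x * indicator (top_boundary K u) x \<partial>?H) = top_energy p K u v" if u: "norm u = 1" for u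
  proof -
    have "(\<integral>\<^sup>+x. ?F x * indicator (top_boundary K u) x \<partial>?H) = (\<integral>\<^sup>+x. ?F x \<partial>top_measure K u)"
      unfolding density_top[OF u, symmetric] by (subst nn_integral_density) (auto simp: mult.commute)
    also have "\<dots> = (\<integral>\<^sup>+y. top_density K u y * ?F (top_point K u (hproj u y)) \<partial>cone_measure u)"
      by (rule nn_integral_top_measure[OF u]) measurable
    also have "\<dots> = top_energy p K u v"
      unfolding top_energy_def Let_def
    proof (rule nn_integral_cong)
      fix y
      let ?x = "top_point K u (hproj u y)"
      show "top_density K u y * ?F ?x = (if ?x \<in> top_boundary K u
        then ?c * ennreal (\<bar>v \<bullet> dual_normal K ?x\<bar> powr p / (dual_normal K ?x \<bullet> u)) else 0)"
      proof (cases "?x \<in> top_boundary K u")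
        case True
        then have r: "?x \<in> regular_boundary K" "dual_normal K ?x \<bullet> u > 0" by (auto simp: top_boundary_def)
        have "norm (dual_normal K ?x) > 0" using dual_normal_nonzero[OF dual_normal_in[OF r(1)]] by simp
        then show ?thesis using True r
          by (simp add: top_density_def Let_def mult.assoc ennreal_mult[symmetric])
      qed (simp add: top_density_def Let_def)
    qed
    finally show ?thesis .
  qed
  have side: "(\<integral>\<^sup>+x. ?F x * indicator S x \<partial>?H) = side_energy p K u v"
  proof -
    have "(\<integral>\<^sup>+x. ?F x * indicator S x \<partial>?H) = (\<integral>\<^sup>+x. indicator (regular_boundary K) x * (?F x * indicator S x) \<partial>?H)"
      by (intro nn_integral_cong) (auto simp: S_def split: split_indicator)
    also have "\<dots> = (\<integral>\<^sup>+x. ?F x * indicator S x \<partial>radial_measure)"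
      unfolding density_regular[symmetric] by (subst nn_integral_density) auto
    also have "\<dots> = (\<integral>\<^sup>+x. radial_density x * (?F (radial K x) * indicator S (radial K x)) \<partial>lborel)"
      by (rule nn_integral_radial_measure) measurable
    also have "\<dots> = side_energy p K u v"
      unfolding side_energy_def
    proof (rule nn_integral_cong)
      fix x
      show "radial_density x * (?F (radial K x) * indicator S (radial K x)) =
        (if x \<in> K \<and> radial K x \<in> regular_boundary K \<and> dual_normal K (radial K x) \<bullet> u = 0
        then ?c * ennreal (\<bar>v \<bullet> dual_normal K (radial K x)\<bar> powr p) else 0)"
      proof (cases "x \<in> K \<and> radial K x \<in> S")
        case True
        then have "norm (dual_normal K (radial K x)) > 0" using dual_normal_nonzero[OF dual_normal_in] by (auto simp: S_def)
        then show ?thesis using True by (simp add: radial_density_def S_def mult.assoc ennreal_mult[symmetric])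
      qed (auto simp: radial_density_def S_def)
    qed
    finally show ?thesis .
  qed
  have "Lp_energy p K v = (\<integral>\<^sup>+x. ?F x * indicator (top_boundary K u) x + ?F x * indicator (top_boundary K (- u)) x
      + ?F x * indicator S x \<partial>?H)"
    unfolding Lp_energy_hausdorff
  proof (rule nn_integral_cong)
    fix x
    have "indicator (regular_boundary K) x =
        indicator (top_boundary K u) x + indicator (top_boundary K (- u)) x + (indicator S x :: ennreal)"
      by (auto simp: top_boundary_def S_def split: split_indicator)
    then show "?F x * indicator (regular_boundary K) x = ?F x * indicator (top_boundary K u) x
        + ?F x * indicator (top_boundary K (- u)) x + ?F x * indicator S x"
      by (simp only: distrib_left)
  qed
  also have "\<dots> = (\<integral>\<^sup>+x. ?F x * indicator (top_boundary K u) x \<partial>?H)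
      + (\<integral>\<^sup>+x. ?F x * indicator (top_boundary K (- u)) x \<partial>?H) + (\<integral>\<^sup>+x. ?F x * indicator S x \<partial>?H)"
  proof -
    have m: "(\<lambda>x. ?F x * indicator A x) \<in> borel_measurable ?H" if [measurable]: "A \<in> sets borel" for A
      by measurable
    show ?thesis by (subst nn_integral_add, (intro borel_measurable_add m; simp), (intro m; simp),
        subst nn_integral_add, (intro m; simp), (intro m; simp), rule refl)
  qed
  finally show ?thesis using top[OF u] top[of "- u"] u side by simp
qed

text \<open>Dual normals lie in the bounded polar body, so the integrand of the cone volume form is
  bounded on the compact set \<open>K\<close>.\<close>

lemma Lp_energy_finite:
  assumes p: "p \<ge> 0" shows "Lp_energy p K v < top"
proof -
  obtain B where B: "B > 0" "\<And>w. w \<in> polar_body K \<Longrightarrow> norm w \<le> B" using polar_bounded by blast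
  let ?c = "flat_const TYPE('a)"
  have "Lp_energy p K v \<le> (\<integral>\<^sup>+x. (?c * ennreal ((norm v * B) powr p)) * indicator K x \<partial>lborel)"
    unfolding Lp_energy_radial
  proof (intro nn_integral_mono)
    fix x
    show "(if x \<in> K \<and> radial K x \<in> regular_boundary K
       then ?c * ennreal (\<bar>v \<bullet> dual_normal K (radial K x)\<bar> powr p) else 0) \<le> ?c * ennreal ((norm v * B) powr p) * indicator K x"
    proof (cases "x \<in> K \<and> radial K x \<in> regular_boundary K")
      case True
      let ?n = "dual_normal K (radial K x)"
      have "norm ?n \<le> B" using True dual_normal_in dual_normals_polar B(2) by blast
      then have "\<bar>v \<bullet> ?n\<bar> \<le> norm v * B"
        by (intro order_trans[OF Cauchy_Schwarz_ineq2] mult_left_mono) auto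
      then have "ennreal (\<bar>v \<bullet> ?n\<bar> powr p) \<le> ennreal ((norm v * B) powr p)"
        using p by (intro ennreal_leI powr_mono2) auto
      then show ?thesis using True by (simp add: mult_left_mono)
    next
      case False
      then show ?thesis unfolding if_not_P[OF False] by simp
    qed
  qed
  also have "\<dots> = (?c * ennreal ((norm v * B) powr p)) * emeasure lborel K"
    by (rule nn_integral_cmult_indicator) simp
  also have "\<dots> < top"
    using flat_const_finite[where 'a='a] emeasure_compact_finite[OF compact_K] by (simp add: ennreal_mult_less_top)
  finally show ?thesis .
qed

lemma Lp_integral_eq_energy:
  "(\<integral>\<theta>. \<bar>v \<bullet> \<theta>\<bar> powr p * support_function K \<theta> powr (1 - p) \<partial>surface_area_measure K) = enn2real (Lp_energy p K v)"
  unfolding Lp_energy_def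
proof (rule integral_eq_nn_integral)
  have "(\<lambda>\<theta>. \<bar>v \<bullet> \<theta>\<bar> powr p * support_function K \<theta> powr (1 - p)) \<in> borel_measurable borel" by measurable
  then show "(\<lambda>\<theta>. \<bar>v \<bullet> \<theta>\<bar> powr p * support_function K \<theta> powr (1 - p)) \<in> borel_measurable (surface_area_measure K)"
    unfolding surface_area_measure_def by (simp add: measurable_restrict_space1)
qed simp

end

subsection \<open>The part of the boundary with horizontal normals\<close>

lemma norm_hproj_le: assumes u: "norm u = 1" shows "norm (hproj u x) \<le> norm x"
proof -
  have uu: "u \<bullet> u = 1" using u by (simp add: dot_square_norm)
  have "hproj u x \<bullet> hproj u x = x \<bullet> x - (x \<bullet> u)\<^sup>2"
    using uu by (simp add: hproj_def inner_diff_left inner_diff_right power2_eq_square inner_commute[of u x])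
  then have "(norm (hproj u x))\<^sup>2 \<le> (norm x)\<^sup>2" by (simp add: power2_norm_eq_inner)
  then show ?thesis by (rule power2_le_imp_le) simp
qed

lemma hproj_uminus [simp]: "hproj (- u) = hproj u"
  by (simp add: hproj_def fun_eq_iff)

lemma lower_graph_eq: "lower_graph u K z = - upper_graph (- u) K z"
proof -
  have "uminus ` {s. z + s *\<^sub>R u \<in> K} = {s. z + s *\<^sub>R (- u) \<in> K}"
    by (auto simp: image_iff intro!: bexI[of _ "- _"] exI[of _ "- _"])
  then show ?thesis by (simp add: lower_graph_def upper_graph_def Inf_real_def)
qed

text \<open>The right prism over the projection of \<open>K\<close>: its gauge, restricted to the hyperplane, is the
  minkowski_gauge of the projection, so that bodies in the hyperplane need no separate treatment.\<close>

definition prism :: "'a::euclidean_space \<Rightarrow> 'a set \<Rightarrow> 'a set" where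
  "prism u K = {x. hproj u x \<in> hproj u ` K \<and> \<bar>x \<bullet> u\<bar> \<le> 1}"

text \<open>The factor of the side energy that depends on the projection alone once \<open>C\<close>
  is the prism over it.\<close>

definition side_weight :: "real \<Rightarrow> 'a::euclidean_space set \<Rightarrow> 'a \<Rightarrow> 'a \<Rightarrow> ennreal" where
  "side_weight p C v z = (if z \<in> C \<and> radial C z \<in> regular_boundary C
     then flat_const TYPE('a) * ennreal (\<bar>v \<bullet> dual_normal C (radial C z)\<bar> powr p) else 0)"

context convex_body
begin

lemma prism_body: assumes u: "norm u = 1" shows "prism u K \<in> convex_bodies_o"
proof -
  let ?T = "\<lambda>p::'a \<times> real. hproj u (fst p) + snd p *\<^sub>R u"
  have T: "linear ?T" by (rule linearI) (simp_all add: hproj_add hproj_scaleR algebra_simps)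
  have eq: "prism u K = ?T ` (K \<times> {-1..1})"
  proof safe
    fix x assume "x \<in> prism u K"
    then obtain k where k: "k \<in> K" "hproj u x = hproj u k" "\<bar>x \<bullet> u\<bar> \<le> 1" by (auto simp: prism_def)
    then have "x = ?T (k, x \<bullet> u)" by (simp add: hproj_decomp[symmetric] flip: k(2))
    then show "x \<in> ?T ` (K \<times> {-1..1})" using k by (intro image_eqI[of _ _ "(k, x \<bullet> u)"]) auto
  next
    fix k and s :: real assume "k \<in> K" "s \<in> {-1..1}"
    then show "hproj u (fst (k, s)) + snd (k, s) *\<^sub>R u \<in> prism u K"
      using u by (auto simp: prism_def hproj_add hproj_scaleR inner_add_left dot_square_norm)
  qed
  have "convex (prism u K)" unfolding eq
    by (intro convex_linear_image T convex_Times convex_K convex_real_interval)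
  moreover have "compact (prism u K)" unfolding eq
    by (intro compact_continuous_image compact_Times compact_K compact_Icc linear_continuous_on linear_conv_bounded_linear[THEN iffD1] T)
  moreover have "0 \<in> interior (prism u K)"
  proof -
    obtain r where r: "r > 0" "cball 0 r \<subseteq> K" by (rule inner_radius)
    have "cball 0 (min r 1) \<subseteq> prism u K"
    proof
      fix x :: 'a assume x: "x \<in> cball 0 (min r 1)"
      have "hproj u x \<in> K" using x norm_hproj_le[OF u, of x] by (intro subsetD[OF r(2)]) auto
      moreover have "\<bar>x \<bullet> u\<bar> \<le> 1" using Cauchy_Schwarz_ineq2[of x u] x u by simp
      ultimately show "x \<in> prism u K" using u by (auto simp: prism_def intro!: image_eqI[of _ _ "hproj u x"])
    qed
    then show ?thesis using r(1) by (auto simp: mem_interior_cball intro!: exI[of _ "min r 1"])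
  qed
  ultimately show ?thesis by (simp add: convex_bodies_o_def)
qed

lemma measurable_radial_weight:
  "(\<lambda>x. if x \<in> K \<and> radial K x \<in> regular_boundary K \<and> P (dual_normal K (radial K x))
     then G (dual_normal K (radial K x)) else 0 :: ennreal) \<in> borel_measurable borel"
  if [measurable]: "Measurable.pred borel P" "G \<in> borel_measurable borel"
proof -
  have "(\<lambda>x. if x \<in> K \<and> radial K x \<in> regular_boundary K \<and> P (dual_normal K (radial K x))
     then G (dual_normal K (radial K x)) else 0 :: ennreal) =
    (\<lambda>x. if x \<in> K \<and> radial K x \<in> regular_boundary K \<and> P (normal0 (radial K x))
     then G (normal0 (radial K x)) else 0)" by (auto simp: fun_eq_iff)
  also have "\<dots> \<in> borel_measurable borel" by measurable
  finally show ?thesis .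
qed

lemma fibre_between:
  assumes u: "norm u = 1" and z: "z \<in> hproj u ` K" and s: "lower_graph u K z \<le> s" "s \<le> upper_graph u K z"
  shows "z + s *\<^sub>R u \<in> K"
proof -
  obtain k where k: "k \<in> K" "z = hproj u k" using z by blast
  have 1: "z + (k \<bullet> u) *\<^sub>R u \<in> K" using k by (simp add: hproj_decomp[symmetric])
  then have 2: "z + upper_graph u K z *\<^sub>R u \<in> K" using upper_graph_attained(1)[OF u 1] by (simp add: top_point_def)
  have 3: "z + lower_graph u K z *\<^sub>R u \<in> K"
    using upper_graph_attained(1)[of "- u" z "- (k \<bullet> u)"] 1 u by (simp add: lower_graph_eq top_point_def)
  have "convex ((\<lambda>s. z + s *\<^sub>R u) -` K)"
  proof (rule convexI)
    fix a b x y :: real assume "x \<in> (\<lambda>s. z + s *\<^sub>R u) -` K" "y \<in> (\<lambda>s. z + s *\<^sub>R u) -` K" and ab: "0 \<le> a" "0 \<le> b" "a + b = 1"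
    then have "a *\<^sub>R (z + x *\<^sub>R u) + b *\<^sub>R (z + y *\<^sub>R u) \<in> K" using convex_K by (auto intro: convexD)
    also have "a *\<^sub>R (z + x *\<^sub>R u) + b *\<^sub>R (z + y *\<^sub>R u) = (a + b) *\<^sub>R z + (a * x + b * y) *\<^sub>R u"
      by (simp add: algebra_simps)
    finally show "a *\<^sub>R x + b *\<^sub>R y \<in> (\<lambda>s. z + s *\<^sub>R u) -` K" using ab by simp
  qed
  then have "is_interval ((\<lambda>s. z + s *\<^sub>R u) -` K)" by (simp add: is_interval_convex_1)
  then have "s \<in> (\<lambda>s. z + s *\<^sub>R u) -` K" using 2 3 s unfolding is_interval_1 by (meson vimageI2)
  then show ?thesis by simp
qed

lemma fibre_bounds:
  assumes u: "norm u = 1" and s: "z + s *\<^sub>R u \<in> K"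
  shows "lower_graph u K z \<le> s" "s \<le> upper_graph u K z"
  using upper_graph_attained(2)[OF u s] upper_graph_attained(2)[of "- u" z "- s"] u s by (auto simp: lower_graph_eq)

text \<open>Above a boundary point \<zeta> of the projection the fibre of \<open>K\<close> is a
  segment parallel to \<open>u\<close>, and at each of its inner points the dual normals of
  \<open>K\<close> are exactly those of the prism at \<zeta>. The ends of the segment may carry
  further normals, so the two exceptional heights are excluded. The factor \<rho> passes from this
  fibre to the cone over it.\<close>

lemma side_point:
  assumes u: "norm u = 1" and z: "z \<bullet> u = 0"
    and \<rho>: "\<rho> = minkowski_gauge (prism u K) z" and \<zeta>: "\<zeta> = radial (prism u K) z"
    and s: "s \<noteq> \<rho> * upper_graph u K \<zeta>" "s \<noteq> \<rho> * lower_graph u K \<zeta>"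
  shows "(if z + s *\<^sub>R u \<in> K \<and> radial K (z + s *\<^sub>R u) \<in> regular_boundary K \<and> dual_normal K (radial K (z + s *\<^sub>R u)) \<bullet> u = 0
      then flat_const TYPE('a) * ennreal (\<bar>v \<bullet> dual_normal K (radial K (z + s *\<^sub>R u))\<bar> powr p) else 0) =
    side_weight p (prism u K) v z * indicator {\<rho> * lower_graph u K \<zeta><..<\<rho> * upper_graph u K \<zeta>} s"
proof -
  define C where "C = prism u K"
  interpret C: convex_body C unfolding C_def by (rule convex_body.intro[OF prism_body[OF u]])
  note \<rho> = \<rho>[folded C_def] and \<zeta> = \<zeta>[folded C_def]
  let ?x = "z + s *\<^sub>R u"
  let ?P = "?x \<in> K \<and> radial K ?x \<in> regular_boundary K \<and> dual_normal K (radial K ?x) \<bullet> u = 0"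
  let ?Q = "z \<in> C \<and> \<zeta> \<in> regular_boundary C \<and> \<rho> * lower_graph u K \<zeta> < s \<and> s < \<rho> * upper_graph u K \<zeta>"
  have uu: "u \<bullet> u = 1" using u by (simp add: dot_square_norm)
  have hx: "hproj u ?x = z" using u z by (simp add: hproj_add hproj_scaleR hproj_idem)
  have \<zeta>u: "\<zeta> \<bullet> u = 0" using z by (simp add: \<zeta> radial_def)
  have KC: "hproj u k \<in> C" if "k \<in> K" for k using that u by (auto simp: C_def prism_def)
  \<comment> \<open>At height 0 the prism contains the points one unit above and below, which forces
    its normals to be horizontal.\<close>
  have Cdual: "w \<bullet> u = 0" if y: "y \<bullet> u = 0" "y \<in> C" and w: "w \<in> dual_normals C y" for w y
  proof -
    have "y + u \<in> C" "y - u \<in> C" using y u uu by (auto simp: C_def prism_def hproj_add hproj_diff inner_add_left inner_diff_left)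
    then have "w \<bullet> (y + u) \<le> 1" "w \<bullet> (y - u) \<le> 1" "w \<bullet> y = 1" using w by (auto simp: dual_normals_def)
    then show ?thesis by (simp add: inner_add_right inner_diff_right)
  qed
  have CK: "w \<bullet> k \<le> 1" if w: "w \<in> dual_normals C y" "w \<bullet> u = 0" and k: "k \<in> K" for w y k
  proof -
    have "w \<bullet> hproj u k \<le> 1" using w(1) KC[OF k] by (auto simp: dual_normals_def)
    then show ?thesis using w(2) by (simp add: hproj_def inner_diff_right)
  qed
  have KCd: "w \<bullet> y \<le> 1" if w: "\<And>k. k \<in> K \<Longrightarrow> w \<bullet> k \<le> 1" "w \<bullet> u = 0" and y: "y \<in> C" for w y
  proof -
    obtain k where k: "k \<in> K" "hproj u y = hproj u k" using y by (auto simp: C_def prism_def)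
    have "w \<bullet> y = w \<bullet> hproj u y" using w(2) by (simp add: hproj_def inner_diff_right)
    also have "\<dots> = w \<bullet> k" using w(2) unfolding k(2) by (simp add: hproj_def inner_diff_right)
    finally show ?thesis using w(1)[OF k(1)] by simp
  qed
  have PQ: "?Q \<and> dual_normal C \<zeta> = dual_normal K (radial K ?x)" if P: ?P
  proof -
    let ?n = "dual_normal K (radial K ?x)"
    define \<mu> where "\<mu> = minkowski_gauge K ?x"
    have x0: "?x \<noteq> 0" using P regular_frontier radial_frontier_iff by blast
    have \<mu>: "\<mu> > 0" unfolding \<mu>_def by (rule gauge_pos[OF x0])
    have n: "?n \<in> dual_normals K (radial K ?x)" using P dual_normal_in by blast
    have "w \<bullet> ?x = \<mu> * (w \<bullet> radial K ?x)" for w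
      using \<mu> unfolding radial_def \<mu>_def[symmetric] by simp
    from this[of ?n] have nx: "?n \<bullet> ?x = \<mu>" using n unfolding dual_normals_def by simp
    then have nz: "?n \<bullet> z = \<mu>" using P by (simp add: inner_add_right)
    have nk: "\<And>k. k \<in> K \<Longrightarrow> ?n \<bullet> k \<le> 1" using n by (auto simp: dual_normals_def)
    have q: "radial K ?x \<in> K" using P frontier_in regular_frontier by blast
    have "hproj u (radial K ?x) = z /\<^sub>R \<mu>" by (simp add: radial_def \<mu>_def hproj_scaleR hx)
    with KC[OF q] have zC: "z /\<^sub>R \<mu> \<in> C" by simp
    have "?n \<in> dual_normals C (z /\<^sub>R \<mu>)" using nz \<mu> KCd[OF nk] P by (auto simp: dual_normals_def)
    then have fr: "z /\<^sub>R \<mu> \<in> frontier C" and nC: "?n \<in> dual_normals C (z /\<^sub>R \<mu>)" using C.dual_normals_frontier[OF zC] by auto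
    have z0: "z \<noteq> 0" using nz \<mu> by auto
    have "minkowski_gauge C (z /\<^sub>R \<mu>) = 1" using fr C.frontier_gauge by blast
    then have "\<rho> = \<mu>" using C.gauge_scale[of "inverse \<mu>" z] \<mu> by (simp add: \<rho> field_simps)
    then have \<zeta>': "\<zeta> = z /\<^sub>R \<mu>" by (simp add: \<zeta> radial_def \<rho>)
    have "w = ?n" if w: "w \<in> dual_normals C \<zeta>" for w
    proof -
      have wu: "w \<bullet> u = 0" using Cdual[OF \<zeta>u _ w] zC \<zeta>' by simp
      have "w \<bullet> radial K ?x = w \<bullet> \<zeta>" using wu \<mu> unfolding \<zeta>' radial_def \<mu>_def[symmetric] by (simp add: inner_add_right)
      also have "\<dots> = 1" using w by (simp add: dual_normals_def)
      finally have "w \<in> dual_normals K (radial K ?x)" using CK[OF w wu] by (auto simp: dual_normals_def)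
      then show ?thesis using P dual_normal_unique by blast
    qed
    then have "dual_normals C \<zeta> = {?n}" using nC \<zeta>' by blast
    then have r: "\<zeta> \<in> regular_boundary C" "dual_normal C \<zeta> = ?n"
      using C.regular_boundary_iff fr \<zeta>' by (auto simp: dual_normal_def)
    have "\<mu> \<le> 1" using P in_iff_gauge \<mu>_def by blast
    then have "z \<in> C" using \<open>\<rho> = \<mu>\<close> \<rho> C.in_iff_gauge by simp
    have "radial K ?x = \<zeta> + (s / \<mu>) *\<^sub>R u"
      unfolding \<zeta>' radial_def \<mu>_def[symmetric] by (simp add: scaleR_add_right divide_inverse mult.commute)
    then have "lower_graph u K \<zeta> \<le> s / \<mu>" "s / \<mu> \<le> upper_graph u K \<zeta>" using fibre_bounds[OF u] q by auto
    then have "\<mu> * lower_graph u K \<zeta> \<le> s" "s \<le> \<mu> * upper_graph u K \<zeta>" using \<mu> by (auto simp: field_simps)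
    then show ?thesis using r \<open>z \<in> C\<close> s \<open>\<rho> = \<mu>\<close> by auto
  qed
  have QP: ?P if Q: ?Q
  proof -
    let ?n = "dual_normal C \<zeta>"
    have fr: "\<zeta> \<in> frontier C" "\<zeta> \<in> C" using Q C.regular_frontier C.frontier_in by blast+
    have z0: "z \<noteq> 0" using fr(1) C.radial_frontier_iff unfolding \<zeta> by blast
    have \<rho>0: "\<rho> > 0" unfolding \<rho> by (rule C.gauge_pos[OF z0])
    have \<rho>1: "\<rho> \<le> 1" using Q C.in_iff_gauge \<rho> by blast
    have z\<zeta>: "z = \<rho> *\<^sub>R \<zeta>" using \<rho>0 by (simp add: \<zeta> radial_def \<rho>[symmetric])
    define \<sigma> where "\<sigma> = s / \<rho>"
    have \<sigma>: "lower_graph u K \<zeta> < \<sigma>" "\<sigma> < upper_graph u K \<zeta>" using Q \<rho>0 by (auto simp: \<sigma>_def field_simps)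
    have \<zeta>K: "\<zeta> \<in> hproj u ` K" using fr(2) hproj_idem[OF \<zeta>u] by (auto simp: C_def prism_def)
    let ?q = "\<zeta> + \<sigma> *\<^sub>R u"
    have xq: "?x = \<rho> *\<^sub>R ?q" using \<rho>0 by (simp add: z\<zeta> \<sigma>_def scaleR_add_right)
    have qK: "?q \<in> K" using fibre_between[OF u \<zeta>K] \<sigma> by auto
    have n: "?n \<in> dual_normals C \<zeta>" using Q C.dual_normal_in by blast
    have nu: "?n \<bullet> u = 0" by (rule Cdual[OF \<zeta>u fr(2) n])
    have nq: "?n \<in> dual_normals K ?q"
      using n nu CK[OF n nu] by (auto simp: dual_normals_def inner_add_right)
    have frq: "?q \<in> frontier K" by (rule dual_normals_frontier[OF qK nq])
    have gx: "minkowski_gauge K ?x = \<rho>" unfolding xq using gauge_scale[of \<rho> ?q] \<rho>0 frq frontier_gauge by simp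
    have rx: "radial K ?x = ?q" using \<rho>0 unfolding radial_def gx by (simp add: xq)
    have "w = ?n" if w: "w \<in> dual_normals K ?q" for w
    proof -
      \<comment> \<open>Both ends of the fibre belong to \<open>K\<close> and lie strictly on
        opposite sides of \<open>?q\<close>, so a normal at \<open>?q\<close> has no component along
        \<open>u\<close>.\<close>
      have "\<zeta> + lower_graph u K \<zeta> *\<^sub>R u \<in> K" "\<zeta> + upper_graph u K \<zeta> *\<^sub>R u \<in> K"
        using fibre_between[OF u \<zeta>K] \<sigma> by auto
      then have "w \<bullet> (\<zeta> + lower_graph u K \<zeta> *\<^sub>R u) \<le> w \<bullet> ?q" "w \<bullet> (\<zeta> + upper_graph u K \<zeta> *\<^sub>R u) \<le> w \<bullet> ?q"
        using w by (auto simp: dual_normals_def)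
      then have "(lower_graph u K \<zeta> - \<sigma>) * (w \<bullet> u) \<le> 0" "(upper_graph u K \<zeta> - \<sigma>) * (w \<bullet> u) \<le> 0"
        by (auto simp: inner_add_right algebra_simps)
      then have wu: "w \<bullet> u = 0" using \<sigma> by (auto simp: mult_le_0_iff)
      have "w \<in> dual_normals C \<zeta>"
        using w wu KCd[of w] by (auto simp: dual_normals_def inner_add_right)
      then show ?thesis using Q C.dual_normal_unique by blast
    qed
    then have "dual_normals K ?q = {?n}" using nq by blast
    then have "?q \<in> regular_boundary K" "dual_normal K ?q = ?n"
      using regular_boundary_iff frq by (auto simp: dual_normal_def)
    moreover have "?x \<in> K" unfolding in_iff_gauge gx by (rule \<rho>1)
    ultimately show ?thesis using nu rx by simp
  qed
  show ?thesis
  proof (cases ?P)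
    case True
    then show ?thesis using PQ[OF True] by (simp add: side_weight_def C_def[symmetric] \<zeta>[symmetric])
  next
    case False
    then have "\<not> ?Q" using QP by blast
    then show ?thesis using False by (auto simp: side_weight_def C_def[symmetric] \<zeta>[symmetric])
  qed
qed

text \<open>\<open>K\<close> enters only through its projection and its fibre lengths over the
  boundary of that projection. Both are the same for all members of a shadow system.\<close>

lemma side_energy_fibres:
  assumes u: "norm u = 1"
  shows "side_energy p K u v = (\<integral>\<^sup>+x. indicator {x. 0 \<le> x \<bullet> u \<and> x \<bullet> u < 1} x *
    (side_weight p (prism u K) v (hproj u x) * ennreal (minkowski_gauge (prism u K) (hproj u x) *
      (upper_graph u K (radial (prism u K) (hproj u x)) - lower_graph u K (radial (prism u K) (hproj u x))))) \<partial>lborel)"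
proof -
  define C where "C = prism u K"
  interpret C: convex_body C unfolding C_def by (rule convex_body.intro[OF prism_body[OF u]])
  let ?W = "\<lambda>x. (if x \<in> K \<and> radial K x \<in> regular_boundary K \<and> dual_normal K (radial K x) \<bullet> u = 0
     then flat_const TYPE('a) * ennreal (\<bar>v \<bullet> dual_normal K (radial K x)\<bar> powr p) else 0)"
  have Wm: "?W \<in> borel_measurable borel" by (rule measurable_radial_weight) measurable
  show ?thesis
    unfolding side_energy_def nn_integral_slab[OF u Wm]
  proof (rule nn_integral_cong, rule arg_cong2[where f="(*)"], rule refl)
    fix x
    let ?z = "hproj u x"
    let ?l = "minkowski_gauge C ?z" and ?\<zeta> = "radial C ?z"
    let ?a = "?l * lower_graph u K ?\<zeta>" and ?b = "?l * upper_graph u K ?\<zeta>"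
    have z: "?z \<bullet> u = 0" using u by simp
    have "(\<integral>\<^sup>+s. ?W (?z + s *\<^sub>R u) \<partial>lborel) = (\<integral>\<^sup>+s. side_weight p C v ?z * indicator {?a<..<?b} s \<partial>lborel)"
    proof (rule nn_integral_cong_AE)
      \<comment> \<open>The two heights excluded in \<open>side_point\<close> form a null set on
        each line.\<close>
      have "AE s in lborel. s \<noteq> ?b" "AE s in lborel. s \<noteq> ?a" by (rule AE_lborel_singleton)+
      then show "AE s in lborel. ?W (?z + s *\<^sub>R u) = side_weight p C v ?z * indicator {?a<..<?b} s"
      proof eventually_elim
        case (elim s)
        then show ?case unfolding C_def by (intro side_point[OF u z refl refl]) auto
      qed
    qed
    also have "\<dots> = side_weight p C v ?z * emeasure lborel {?a<..<?b}"
      by (rule nn_integral_cmult_indicator) simp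
    also have "\<dots> = side_weight p C v ?z * ennreal (?l * (upper_graph u K ?\<zeta> - lower_graph u K ?\<zeta>))"
    proof (cases "side_weight p C v ?z = 0")
      case False
      then have r: "?\<zeta> \<in> regular_boundary C" by (auto simp: side_weight_def split: if_splits)
      have "?\<zeta> \<bullet> u = 0" using z by (simp add: radial_def)
      moreover have "?\<zeta> \<in> C" using r C.frontier_in C.regular_frontier by blast
      ultimately have "?\<zeta> \<in> hproj u ` K" using hproj_idem[of ?\<zeta> u] by (auto simp: C_def prism_def)
      then obtain k where k: "k \<in> K" "?\<zeta> = hproj u k" by blast
      then have "?\<zeta> + (k \<bullet> u) *\<^sub>R u \<in> K" by (simp add: hproj_decomp[symmetric])
      then have "lower_graph u K ?\<zeta> \<le> upper_graph u K ?\<zeta>" using fibre_bounds[OF u] by (meson order_trans)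
      then have "?a \<le> ?b" using C.gauge_nonneg by (intro mult_left_mono)
      then show ?thesis by (simp add: right_diff_distrib)
    qed simp
    finally show "(\<integral>\<^sup>+s. ?W (?z + s *\<^sub>R u) \<partial>lborel) = side_weight p (prism u K) v ?z *
      ennreal (minkowski_gauge (prism u K) ?z * (upper_graph u K (radial (prism u K) ?z) - lower_graph u K (radial (prism u K) ?z)))"
      unfolding C_def .
  qed
qed

end

lemma side_energy_cong:
  assumes K: "K \<in> convex_bodies_o" and L: "L \<in> convex_bodies_o" and u: "norm u = 1"
    and proj: "hproj u ` K = hproj u ` L"
    and len: "\<And>z. z \<in> hproj u ` K \<Longrightarrow>
      upper_graph u K z - lower_graph u K z = upper_graph u L z - lower_graph u L z"
    and v: "hproj u v = hproj u v'"
  shows "side_energy p K u v = side_energy p L u v'"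
proof -
  interpret K: convex_body K by (rule convex_body.intro[OF K])
  interpret L: convex_body L by (rule convex_body.intro[OF L])
  define C where "C = prism u K"
  interpret C: convex_body C unfolding C_def by (rule convex_body.intro[OF K.prism_body[OF u]])
  have CL: "C = prism u L" by (simp add: C_def prism_def proj)
  have uu: "u \<bullet> u = 1" using u by (simp add: dot_square_norm)
  show ?thesis
    unfolding K.side_energy_fibres[OF u] L.side_energy_fibres[OF u] C_def[symmetric] CL[symmetric]
  proof (rule nn_integral_cong, rule arg_cong2[where f="(*)"], rule refl)
    fix x
    let ?z = "hproj u x"
    let ?\<zeta> = "radial C ?z"
    show "side_weight p C v ?z * ennreal (minkowski_gauge C ?z * (upper_graph u K ?\<zeta> - lower_graph u K ?\<zeta>)) =
      side_weight p C v' ?z * ennreal (minkowski_gauge C ?z * (upper_graph u L ?\<zeta> - lower_graph u L ?\<zeta>))"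
    proof (cases "?z \<in> C \<and> ?\<zeta> \<in> regular_boundary C")
      case True
      let ?n = "dual_normal C ?\<zeta>"
      have \<zeta>C: "?\<zeta> \<in> C" using True C.frontier_in C.regular_frontier by blast
      have \<zeta>u: "?\<zeta> \<bullet> u = 0" using u by (simp add: radial_def)
      have "?\<zeta> + u \<in> C" "?\<zeta> - u \<in> C"
        using \<zeta>C \<zeta>u u uu by (auto simp: C_def prism_def hproj_add hproj_diff inner_add_left inner_diff_left)
      then have "?n \<bullet> (?\<zeta> + u) \<le> 1" "?n \<bullet> (?\<zeta> - u) \<le> 1" "?n \<bullet> ?\<zeta> = 1"
        using C.dual_normal_in[of ?\<zeta>] True by (auto simp: dual_normals_def)
      then have nu: "?n \<bullet> u = 0" by (simp add: inner_add_right inner_diff_right)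
      \<comment> \<open>The normals of the prism at height 0 are horizontal, so \<open>v\<close>
        enters only through its projection.\<close>
      have "v \<bullet> ?n = hproj u v \<bullet> ?n" "v' \<bullet> ?n = hproj u v' \<bullet> ?n"
        using nu by (simp_all add: hproj_def inner_diff_left inner_commute[of u])
      then have "v \<bullet> ?n = v' \<bullet> ?n" using v by simp
      moreover have "?\<zeta> \<in> hproj u ` K" using \<zeta>C hproj_idem[OF \<zeta>u] by (auto simp: C_def prism_def)
      ultimately show ?thesis using len by (simp add: side_weight_def)
    next
      case False
      then show ?thesis unfolding side_weight_def if_not_P[OF False] by simp
    qed
  qed
qed

lemma Lp_energy_reflection:
  assumes K: "K \<in> convex_bodies_o" and L: "L \<in> convex_bodies_o" and u: "norm u = 1"
    and refl: "L = reflection u ` K"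
  shows "Lp_energy p L (reflection u v) = Lp_energy p K v"
proof -
  interpret K: convex_body K by (rule convex_body.intro[OF K])
  interpret L: convex_body L by (rule convex_body.intro[OF L])
  let ?r = "reflection u"
  have rr: "?r (?r x) = x" for x using u by simp
  have inL: "?r x \<in> L \<longleftrightarrow> x \<in> K" for x unfolding refl using rr by (metis image_iff)
  have dual: "dual_normals L (?r x) = ?r ` dual_normals K x" for x
  proof -
    have "w \<in> dual_normals L (?r x) \<longleftrightarrow> ?r w \<in> dual_normals K x" for w
      unfolding dual_normals_def refl using inner_reflection'[of u w] by simp
    then show ?thesis using rr by (metis (no_types, lifting) image_iff set_eqI)
  qed
  have gauge_le: "minkowski_gauge L (?r x) \<le> 1 \<longleftrightarrow> minkowski_gauge K x \<le> 1" for x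
    using inL K.in_iff_gauge L.in_iff_gauge by blast
  \<comment> \<open>The gauges have corresponding unit balls; applying this to \<open>x\<close>
    divided by either gauge gives the two inequalities.\<close>
  have g: "minkowski_gauge L (?r x) = minkowski_gauge K x" for x
  proof (cases "x = 0")
    case False
    have r0: "?r x \<noteq> 0" using False rr[of x] linear_0[OF linear_reflection] by metis
    have scale: "minkowski_gauge L (?r (c *\<^sub>R x)) = c * minkowski_gauge L (?r x)" if "c \<ge> 0" for c
      using L.gauge_scale[OF that] by (simp add: linear_scale[OF linear_reflection])
    have p: "minkowski_gauge K x > 0" "minkowski_gauge L (?r x) > 0" using K.gauge_pos[OF False] L.gauge_pos[OF r0] by auto
    have "minkowski_gauge L (?r ((1 / minkowski_gauge K x) *\<^sub>R x)) \<le> 1"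
      unfolding gauge_le using p K.gauge_scale[of "1 / minkowski_gauge K x" x] by simp
    then have 1: "minkowski_gauge L (?r x) \<le> minkowski_gauge K x" using p by (subst (asm) scale) (auto simp: field_simps)
    have "minkowski_gauge L (?r ((1 / minkowski_gauge L (?r x)) *\<^sub>R x)) \<le> 1" using p by (subst scale) auto
    then have "minkowski_gauge K x \<le> minkowski_gauge L (?r x)"
      unfolding gauge_le using p K.gauge_scale[of "1 / minkowski_gauge L (?r x)" x] by (simp add: field_simps)
    with 1 show ?thesis by simp
  qed (simp add: linear_0[OF linear_reflection])
  have rad: "radial L (?r x) = ?r (radial K x)" for x
    by (simp add: radial_def g linear_scale[OF linear_reflection])
  have reg: "?r x \<in> regular_boundary L \<longleftrightarrow> x \<in> regular_boundary K" for x
  proof -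
    have "is_singleton (?r ` S) \<longleftrightarrow> is_singleton S" for S
      using rr by (metis (no_types, lifting) bij_betw_same_card bij_betw_imageI inj_on_def is_singleton_altdef)
    then show ?thesis
      unfolding K.regular_boundary_iff L.regular_boundary_iff K.frontier_gauge L.frontier_gauge g dual
      by (simp add: is_singleton_def)
  qed
  have nor: "dual_normal L (?r x) = ?r (dual_normal K x)" if "x \<in> regular_boundary K" for x
    using L.dual_normal_unique[of "?r x" "?r (dual_normal K x)"] that reg dual K.dual_normal_in by auto
  let ?F = "\<lambda>x. if x \<in> L \<and> radial L x \<in> regular_boundary L
     then flat_const TYPE('a) * ennreal (\<bar>?r v \<bullet> dual_normal L (radial L x)\<bar> powr p) else 0"
  have Fm: "?F \<in> borel_measurable borel"
    using L.measurable_radial_weight[of "\<lambda>_. True" "\<lambda>w. flat_const TYPE('a) * ennreal (\<bar>?r v \<bullet> w\<bar> powr p)"] by simp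
  have "Lp_energy p L (?r v) = (\<integral>\<^sup>+x. ?F (?r x) \<partial>lborel)"
    unfolding L.Lp_energy_radial by (rule nn_integral_reflection[OF u Fm, symmetric])
  also have "\<dots> = Lp_energy p K v"
    unfolding K.Lp_energy_radial
    by (intro nn_integral_cong) (auto simp: rad reg nor inL inner_reflection[OF u])
  finally show ?thesis .
qed

subsection \<open>Regularity over almost every point of the projection\<close>

text \<open>The relative interior of the projection of \<open>K\<close>.\<close>

definition inner_projection :: "'a::euclidean_space \<Rightarrow> 'a set \<Rightarrow> 'a set" where
  "inner_projection u K = {z. z \<bullet> u = 0 \<and> (\<exists>\<delta>>0. (1 + \<delta>) *\<^sub>R z \<in> hproj u ` K)}"

text \<open>Seen over the orthogonal complement of \<open>u\<close>, the hyperplane with normal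
  \<open>w\<close> is the graph of an affine function; this is its derivative in direction
  \<open>e\<close>.\<close>

definition slope :: "'a::euclidean_space \<Rightarrow> 'a \<Rightarrow> 'a \<Rightarrow> real" where
  "slope u e w = - (w \<bullet> e) / (w \<bullet> u)"

text \<open>The intervals from \<open>q k\<close> to \<open>p k\<close> descend as \<open>k\<close>
  grows. Removing the largest index, whose interval is lowest, leaves intervals above
  \<open>p b\<close>, so the induction continues with \<open>p b\<close> as the new lower
  bound.\<close>

lemma disjoint_gaps_card:
  fixes p q :: "nat \<Rightarrow> real"
  assumes "finite I" and "\<And>k. k \<in> I \<Longrightarrow> c \<le> q k \<and> p k \<le> d" and "\<And>k. k \<in> I \<Longrightarrow> \<epsilon> \<le> p k - q k"
    and "\<And>k l. k \<in> I \<Longrightarrow> l \<in> I \<Longrightarrow> k < l \<Longrightarrow> p l \<le> q k" and "c \<le> d"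
  shows "real (card I) * \<epsilon> \<le> d - c"
  using assms
proof (induction I arbitrary: c rule: finite_linorder_max_induct)
  case (insert b A)
  have *: "real (card A) * \<epsilon> \<le> d - p b"
    using insert.prems(1,2,3) insert.hyps(2) by (intro insert.IH) auto
  have "b \<notin> A" using insert.hyps(2) by blast
  then have "real (card (insert b A)) * \<epsilon> = real (card A) * \<epsilon> + \<epsilon>"
    using insert.hyps(1) by (simp add: algebra_simps)
  also have "\<dots> \<le> d - c" using * insert.prems(1)[of b] insert.prems(2)[of b] by simp
  finally show ?case .
qed simp

lemma ennreal_zero_if_multiples_bounded:
  fixes x C :: ennreal
  assumes C: "C < top" and le: "\<And>n::nat. of_nat n * x \<le> C"
  shows "x = 0"
proof (rule ccontr)
  assume "x \<noteq> 0"
  have "x \<noteq> top" using le[of 1] C by (auto simp: top_unique)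
  then obtain r where r: "x = ennreal r" "r \<ge> 0" by (cases x) auto
  obtain c where c: "C = ennreal c" "c \<ge> 0" using C by (cases C) auto
  have "r > 0" using \<open>x \<noteq> 0\<close> r by auto
  obtain n :: nat where "c / r < real n" using reals_Archimedean2 by blast
  then have "c < real n * r" using \<open>r > 0\<close> by (simp add: field_simps)
  moreover have "ennreal (real n * r) \<le> ennreal c"
    using le[of n] r c by (simp add: ennreal_of_nat_eq_real_of_nat ennreal_mult)
  ultimately show False using c by (simp add: ennreal_le_iff)
qed

context convex_body
begin

text \<open>Mixing \<open>k\<close> with the interior point \<open>r u\<close> produces a point
  strictly above \<open>c *\<^sub>R k\<close> in the fibre over \<open>z\<close>. A normal at the
  top has value 1 there but at most \<open>c < 1\<close> at \<open>c *\<^sub>R k\<close>, hence it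
  increases along \<open>u\<close>.\<close>

lemma inner_projection_top:
  assumes u: "norm u = 1" and z: "z \<in> inner_projection u K"
  shows "top_point K u z \<in> frontier K" "hproj u (top_point K u z) = z"
    "\<And>w. w \<in> dual_normals K (top_point K u z) \<Longrightarrow> w \<bullet> u > 0"
proof -
  have zu: "z \<bullet> u = 0" using z by (simp add: inner_projection_def)
  obtain \<delta> where \<delta>: "\<delta> > 0" "(1 + \<delta>) *\<^sub>R z \<in> hproj u ` K" using z by (auto simp: inner_projection_def)
  obtain k where k: "k \<in> K" "(1 + \<delta>) *\<^sub>R z = hproj u k" using \<delta>(2) by blast
  obtain r where r: "r > 0" "cball 0 r \<subseteq> K" by (rule inner_radius)
  define c where "c = 1 / (1 + \<delta>)"
  have c: "0 < c" "c < 1" "1 - c = c * \<delta>" using \<delta>(1) by (auto simp: c_def field_simps)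
  have cz: "c *\<^sub>R hproj u k = z" unfolding k(2)[symmetric] using \<delta>(1) by (simp add: c_def)
  define s0 where "s0 = c * (k \<bullet> u)"
  have ck: "c *\<^sub>R k = z + s0 *\<^sub>R u"
    by (subst hproj_decomp[of k u]) (simp add: cz scaleR_add_right s0_def)
  have "r *\<^sub>R u \<in> K" using r u by (intro subsetD[OF r(2)]) simp
  then have "c *\<^sub>R k + (1 - c) *\<^sub>R (r *\<^sub>R u) \<in> K" using c k(1) by (intro convexD[OF convex_K]) auto
  then have in1: "z + (s0 + (1 - c) * r) *\<^sub>R u \<in> K" unfolding ck by (simp add: algebra_simps)
  have top: "top_point K u z \<in> K" and up: "s0 + (1 - c) * r \<le> upper_graph u K z"
    using upper_graph_attained[OF u in1] by auto
  define f where "f = upper_graph u K z"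
  have fs: "s0 < f" using up c r(1) unfolding f_def by (smt (verit) mult_pos_pos)
  have tp: "top_point K u z = z + f *\<^sub>R u" by (simp add: top_point_def f_def)
  show h: "hproj u (top_point K u z) = z" using u zu by (simp add: tp hproj_add hproj_scaleR hproj_idem)
  show fr: "top_point K u z \<in> frontier K"
  proof (rule ccontr)
    assume "top_point K u z \<notin> frontier K"
    then have "top_point K u z \<in> interior K" using top closed_K by (simp add: frontier_def)
    then obtain e where e: "e > 0" "cball (top_point K u z) e \<subseteq> K" by (meson mem_interior_cball)
    have "z + (f + e) *\<^sub>R u \<in> K"
      using e u by (intro subsetD[OF e(2)]) (simp add: tp dist_norm scaleR_add_left)
    then have "f + e \<le> f" using upper_graph_attained(2)[OF u] f_def by blast
    then show False using e(1) by simp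
  qed
  show "w \<bullet> u > 0" if w: "w \<in> dual_normals K (top_point K u z)" for w
  proof (rule ccontr)
    assume "\<not> w \<bullet> u > 0"
    then have "(f - s0) * (w \<bullet> u) \<le> 0" using fs by (simp add: mult_le_0_iff)
    moreover have "w \<bullet> (z + f *\<^sub>R u) = w \<bullet> (z + s0 *\<^sub>R u) + (f - s0) * (w \<bullet> u)"
      by (simp add: inner_add_right algebra_simps)
    ultimately have "1 \<le> w \<bullet> (c *\<^sub>R k)" using w unfolding tp ck dual_normals_def by simp
    moreover have "w \<bullet> k \<le> 1" using w k(1) by (auto simp: dual_normals_def)
    then have "c * (w \<bullet> k) \<le> c" using c by (simp add: mult_left_le)
    ultimately show False using c by simp
  qed
qed

text \<open>If the projected point were on the relative boundary, a horizontal normal of the prism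
  there would also be a normal of \<open>K\<close> at \<open>x\<close>, different from the unique
  one, which has a positive component along \<open>u\<close>.\<close>

lemma top_boundary_inner_projection:
  assumes u: "norm u = 1" and x: "x \<in> top_boundary K u"
  shows "hproj u x \<in> inner_projection u K"
proof (rule ccontr)
  assume notU: "hproj u x \<notin> inner_projection u K"
  define C where "C = prism u K"
  interpret C: convex_body C unfolding C_def by (rule convex_body.intro[OF prism_body[OF u]])
  let ?z = "hproj u x"
  have r: "x \<in> regular_boundary K" and p: "dual_normal K x \<bullet> u > 0" using x by (auto simp: top_boundary_def)
  have uu: "u \<bullet> u = 1" using u by (simp add: dot_square_norm)
  have zu: "?z \<bullet> u = 0" using u by simp
  have KC: "hproj u k \<in> C" if "k \<in> K" for k using that u by (auto simp: C_def prism_def)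
  have zC: "?z \<in> C" using r frontier_in regular_frontier by (intro KC) blast
  have "minkowski_gauge C ?z = 1"
  proof (rule ccontr)
    assume "minkowski_gauge C ?z \<noteq> 1"
    then have g1: "minkowski_gauge C ?z < 1" using zC C.in_iff_gauge by (simp add: order_less_le)
    show False
    \<comment> \<open>Radial projection does not reach the boundary from 0, so any positive dilation
      is taken there.\<close>
    proof (cases "?z = 0")
      case True
      have "(1 + 1) *\<^sub>R ?z \<in> hproj u ` K" unfolding True using zero_in by (auto intro!: image_eqI[of _ _ 0])
      then have "\<exists>\<delta>>0. (1 + \<delta>) *\<^sub>R ?z \<in> hproj u ` K" by (intro exI[of _ 1]) (simp only: zero_less_one simp_thms)
      then show False using notU zu unfolding inner_projection_def by blast
    next
      case False
      then have g0: "minkowski_gauge C ?z > 0" by (rule C.gauge_pos)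
      have "radial C ?z \<in> C" using C.radial_frontier[OF False] C.frontier_in by blast
      then have "hproj u (radial C ?z) \<in> hproj u ` K" by (simp add: C_def prism_def)
      moreover have "hproj u (radial C ?z) = (1 + (1 / minkowski_gauge C ?z - 1)) *\<^sub>R ?z"
        using u by (simp add: radial_def hproj_scaleR divide_inverse)
      ultimately have "(1 + (1 / minkowski_gauge C ?z - 1)) *\<^sub>R ?z \<in> hproj u ` K" by simp
      moreover have "1 / minkowski_gauge C ?z - 1 > 0" using g0 g1 by simp
      ultimately show False using notU zu unfolding inner_projection_def by blast
    qed
  qed
  then obtain w where w: "w \<in> dual_normals C ?z" using C.dual_normals_ex C.frontier_gauge by blast
  have "?z + u \<in> C" "?z - u \<in> C" using zC u uu
    by (auto simp: C_def prism_def hproj_add hproj_diff inner_add_left inner_diff_left)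
  then have "w \<bullet> (?z + u) \<le> 1" "w \<bullet> (?z - u) \<le> 1" "w \<bullet> ?z = 1" using w by (auto simp: dual_normals_def)
  then have wu: "w \<bullet> u = 0" by (simp add: inner_add_right inner_diff_right)
  have wh: "w \<bullet> y = w \<bullet> hproj u y" for y using wu by (simp add: hproj_def inner_diff_right)
  have "w \<in> dual_normals K x"
    using w KC by (auto simp: dual_normals_def wh[of x]) (metis wh)
  then have "w = dual_normal K x" using r dual_normal_unique by blast
  then show False using p wu by simp
qed

text \<open>Concavity of the upper graph: the supporting inequalities at \<open>x\<close> and at
  \<open>y\<close> bound the rise \<open>(y - x) \<bullet> u\<close> from above and from below by
  \<open>c\<close> times the respective slopes.\<close>

lemma slope_antimono:
  assumes x: "x \<in> K" "w \<in> dual_normals K x" "w \<bullet> u > 0" and y: "y \<in> K" "w' \<in> dual_normals K y" "w' \<bullet> u > 0"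
    and u: "norm u = 1" and e: "hproj u y = hproj u x + c *\<^sub>R e" "c > 0"
  shows "slope u e w' \<le> slope u e w"
proof -
  have d: "y - x = c *\<^sub>R e + ((y - x) \<bullet> u) *\<^sub>R u"
    using e(1) by (simp add: hproj_def algebra_simps)
  have ineq: "c * (v \<bullet> e) + ((y - x) \<bullet> u) * (v \<bullet> u) = v \<bullet> (y - x)" for v
    by (subst (2) d) (simp add: inner_add_right)
  have "w \<bullet> (y - x) \<le> 0" "0 \<le> w' \<bullet> (y - x)"
    using x y by (auto simp: dual_normals_def inner_diff_right)
  then have 1: "c * (w \<bullet> e) + ((y - x) \<bullet> u) * (w \<bullet> u) \<le> 0" and 2: "0 \<le> c * (w' \<bullet> e) + ((y - x) \<bullet> u) * (w' \<bullet> u)"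
    by (simp_all add: ineq)
  from 1 have "(y - x) \<bullet> u \<le> c * slope u e w" using x(3) by (simp add: slope_def field_simps)
  moreover from 2 have "c * slope u e w' \<le> (y - x) \<bullet> u" using y(3) by (simp add: slope_def field_simps)
  ultimately have "c * slope u e w' \<le> c * slope u e w" by linarith
  then show ?thesis using e(2) by simp
qed

text \<open>The same \<epsilon> bounds the jump of the slope and the component along
  \<open>u\<close> of both normals from below. The second bound keeps the slopes bounded and the set
  compact.\<close>

definition steep_jumps :: "'a \<Rightarrow> 'a \<Rightarrow> real \<Rightarrow> 'a set" where
  "steep_jumps u e \<epsilon> = {x \<in> K. \<exists>w1 \<in> dual_normals K x. \<exists>w2 \<in> dual_normals K x.
     w1 \<bullet> u \<ge> \<epsilon> \<and> w2 \<bullet> u \<ge> \<epsilon> \<and> \<epsilon> \<le> slope u e w1 - slope u e w2}"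

lemma steep_jumps_compact: assumes \<epsilon>: "\<epsilon> > 0" shows "compact (steep_jumps u e \<epsilon>)"
proof -
  let ?G = "{(x, w). x \<in> K \<and> w \<in> polar_body K \<and> w \<bullet> x = 1}"
  let ?D = "{p::('a \<times> 'a) \<times> ('a \<times> 'a). fst (fst p) = fst (snd p) \<and> snd (fst p) \<bullet> u \<ge> \<epsilon> \<and> snd (snd p) \<bullet> u \<ge> \<epsilon> \<and>
    \<epsilon> * ((snd (fst p) \<bullet> u) * (snd (snd p) \<bullet> u)) \<le> (snd (snd p) \<bullet> e) * (snd (fst p) \<bullet> u) - (snd (fst p) \<bullet> e) * (snd (snd p) \<bullet> u)}"
  \<comment> \<open>Clearing the positive denominators turns the jump condition into one that is
    visibly closed.\<close>
  have iff: "\<epsilon> * ((w1 \<bullet> u) * (w2 \<bullet> u)) \<le> (w2 \<bullet> e) * (w1 \<bullet> u) - (w1 \<bullet> e) * (w2 \<bullet> u) \<longleftrightarrow> \<epsilon> \<le> slope u e w1 - slope u e w2"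
    if "w1 \<bullet> u \<ge> \<epsilon>" "w2 \<bullet> u \<ge> \<epsilon>" for w1 w2
  proof -
    have p: "w1 \<bullet> u > 0" "w2 \<bullet> u > 0" using that \<epsilon> by auto
    have "slope u e w1 - slope u e w2 = ((w2 \<bullet> e) * (w1 \<bullet> u) - (w1 \<bullet> e) * (w2 \<bullet> u)) / ((w1 \<bullet> u) * (w2 \<bullet> u))"
      using p by (simp add: slope_def field_simps)
    then show ?thesis using p by (simp add: le_divide_eq)
  qed
  have "closed ?D" by (intro closed_Collect_conj closed_Collect_le closed_Collect_eq continuous_intros)
  then have "compact ((\<lambda>p. fst (fst p)) ` ((?G \<times> ?G) \<inter> ?D))"
    by (intro compact_continuous_image compact_Int_closed compact_Times dual_normals_closed_graph continuous_intros)
  also have "(\<lambda>p. fst (fst p)) ` ((?G \<times> ?G) \<inter> ?D) = steep_jumps u e \<epsilon>"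
  proof (rule set_eqI, rule iffI)
    fix x assume "x \<in> (\<lambda>p. fst (fst p)) ` ((?G \<times> ?G) \<inter> ?D)"
    then obtain w1 w2 where w: "x \<in> K" "w1 \<in> dual_normals K x" "w2 \<in> dual_normals K x" "w1 \<bullet> u \<ge> \<epsilon>" "w2 \<bullet> u \<ge> \<epsilon>"
      "\<epsilon> * ((w1 \<bullet> u) * (w2 \<bullet> u)) \<le> (w2 \<bullet> e) * (w1 \<bullet> u) - (w1 \<bullet> e) * (w2 \<bullet> u)"
      by (auto simp: dual_normals_polar)
    then show "x \<in> steep_jumps u e \<epsilon>" unfolding steep_jumps_def using iff by blast
  next
    fix x assume "x \<in> steep_jumps u e \<epsilon>"
    then obtain w1 w2 where w: "x \<in> K" "w1 \<in> dual_normals K x" "w2 \<in> dual_normals K x" "w1 \<bullet> u \<ge> \<epsilon>" "w2 \<bullet> u \<ge> \<epsilon>"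
      "\<epsilon> \<le> slope u e w1 - slope u e w2" unfolding steep_jumps_def by blast
    then have "((x, w1), (x, w2)) \<in> (?G \<times> ?G) \<inter> ?D" using iff by (auto simp: dual_normals_polar)
    then show "x \<in> (\<lambda>p. fst (fst p)) ` ((?G \<times> ?G) \<inter> ?D)" by force
  qed
  finally show ?thesis .
qed

text \<open>Along a line in direction \<open>e\<close> the jumps of the slope are bounded below and the slope is monotone
  and bounded, so a grid of mesh \<open>1/N\<close> on a unit segment meets the set in boundedly many points.
  Averaging over translations, \<open>N\<close> times its measure stays bounded as \<open>N\<close> grows.\<close>

lemma steep_jumps_null:
  assumes u: "norm u = 1" and e: "e \<bullet> u = 0" and \<epsilon>: "\<epsilon> > 0"
  shows "emeasure (cone_measure u) {y. hproj u y \<in> hproj u ` steep_jumps u e \<epsilon>} = 0"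
proof -
  let ?Z = "hproj u ` steep_jumps u e \<epsilon>"
  have "compact ?Z" by (intro compact_continuous_image continuous_hproj steep_jumps_compact \<epsilon>)
  then have Zm [measurable]: "?Z \<in> sets borel" by (simp add: borel_closed compact_imp_closed)
  obtain B where B: "B > 0" "\<And>w. w \<in> polar_body K \<Longrightarrow> norm w \<le> B" using polar_bounded by blast
  obtain R where R: "R > 0" "\<And>x. x \<in> K \<Longrightarrow> norm x \<le> R" using outer_radius by blast
  define L where "L = B * norm e / \<epsilon>"
  have L0: "L \<ge> 0" using B(1) \<epsilon> by (simp add: L_def)
  have slope_le: "\<bar>slope u e w\<bar> \<le> L" if "w \<in> dual_normals K x" "w \<bullet> u \<ge> \<epsilon>" for w x
  proof -
    have "\<bar>slope u e w\<bar> = \<bar>w \<bullet> e\<bar> / (w \<bullet> u)" using that \<epsilon> by (simp add: slope_def)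
    also have "\<dots> \<le> (B * norm e) / \<epsilon>"
    proof (rule frac_le)
      have "norm w \<le> B" using that B(2) dual_normals_polar by blast
      then show "\<bar>w \<bullet> e\<bar> \<le> B * norm e"
        by (intro order_trans[OF Cauchy_Schwarz_ineq2] mult_right_mono) auto
    qed (use that \<epsilon> B(1) in auto)
    finally show ?thesis by (simp add: L_def)
  qed
  have count: "real (card {k. k < N \<and> z + (real k / real N) *\<^sub>R e \<in> ?Z}) \<le> 2 * L / \<epsilon>" for z and N :: nat
  proof -
    let ?I = "{k. k < N \<and> z + (real k / real N) *\<^sub>R e \<in> ?Z}"
    define P where "P k x w1 w2 \<longleftrightarrow> x \<in> K \<and> hproj u x = z + (real k / real N) *\<^sub>R e \<and> w1 \<in> dual_normals K x \<and>
        w2 \<in> dual_normals K x \<and> w1 \<bullet> u \<ge> \<epsilon> \<and> w2 \<bullet> u \<ge> \<epsilon> \<and> \<epsilon> \<le> slope u e w1 - slope u e w2" for k x w1 w2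
    have "\<exists>x w1 w2. P k x w1 w2" if "k \<in> ?I" for k
    proof -
      have "z + (real k / real N) *\<^sub>R e \<in> ?Z" using that by simp
      then obtain x where x: "z + (real k / real N) *\<^sub>R e = hproj u x" "x \<in> steep_jumps u e \<epsilon>" by (rule imageE)
      obtain w1 w2 where "w1 \<in> dual_normals K x" "w2 \<in> dual_normals K x" "w1 \<bullet> u \<ge> \<epsilon>" "w2 \<bullet> u \<ge> \<epsilon>"
        "\<epsilon> \<le> slope u e w1 - slope u e w2" "x \<in> K" using x(2) unfolding steep_jumps_def by blast
      then show ?thesis using x(1)[symmetric] unfolding P_def by (intro exI[of _ x] exI[of _ w1] exI[of _ w2] conjI)
    qed
    then obtain x w1 w2 where "\<And>k. k \<in> ?I \<Longrightarrow> P k (x k) (w1 k) (w2 k)" by metis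
    note * = this[unfolded P_def]
    \<comment> \<open>By monotonicity the jumps at different grid points occupy non-overlapping
      subintervals of \<open>[-L, L]\<close>, each of length at least \<epsilon>.\<close>
    have "real (card ?I) * \<epsilon> \<le> L - (- L)"
    proof (rule disjoint_gaps_card)
      fix k assume k: "k \<in> ?I"
      show "- L \<le> slope u e (w2 k) \<and> slope u e (w1 k) \<le> L"
        using slope_le[of "w1 k" "x k"] slope_le[of "w2 k" "x k"] *[OF k] by (simp add: abs_le_iff)
      show "\<epsilon> \<le> slope u e (w1 k) - slope u e (w2 k)" using *[OF k] by blast
      fix l assume l: "l \<in> ?I" "k < l"
      show "slope u e (w1 l) \<le> slope u e (w2 k)"
      proof (rule slope_antimono[OF _ _ _ _ _ _ u])
        show "hproj u (x l) = hproj u (x k) + (real l / real N - real k / real N) *\<^sub>R e"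
          using *[OF k] *[OF l(1)] by (simp add: scaleR_diff_left)
        show "0 < real l / real N - real k / real N" using l by (simp add: diff_divide_distrib[symmetric])
      qed (use *[OF k] *[OF l(1)] \<epsilon> in auto)
    qed (use L0 in auto)
    then show ?thesis using \<epsilon> by (simp add: field_simps)
  qed
  define M where "M = 2 * L / \<epsilon>"
  \<comment> \<open>Shifts by at most \<open>norm e\<close> are used, so outside this bounded set no
    grid meets the projection of \<open>K\<close>.\<close>
  define D where "D = {y. u \<bullet> y = 1 \<and> norm (hproj u y) \<le> R + norm e}"
  have Dm [measurable]: "D \<in> sets borel" unfolding D_def by measurable
  have "bounded D"
  proof (rule boundedI)
    fix y assume "y \<in> D"
    then have "norm (hproj u y) \<le> R + norm e" "y \<bullet> u = 1" by (auto simp: D_def inner_commute)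
    then show "norm y \<le> R + norm e + 1"
      using u norm_triangle_ineq[of "hproj u y" "(y \<bullet> u) *\<^sub>R u"] unfolding hproj_decomp[of y u, symmetric] by simp
  qed
  then have Dfin: "emeasure (cone_measure u) D < top"
    using u by (intro emeasure_cone_measure_bounded) auto
  have *: "of_nat N * emeasure (cone_measure u) {y. hproj u y \<in> ?Z} \<le> ennreal M * emeasure (cone_measure u) D" for N :: nat
  proof -
    have "of_nat N * emeasure (cone_measure u) {y. hproj u y \<in> ?Z}
        = (\<Sum>k<N. \<integral>\<^sup>+y. indicator {y. hproj u y \<in> ?Z} y \<partial>cone_measure u)" by simp
    \<comment> \<open>Each of the \<open>N\<close> translates has the same measure; summing under
      the integral then counts grid points.\<close>
    also have "\<dots> = (\<Sum>k<N. \<integral>\<^sup>+y. indicator {y. hproj u y \<in> ?Z} (y + (real k / real N) *\<^sub>R e) \<partial>cone_measure u)"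
      using e by (intro sum.cong refl cone_measure_translate[symmetric]) (auto simp: inner_commute)
    also have "\<dots> = (\<integral>\<^sup>+y. (\<Sum>k<N. indicator {y. hproj u y \<in> ?Z} (y + (real k / real N) *\<^sub>R e)) \<partial>cone_measure u)"
      by (rule nn_integral_sum[symmetric]) measurable
    also have "\<dots> \<le> (\<integral>\<^sup>+y. ennreal M * indicator D y \<partial>cone_measure u)"
    proof (rule nn_integral_mono_AE, use AE_cone_measure[of u] in eventually_elim)
      fix y assume y: "u \<bullet> y = 1"
      have h: "hproj u (y + (real k / real N) *\<^sub>R e) = hproj u y + (real k / real N) *\<^sub>R e" for k
        using e by (simp add: hproj_add hproj_scaleR hproj_idem)
      let ?I = "{k. k < N \<and> hproj u y + (real k / real N) *\<^sub>R e \<in> ?Z}"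
      have "(\<Sum>k<N. indicator {y. hproj u y \<in> ?Z} (y + (real k / real N) *\<^sub>R e)) =
          (\<Sum>k<N. if hproj u y + (real k / real N) *\<^sub>R e \<in> ?Z then 1 else 0 :: ennreal)"
        by (intro sum.cong refl) (simp add: h indicator_def)
      also have "\<dots> = of_nat (card ?I)"
        by (subst sum.inter_filter[symmetric]) (auto intro!: arg_cong[where f=card])
      finally have S: "(\<Sum>k<N. indicator {y. hproj u y \<in> ?Z} (y + (real k / real N) *\<^sub>R e)) = (of_nat (card ?I) :: ennreal)" .
      show "(\<Sum>k<N. indicator {y. hproj u y \<in> ?Z} (y + (real k / real N) *\<^sub>R e)) \<le> ennreal M * indicator D y"
      proof (cases "y \<in> D")
        case True
        have "ennreal (real (card ?I)) \<le> ennreal M" unfolding M_def by (intro ennreal_leI count)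
        then show ?thesis using True unfolding S by (simp add: ennreal_of_nat_eq_real_of_nat)
      next
        case False
        have emp: "?I = {}"
        proof (rule ccontr)
          assume "?I \<noteq> {}"
          then obtain k x where k: "k < N" "x \<in> K" "hproj u y + (real k / real N) *\<^sub>R e = hproj u x"
            by (auto simp: steep_jumps_def)
          have "norm (hproj u x) \<le> R" using norm_hproj_le[OF u, of x] R(2)[OF k(2)] by linarith
          moreover have "hproj u y = hproj u x - (real k / real N) *\<^sub>R e" using k(3) by (simp add: algebra_simps)
          moreover have "norm ((real k / real N) *\<^sub>R e) \<le> norm e"
            using mult_right_mono[of "real k / real N" 1 "norm e"] k(1) by simp
          ultimately have "norm (hproj u y) \<le> R + norm e" using norm_triangle_ineq4[of "hproj u x" "(real k / real N) *\<^sub>R e"] by simp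
          then show False using False y by (simp add: D_def)
        qed
        show ?thesis unfolding S emp by simp
      qed
    qed
    also have "\<dots> = ennreal M * emeasure (cone_measure u) D" by (rule nn_integral_cmult_indicator) simp
    finally show ?thesis .
  qed
  show ?thesis
    by (rule ennreal_zero_if_multiples_bounded[OF _ *]) (use Dfin in \<open>simp add: ennreal_mult_less_top\<close>)
qed

text \<open>The slopes in the projected coordinate directions determine
  \<open>w / (w \<bullet> u)\<close>, and the condition \<open>w \<bullet> x = 1\<close> fixes the
  remaining scalar.\<close>

lemma slopes_determine_dual_normal:
  assumes u: "norm u = 1" and w: "w1 \<in> dual_normals K x" "w2 \<in> dual_normals K x" "w1 \<bullet> u > 0" "w2 \<bullet> u > 0"
    and eq: "\<And>b. b \<in> Basis \<Longrightarrow> slope u (hproj u b) w1 = slope u (hproj u b) w2"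
  shows "w1 = w2"
proof -
  have hsym: "w \<bullet> hproj u b = hproj u w \<bullet> b" for w b
    by (simp add: hproj_def inner_diff_left inner_diff_right inner_commute[of u b])
  have "hproj u w1 /\<^sub>R (w1 \<bullet> u) = hproj u w2 /\<^sub>R (w2 \<bullet> u)"
  proof (rule euclidean_eqI)
    fix b :: 'a assume b: "b \<in> Basis"
    have "(hproj u w1 \<bullet> b) / (w1 \<bullet> u) = (hproj u w2 \<bullet> b) / (w2 \<bullet> u)"
      using eq[OF b] unfolding slope_def hsym minus_divide_left[symmetric] neg_equal_iff_equal .
    then show "(hproj u w1 /\<^sub>R (w1 \<bullet> u)) \<bullet> b = (hproj u w2 /\<^sub>R (w2 \<bullet> u)) \<bullet> b"
      unfolding inner_scaleR_left divide_inverse by (simp only: mult.commute)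
  qed
  moreover have "w /\<^sub>R (w \<bullet> u) = hproj u w /\<^sub>R (w \<bullet> u) + u" if "w \<bullet> u > 0" for w
    using that by (simp add: hproj_def scaleR_diff_right)
  ultimately have e: "w1 /\<^sub>R (w1 \<bullet> u) = w2 /\<^sub>R (w2 \<bullet> u)" using w(3,4) by simp
  have "(w1 /\<^sub>R (w1 \<bullet> u)) \<bullet> x = 1 / (w1 \<bullet> u)" "(w2 /\<^sub>R (w2 \<bullet> u)) \<bullet> x = 1 / (w2 \<bullet> u)"
    using w by (simp_all add: dual_normals_def divide_inverse)
  then have "w1 \<bullet> u = w2 \<bullet> u" using e by simp
  then show ?thesis using e w(3) by simp
qed

text \<open>At a non-regular top point two dual normals differ in slope in some projected coordinate
  direction, so the point belongs to one of countably many sets \<open>steep_jumps\<close>, each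
  with null projection.\<close>

theorem AE_top_regular:
  assumes u: "norm u = 1"
  shows "AE y in cone_measure u. hproj u y \<in> inner_projection u K \<longrightarrow> top_point K u (hproj u y) \<in> top_boundary K u"
proof -
  let ?N = "\<Union>m::nat. \<Union>b\<in>Basis. {y. hproj u y \<in> hproj u ` steep_jumps u (hproj u b) (1 / real (Suc m))}"
  have mset: "{y. hproj u y \<in> hproj u ` steep_jumps u (hproj u b) (1 / real (Suc m))} \<in> null_sets (cone_measure u)"
    for b and m :: nat
  proof -
    have "compact (hproj u ` steep_jumps u (hproj u b) (1 / real (Suc m)))"
      by (intro compact_continuous_image continuous_hproj steep_jumps_compact) simp
    then have [measurable]: "hproj u ` steep_jumps u (hproj u b) (1 / real (Suc m)) \<in> sets borel"
      by (simp add: borel_closed compact_imp_closed)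
    have "{y. hproj u y \<in> hproj u ` steep_jumps u (hproj u b) (1 / real (Suc m))} \<in> sets (cone_measure u)"
      unfolding sets_cone_measure by measurable
    then show ?thesis using u by (intro null_setsI steep_jumps_null) auto
  qed
  have N: "?N \<in> null_sets (cone_measure u)"
    by (intro null_sets_UN null_sets_UN' mset countable_finite) auto
  show ?thesis
  proof (rule AE_I'[OF N], rule subsetI, rule ccontr)
    fix y assume "y \<in> {y \<in> space (cone_measure u). \<not> (hproj u y \<in> inner_projection u K \<longrightarrow> top_point K u (hproj u y) \<in> top_boundary K u)}"
    then have z: "hproj u y \<in> inner_projection u K" and nt: "top_point K u (hproj u y) \<notin> top_boundary K u" by auto
    assume nN: "y \<notin> ?N"
    let ?x = "top_point K u (hproj u y)"
    note t = inner_projection_top[OF u z]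
    obtain w1 where w1: "w1 \<in> dual_normals K ?x" using dual_normals_ex[OF t(1)] by blast
    have le: "slope u (hproj u b) w \<le> slope u (hproj u b) w'"
      if w: "w \<in> dual_normals K ?x" "w' \<in> dual_normals K ?x" and b: "b \<in> Basis" for w w' b
    proof (rule ccontr)
      assume "\<not> ?thesis"
      then have "0 < min (min (w \<bullet> u) (w' \<bullet> u)) (slope u (hproj u b) w - slope u (hproj u b) w')"
        using t(3) w by simp
      then obtain m where m: "1 / real (Suc m) < min (min (w \<bullet> u) (w' \<bullet> u)) (slope u (hproj u b) w - slope u (hproj u b) w')"
        using reals_Archimedean by (metis inverse_eq_divide)
      then have "1 / real (Suc m) \<le> w \<bullet> u" "1 / real (Suc m) \<le> w' \<bullet> u"
        "1 / real (Suc m) \<le> slope u (hproj u b) w - slope u (hproj u b) w'" by linarith+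
      then have "?x \<in> steep_jumps u (hproj u b) (1 / real (Suc m))"
        using w(1,2) frontier_in[OF t(1)] unfolding steep_jumps_def by blast
      then have "hproj u y \<in> hproj u ` steep_jumps u (hproj u b) (1 / real (Suc m))" using t(2) by (metis imageI)
      then show False using nN b by blast
    qed
    have "w2 = w1" if "w2 \<in> dual_normals K ?x" for w2
      using le that w1 t(3) by (intro slopes_determine_dual_normal[OF u]) (auto intro: antisym)
    then have "dual_normals K ?x = {w1}" using w1 by blast
    then have "?x \<in> top_boundary K u"
      using t(1) t(3)[OF w1] by (auto simp: top_boundary_def regular_boundary_iff dual_normal_def)
    then show False using nt by contradiction
  qed
qed

end

subsection \<open>Shadow systems\<close>

lemma abs_powr_convex:
  fixes x y a b p :: real
  assumes p: "p \<ge> 1" and ab: "0 \<le> a" "0 \<le> b" "a + b = 1"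
  shows "\<bar>a * x + b * y\<bar> powr p \<le> a * \<bar>x\<bar> powr p + b * \<bar>y\<bar> powr p"
proof -
  \<comment> \<open>Convexity of \<open>powr\<close> is applied to positive arguments; when one
    argument vanishes the claim reduces to \<open>c powr p \<le> c\<close> for \<open>c\<close>
    between 0 and 1.\<close>
  have small: "(c * s) powr p \<le> c * s powr p" if "0 \<le> c" "c \<le> 1" "0 \<le> s" for c s :: real
  proof (cases "c = 0")
    case False
    have "c powr p \<le> c powr 1" using that False p by (intro powr_mono') auto
    then have "c powr p * s powr p \<le> c * s powr p" using that False by (intro mult_right_mono) auto
    then show ?thesis using that by (simp add: powr_mult)
  qed (use p in simp)
  have nonneg: "(a * s + b * t) powr p \<le> a * s powr p + b * t powr p" if st: "0 \<le> s" "0 \<le> t" for s t :: real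
  proof (cases "s = 0 \<or> t = 0")
    case True
    then show ?thesis using small[of a s] small[of b t] ab st p by auto
  next
    case False
    then have "s > 0" "t > 0" using st by auto
    then have *: "((1 - b) * s + b * t) powr p \<le> (1 - b) * s powr p + b * t powr p"
      using convex_onD[OF powr_convex[OF p], of b s t] ab by simp
    have a: "a = 1 - b" using ab by simp
    show ?thesis unfolding a by (rule *)
  qed
  have "\<bar>a * x + b * y\<bar> \<le> a * \<bar>x\<bar> + b * \<bar>y\<bar>"
    using ab by (metis abs_mult abs_of_nonneg abs_triangle_ineq)
  then have "\<bar>a * x + b * y\<bar> powr p \<le> (a * \<bar>x\<bar> + b * \<bar>y\<bar>) powr p" using p by (intro powr_mono2) auto
  also have "\<dots> \<le> a * \<bar>x\<bar> powr p + b * \<bar>y\<bar> powr p" by (rule nonneg) auto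
  finally show ?thesis .
qed

lemma hyperplane_proj_eq: "hyperplane_proj u K = hproj u ` K"
  by (simp add: hyperplane_proj_def hproj_def)

lemma shadow_upper_affine:
  "a + b = 1 \<Longrightarrow> shadow_upper u K (a * s + b * t) z = a * shadow_upper u K s z + b * shadow_upper u K t z"
proof -
  assume "a + b = 1"
  then have b: "b = 1 - a" by simp
  show ?thesis unfolding shadow_upper_def b by (simp add: field_simps)
qed

lemma shadow_length:
  "shadow_upper u K t z - shadow_lower u K t z = upper_graph u K z - lower_graph u K z"
  unfolding shadow_upper_def shadow_lower_def by simp

lemma shadow_lower_minus: "shadow_lower u K (- t) z = - shadow_upper u K t z"
  and shadow_upper_minus: "shadow_upper u K (- t) z = - shadow_lower u K t z"
  by (simp_all add: shadow_lower_def shadow_upper_def)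

lemma upper_graph_uminus: "upper_graph (- u) K z = - lower_graph u K z"
  and lower_graph_uminus: "lower_graph (- u) K z = - upper_graph u K z"
  by (simp_all add: lower_graph_eq)

lemma shadow_upper_uminus: "shadow_upper (- u) K t z = - shadow_lower u K t z"
  and shadow_lower_uminus: "shadow_lower (- u) K t z = - shadow_upper u K t z"
  unfolding shadow_upper_def shadow_lower_def upper_graph_uminus lower_graph_uminus
  by (simp_all add: algebra_simps)

text \<open>Lets every statement on the upper graph be applied to the lower graph, with
  \<open>- u\<close> in place of \<open>u\<close>.\<close>

lemma shadow_system_uminus: "shadow_system (- u) K t = shadow_system u K t"
proof -
  have "shadow_system (- u) K t \<subseteq> shadow_system u K t" for u
  proof
    fix x assume "x \<in> shadow_system (- u) K t"
    then obtain x' s where x: "x = x' + s *\<^sub>R (- u)" "x' \<in> hproj u ` K"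
      "shadow_lower (- u) K t x' \<le> s" "s \<le> shadow_upper (- u) K t x'"
      by (auto simp: shadow_system_def hyperplane_proj_eq)
    then have "x = x' + (- s) *\<^sub>R u" "shadow_lower u K t x' \<le> - s" "- s \<le> shadow_upper u K t x'"
      by (auto simp: shadow_upper_uminus shadow_lower_uminus)
    then show "x \<in> shadow_system u K t" using x(2) unfolding shadow_system_def hyperplane_proj_eq by blast
  qed
  from this[of u] this[of "- u"] show ?thesis by auto
qed

lemma shadow_system_mem:
  assumes u: "norm u = 1"
  shows "x \<in> shadow_system u K t \<longleftrightarrow> hproj u x \<in> hproj u ` K \<and>
    shadow_lower u K t (hproj u x) \<le> x \<bullet> u \<and> x \<bullet> u \<le> shadow_upper u K t (hproj u x)"
proof
  assume "x \<in> shadow_system u K t"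
  then obtain z s where x: "x = z + s *\<^sub>R u" "z \<in> hproj u ` K" "shadow_lower u K t z \<le> s" "s \<le> shadow_upper u K t z"
    by (auto simp: shadow_system_def hyperplane_proj_eq)
  then have zu: "z \<bullet> u = 0" using u by auto
  have "hproj u x = z" "x \<bullet> u = s"
    using u zu x(1) by (simp_all add: hproj_add hproj_scaleR hproj_idem inner_add_left dot_square_norm)
  then show "hproj u x \<in> hproj u ` K \<and> shadow_lower u K t (hproj u x) \<le> x \<bullet> u \<and> x \<bullet> u \<le> shadow_upper u K t (hproj u x)"
    using x by simp
next
  assume "hproj u x \<in> hproj u ` K \<and> shadow_lower u K t (hproj u x) \<le> x \<bullet> u \<and> x \<bullet> u \<le> shadow_upper u K t (hproj u x)"
  then show "x \<in> shadow_system u K t"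
    unfolding shadow_system_def hyperplane_proj_eq using hproj_decomp[of x u] by blast
qed

lemma shadow_system_reflection:
  assumes u: "norm u = 1"
  shows "shadow_system u K (- t) = reflection u ` shadow_system u K t"
proof -
  have uu: "u \<bullet> u = 1" using u by (simp add: dot_square_norm)
  have h: "hproj u (reflection u x) = hproj u x" "reflection u x \<bullet> u = - (x \<bullet> u)" for x
    using u uu by (simp_all add: reflection_def hproj_diff hproj_scaleR inner_diff_left)
  have "reflection u x \<in> shadow_system u K (- t) \<longleftrightarrow> x \<in> shadow_system u K t" for x
    unfolding shadow_system_mem[OF u] h shadow_lower_minus shadow_upper_minus by auto
  then show ?thesis using reflection_reflection[OF u] by (metis (no_types, lifting) image_iff set_eqI)
qed

context convex_body
begin

lemma fibre_ends:
  assumes u: "norm u = 1" and z: "z \<in> hproj u ` K"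
  shows "lower_graph u K z \<le> upper_graph u K z"
proof -
  obtain k where k: "k \<in> K" "z = hproj u k" using z by blast
  then have "z + (k \<bullet> u) *\<^sub>R u \<in> K" by (simp add: hproj_decomp[symmetric])
  then show ?thesis using fibre_bounds[OF u] by (meson order_trans)
qed

text \<open>With \<alpha> = (1+t)/2 and \<beta> = (1-t)/2 the graphs of the system are \<alpha>f -
  \<beta>g and \<alpha>g - \<beta>f. So its points arise from pairs of points in a common fibre of
  \<open>K\<close> by one linear map, and convexity and compactness are inherited from the set of
  such pairs.\<close>

lemma shadow_system_linear_image:
  assumes u: "norm u = 1" and t: "t \<in> {-1..1}"
  shows "shadow_system u K t = (\<lambda>p. hproj u (fst p) + ((1 + t) / 2 * (fst p \<bullet> u) - (1 - t) / 2 * (snd p \<bullet> u)) *\<^sub>R u) `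
    ((K \<times> K) \<inter> {p. hproj u (fst p) = hproj u (snd p)})" (is "_ = ?T ` ?S")
proof (rule set_eqI, rule iffI)
  fix x assume "x \<in> shadow_system u K t"
  then have z: "hproj u x \<in> hproj u ` K" and s: "shadow_lower u K t (hproj u x) \<le> x \<bullet> u" "x \<bullet> u \<le> shadow_upper u K t (hproj u x)"
    by (auto simp: shadow_system_mem[OF u])
  let ?z = "hproj u x"
  define f where "f = upper_graph u K ?z"
  define g where "g = lower_graph u K ?z"
  define \<alpha> where "\<alpha> = (1 + t) / 2"
  define \<beta> where "\<beta> = (1 - t) / 2"
  have gf: "g \<le> f" unfolding f_def g_def by (rule fibre_ends[OF u z])
  have lo: "shadow_lower u K t ?z = \<alpha> * g - \<beta> * f" and up: "shadow_upper u K t ?z = \<alpha> * f - \<beta> * g"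
    by (simp_all add: shadow_lower_def shadow_upper_def f_def g_def \<alpha>_def \<beta>_def field_simps)
  have ab: "\<alpha> + \<beta> = 1" by (simp add: \<alpha>_def \<beta>_def field_simps)
  \<comment> \<open>The relative height of \<open>x\<close> in its fibre. The pair is found by
    moving \<open>p\<close> up from the lower end and \<open>q\<close> down from the upper end by
    this same fraction; a one-point fibre gets the value 0.\<close>
  define \<theta> where "\<theta> = (if f = g then 0 else (x \<bullet> u - (\<alpha> * g - \<beta> * f)) / (f - g))"
  have len: "(\<alpha> * f - \<beta> * g) - (\<alpha> * g - \<beta> * f) = f - g"
  proof -
    have "(\<alpha> * f - \<beta> * g) - (\<alpha> * g - \<beta> * f) = (\<alpha> + \<beta>) * (f - g)" by (simp add: algebra_simps)
    then show ?thesis by (simp add: ab)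
  qed
  have \<theta>: "0 \<le> \<theta>" "\<theta> \<le> 1"
    using s gf len unfolding lo up by (auto simp: \<theta>_def divide_simps)
  have \<theta>eq: "\<theta> * (f - g) = x \<bullet> u - (\<alpha> * g - \<beta> * f)" using s len unfolding lo up by (auto simp: \<theta>_def)
  define p where "p = ?z + (g + \<theta> * (f - g)) *\<^sub>R u"
  define q where "q = ?z + (f - \<theta> * (f - g)) *\<^sub>R u"
  have "0 \<le> \<theta> * (f - g)" "\<theta> * (f - g) \<le> f - g" using \<theta> gf by (auto simp: mult_left_le_one_le)
  then have pq: "p \<in> K" "q \<in> K" unfolding p_def q_def f_def g_def
    by (auto intro!: fibre_between[OF u z])
  have pqu: "p \<bullet> u = g + \<theta> * (f - g)" "q \<bullet> u = f - \<theta> * (f - g)" "hproj u p = ?z" "hproj u q = ?z"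
    using u by (simp_all add: p_def q_def inner_add_left dot_square_norm hproj_add hproj_scaleR)
  have "\<alpha> * (p \<bullet> u) - \<beta> * (q \<bullet> u) = (\<alpha> * g - \<beta> * f) + (\<alpha> + \<beta>) * (\<theta> * (f - g))"
    unfolding pqu by (simp add: algebra_simps)
  also have "\<dots> = x \<bullet> u" unfolding ab \<theta>eq by simp
  finally have "x = ?T (p, q)" unfolding \<alpha>_def \<beta>_def by (simp add: pqu(3) hproj_decomp[symmetric])
  then show "x \<in> ?T ` ?S" using pq pqu by (intro image_eqI[of _ _ "(p, q)"]) auto
next
  fix x assume "x \<in> ?T ` ?S"
  then obtain p q where pq: "p \<in> K" "q \<in> K" "hproj u p = hproj u q"
    and x: "x = hproj u p + ((1 + t) / 2 * (p \<bullet> u) - (1 - t) / 2 * (q \<bullet> u)) *\<^sub>R u" by auto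
  let ?z = "hproj u p"
  have in_fib: "lower_graph u K ?z \<le> p \<bullet> u" "p \<bullet> u \<le> upper_graph u K ?z" "lower_graph u K ?z \<le> q \<bullet> u" "q \<bullet> u \<le> upper_graph u K ?z"
    using fibre_bounds[OF u, of ?z "p \<bullet> u"] fibre_bounds[OF u, of ?z "q \<bullet> u"] pq hproj_decomp[of p u] hproj_decomp[of q u] by auto
  have xz: "hproj u x = ?z" "x \<bullet> u = (1 + t) / 2 * (p \<bullet> u) - (1 - t) / 2 * (q \<bullet> u)"
    using u by (simp_all add: x hproj_add hproj_scaleR inner_add_left dot_square_norm)
  have "(1 + t) / 2 * lower_graph u K ?z \<le> (1 + t) / 2 * (p \<bullet> u)" "(1 + t) / 2 * (p \<bullet> u) \<le> (1 + t) / 2 * upper_graph u K ?z"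
    "(1 - t) / 2 * lower_graph u K ?z \<le> (1 - t) / 2 * (q \<bullet> u)" "(1 - t) / 2 * (q \<bullet> u) \<le> (1 - t) / 2 * upper_graph u K ?z"
    using t in_fib by (intro mult_left_mono; simp)+
  moreover have "shadow_lower u K t ?z = (1 + t) / 2 * lower_graph u K ?z - (1 - t) / 2 * upper_graph u K ?z"
    "shadow_upper u K t ?z = (1 + t) / 2 * upper_graph u K ?z - (1 - t) / 2 * lower_graph u K ?z"
    by (simp_all add: shadow_lower_def shadow_upper_def field_simps)
  ultimately show "x \<in> shadow_system u K t"
    unfolding shadow_system_mem[OF u] xz using pq(1) by auto
qed

lemma shadow_system_body:
  assumes u: "norm u = 1" and t: "t \<in> {-1..1}"
  shows "shadow_system u K t \<in> convex_bodies_o"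
proof -
  let ?T = "\<lambda>p::'a \<times> 'a. hproj u (fst p) + ((1 + t) / 2 * (fst p \<bullet> u) - (1 - t) / 2 * (snd p \<bullet> u)) *\<^sub>R u"
  let ?E = "{p::'a \<times> 'a. hproj u (fst p) = hproj u (snd p)}"
  have T: "linear ?T" by (rule linearI) (simp_all add: hproj_add hproj_scaleR algebra_simps)
  have E: "convex ?E" by (rule convexI) (simp add: hproj_add hproj_scaleR)
  have cE: "closed ?E"
    unfolding hproj_def by (intro closed_Collect_eq continuous_intros)
  have "convex (shadow_system u K t)"
    unfolding shadow_system_linear_image[OF u t]
    by (intro convex_linear_image T convex_Int convex_Times convex_K E)
  moreover have "compact (shadow_system u K t)"
    unfolding shadow_system_linear_image[OF u t]
    by (intro compact_continuous_image compact_Int_closed compact_Times compact_K cE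
        linear_continuous_on linear_conv_bounded_linear[THEN iffD1] T)
  moreover have "0 \<in> interior (shadow_system u K t)"
  proof -
    obtain r where r: "r > 0" "cball 0 r \<subseteq> K" by (rule inner_radius)
    have "cball 0 r \<subseteq> shadow_system u K t"
    proof
      fix x :: 'a assume x: "x \<in> cball 0 r"
      then have K: "x \<in> K" "reflection u x \<in> K" using r(2) u by auto
      have h: "hproj u (reflection u x) = hproj u x" "reflection u x \<bullet> u = - (x \<bullet> u)"
        using u by (simp_all add: reflection_def hproj_diff hproj_scaleR inner_diff_left dot_square_norm)
      have "(1 + t) / 2 * (x \<bullet> u) - (1 - t) / 2 * (- (x \<bullet> u)) = x \<bullet> u" by (simp add: field_simps)
      \<comment> \<open>The ball is invariant under reflection, and the pair of \<open>x\<close> and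
        its mirror image is sent back to \<open>x\<close> for every \<open>t\<close>.\<close>
      then have "x = ?T (x, reflection u x)" by (simp add: h hproj_decomp[symmetric])
      then show "x \<in> shadow_system u K t"
        unfolding shadow_system_linear_image[OF u t] using K h
        by (intro image_eqI[of _ _ "(x, reflection u x)"]) auto
    qed
    then show ?thesis using r(1) by (auto simp: mem_interior_cball)
  qed
  ultimately show ?thesis by (simp add: convex_bodies_o_def)
qed

lemma shadow_bounds:
  assumes u: "norm u = 1" and z: "z \<in> hproj u ` K"
  shows "shadow_lower u K t z \<le> shadow_upper u K t z"
  using fibre_ends[OF assms] shadow_length[of u K t z] by linarith

lemma shadow_fibre:
  assumes u: "norm u = 1" and z: "z \<in> hproj u ` K"
  shows "{s. z + s *\<^sub>R u \<in> shadow_system u K t} = {shadow_lower u K t z..shadow_upper u K t z}"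
proof -
  have zu: "z \<bullet> u = 0" using z u by auto
  have "hproj u (z + s *\<^sub>R u) = z" "(z + s *\<^sub>R u) \<bullet> u = s" for s
    using u zu by (simp_all add: hproj_add hproj_scaleR hproj_idem inner_add_left dot_square_norm)
  then show ?thesis using z by (auto simp: shadow_system_mem[OF u])
qed

lemma shadow_graphs:
  assumes u: "norm u = 1" and z: "z \<in> hproj u ` K"
  shows "upper_graph u (shadow_system u K t) z = shadow_upper u K t z"
    "lower_graph u (shadow_system u K t) z = shadow_lower u K t z"
  using shadow_bounds[OF u z, of t] unfolding upper_graph_def lower_graph_def shadow_fibre[OF u z] by auto

lemma shadow_proj:
  assumes u: "norm u = 1"
  shows "hproj u ` shadow_system u K t = hproj u ` K"
proof
  show "hproj u ` shadow_system u K t \<subseteq> hproj u ` K" by (auto simp: shadow_system_mem[OF u])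
  show "hproj u ` K \<subseteq> hproj u ` shadow_system u K t"
  proof
    fix z assume z: "z \<in> hproj u ` K"
    then have zu: "z \<bullet> u = 0" using u by auto
    have "z + shadow_upper u K t z *\<^sub>R u \<in> shadow_system u K t"
      using shadow_fibre[OF u z, of t] shadow_bounds[OF u z, of t] by auto
    moreover have "hproj u (z + shadow_upper u K t z *\<^sub>R u) = z"
      using u zu by (simp add: hproj_add hproj_scaleR hproj_idem)
    ultimately show "z \<in> hproj u ` shadow_system u K t" by (metis imageI)
  qed
qed

lemma shadow_side_energy:
  assumes u: "norm u = 1" and st: "s \<in> {-1..1}" "t \<in> {-1..1}" and v: "hproj u v = hproj u v'"
  shows "side_energy p (shadow_system u K s) u v = side_energy p (shadow_system u K t) u v'"
proof (rule side_energy_cong[OF shadow_system_body[OF u st(1)] shadow_system_body[OF u st(2)] u _ _ v])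
  fix z assume "z \<in> hproj u ` shadow_system u K s"
  then have z: "z \<in> hproj u ` K" by (simp add: shadow_proj[OF u])
  show "upper_graph u (shadow_system u K s) z - lower_graph u (shadow_system u K s) z =
    upper_graph u (shadow_system u K t) z - lower_graph u (shadow_system u K t) z"
    unfolding shadow_graphs[OF u z] shadow_length ..
qed (simp add: shadow_proj[OF u])

end

subsection \<open>Convexity of the energy along shadow systems\<close>

context convex_body
begin

lemma measurable_top_integrand:
  assumes u: "norm u = 1"
  shows "(\<lambda>y. let x = top_point K u (hproj u y) in if x \<in> top_boundary K u
     then c * ennreal (\<bar>v \<bullet> dual_normal K x\<bar> powr p / (dual_normal K x \<bullet> u)) else 0) \<in> borel_measurable borel"
proof -
  note [measurable] = measurable_top_point[OF u]
  have "(\<lambda>y. let x = top_point K u (hproj u y) in if x \<in> top_boundary K u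
      then c * ennreal (\<bar>v \<bullet> dual_normal K x\<bar> powr p / (dual_normal K x \<bullet> u)) else 0) =
    (\<lambda>y. (c * ennreal (\<bar>v \<bullet> normal0 (top_point K u (hproj u y))\<bar> powr p / (normal0 (top_point K u (hproj u y)) \<bullet> u)))
      * indicator (top_boundary K u) (top_point K u (hproj u y)))"
    by (auto simp: fun_eq_iff Let_def top_boundary_def)
  also have "\<dots> \<in> borel_measurable borel" by measurable
  finally show ?thesis .
qed

text \<open>The dual normal of the interpolated body is the average of the two dual normals with weights
  proportional to \<open>a / (w\<^sub>1 \<bullet> u)\<close> and \<open>b / (w\<^sub>2 \<bullet> u)\<close>: in terms of the graphs, gradients and heights
  of tangent planes at the origin are affine in \<open>t\<close>.\<close>

lemma shadow_dual_normal:
  assumes u: "norm u = 1" and st: "s \<in> {-1..1}" "t \<in> {-1..1}" and ab: "0 \<le> a" "0 \<le> b" "a + b = 1"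
    and r: "r = a * s + b * t" and z: "z \<in> hproj u ` K"
    and x1: "top_point (shadow_system u K s) u z \<in> top_boundary (shadow_system u K s) u"
    and x2: "top_point (shadow_system u K t) u z \<in> top_boundary (shadow_system u K t) u"
    and x: "top_point (shadow_system u K r) u z \<in> top_boundary (shadow_system u K r) u"
    and w1: "w1 = dual_normal (shadow_system u K s) (top_point (shadow_system u K s) u z)"
    and w2: "w2 = dual_normal (shadow_system u K t) (top_point (shadow_system u K t) u z)"
    and w: "w = dual_normal (shadow_system u K r) (top_point (shadow_system u K r) u z)"
    and B: "B = a / (w1 \<bullet> u) + b / (w2 \<bullet> u)"
  shows "w1 \<bullet> u > 0" "w2 \<bullet> u > 0" "B > 0" "w = (a / (w1 \<bullet> u) / B) *\<^sub>R w1 + (b / (w2 \<bullet> u) / B) *\<^sub>R w2"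
proof -
  have rI: "r \<in> {-1..1}" using convexD[OF convex_real_interval(5), of s "-1" 1 t a b] st ab by (simp add: r)
  interpret S: convex_body "shadow_system u K s" by (rule convex_body.intro[OF shadow_system_body[OF u st(1)]])
  interpret T: convex_body "shadow_system u K t" by (rule convex_body.intro[OF shadow_system_body[OF u st(2)]])
  interpret R: convex_body "shadow_system u K r" by (rule convex_body.intro[OF shadow_system_body[OF u rI]])
  have tp: "top_point (shadow_system u K q) u y = y + shadow_upper u K q y *\<^sub>R u" if "y \<in> hproj u ` K" for q y
    using shadow_graphs(1)[OF u that] by (simp add: top_point_def)
  show p: "w1 \<bullet> u > 0" "w2 \<bullet> u > 0" using x1 x2 by (auto simp: top_boundary_def w1 w2)
  have d1: "w1 \<in> dual_normals (shadow_system u K s) (top_point (shadow_system u K s) u z)"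
    using S.dual_normal_in x1 unfolding w1 top_boundary_def by blast
  have d2: "w2 \<in> dual_normals (shadow_system u K t) (top_point (shadow_system u K t) u z)"
    using T.dual_normal_in x2 unfolding w2 top_boundary_def by blast
  define \<beta>1 where "\<beta>1 = a / (w1 \<bullet> u)"
  define \<beta>2 where "\<beta>2 = b / (w2 \<bullet> u)"
  have \<beta>: "0 \<le> \<beta>1" "0 \<le> \<beta>2" using p ab by (auto simp: \<beta>1_def \<beta>2_def)
  have Beq: "B = \<beta>1 + \<beta>2" by (simp add: B \<beta>1_def \<beta>2_def)
  have "a > 0 \<or> b > 0" using ab by linarith
  then have "\<beta>1 > 0 \<or> \<beta>2 > 0" using p by (auto simp: \<beta>1_def \<beta>2_def)
  then show Bp: "B > 0" using \<beta> Beq by linarith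
  \<comment> \<open>By uniqueness at the regular point it suffices that this candidate for
    \<open>w\<close> is a dual normal. Here \<open>B\<close> is the height at which the interpolated
    tangent plane meets the axis of direction \<open>u\<close>.\<close>
  define w' where "w' = (\<beta>1 / B) *\<^sub>R w1 + (\<beta>2 / B) *\<^sub>R w2"
  have mem: "y + shadow_upper u K q y *\<^sub>R u \<in> shadow_system u K q" if y: "y \<in> hproj u ` K" for q y
    using shadow_fibre[OF u y, of q] shadow_bounds[OF u y, of q] by auto
  have h1: "shadow_upper u K s y * (w1 \<bullet> u) \<le> 1 - w1 \<bullet> y" and h2: "shadow_upper u K t y * (w2 \<bullet> u) \<le> 1 - w2 \<bullet> y"
    if "y \<in> hproj u ` K" for y
  proof -
    have "w1 \<bullet> (y + shadow_upper u K s y *\<^sub>R u) \<le> 1" "w2 \<bullet> (y + shadow_upper u K t y *\<^sub>R u) \<le> 1"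
      using mem[OF that] d1 d2 by (auto simp: dual_normals_def)
    then show "shadow_upper u K s y * (w1 \<bullet> u) \<le> 1 - w1 \<bullet> y" "shadow_upper u K t y * (w2 \<bullet> u) \<le> 1 - w2 \<bullet> y"
      by (simp_all add: inner_add_right)
  qed
  have e1: "shadow_upper u K s z * (w1 \<bullet> u) = 1 - w1 \<bullet> z" and e2: "shadow_upper u K t z * (w2 \<bullet> u) = 1 - w2 \<bullet> z"
    using d1 d2 unfolding tp[OF z] by (auto simp: dual_normals_def inner_add_right)
  \<comment> \<open>Rewrites the graph heights as multiples of the quantities that the supporting
    inequalities \<open>h1\<close>, \<open>h2\<close> and equalities \<open>e1\<close>,
    \<open>e2\<close> control.\<close>
  have split: "a * shadow_upper u K s y = \<beta>1 * (shadow_upper u K s y * (w1 \<bullet> u))"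
    "b * shadow_upper u K t y = \<beta>2 * (shadow_upper u K t y * (w2 \<bullet> u))" for y
    using p by (simp_all add: \<beta>1_def \<beta>2_def)
  have up: "shadow_upper u K r y = a * shadow_upper u K s y + b * shadow_upper u K t y" for y
    unfolding r by (rule shadow_upper_affine[OF ab(3)])
  have w'u: "w' \<bullet> u = 1 / B"
  proof -
    have "w' \<bullet> u = (\<beta>1 * (w1 \<bullet> u) + \<beta>2 * (w2 \<bullet> u)) / B" by (simp add: w'_def inner_add_left add_divide_distrib)
    also have "\<beta>1 * (w1 \<bullet> u) + \<beta>2 * (w2 \<bullet> u) = 1" using p ab by (simp add: \<beta>1_def \<beta>2_def)
    finally show ?thesis .
  qed
  have w'y: "w' \<bullet> y = (\<beta>1 * (w1 \<bullet> y) + \<beta>2 * (w2 \<bullet> y)) / B" for y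
    by (simp add: w'_def inner_add_left add_divide_distrib)
  have "w' \<in> dual_normals (shadow_system u K r) (top_point (shadow_system u K r) u z)"
    unfolding dual_normals_def
  proof (intro CollectI conjI ballI)
    have "shadow_upper u K r z = \<beta>1 * (1 - w1 \<bullet> z) + \<beta>2 * (1 - w2 \<bullet> z)"
      unfolding up split e1 e2 ..
    then have "\<beta>1 * (w1 \<bullet> z) + \<beta>2 * (w2 \<bullet> z) + shadow_upper u K r z = B" by (simp add: Beq algebra_simps)
    then show "w' \<bullet> top_point (shadow_system u K r) u z = 1"
      unfolding tp[OF z] inner_add_right inner_scaleR_right w'u unfolding w'y using Bp by (simp add: add_divide_distrib[symmetric])
    fix q assume q: "q \<in> shadow_system u K r"
    let ?y = "hproj u q"
    have y: "?y \<in> hproj u ` K" and qu: "q \<bullet> u \<le> shadow_upper u K r ?y" using q by (auto simp: shadow_system_mem[OF u])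
    have "q \<bullet> u \<le> \<beta>1 * (1 - w1 \<bullet> ?y) + \<beta>2 * (1 - w2 \<bullet> ?y)"
      using qu unfolding up split using mult_left_mono[OF h1[OF y] \<beta>(1)] mult_left_mono[OF h2[OF y] \<beta>(2)] by linarith
    then have *: "\<beta>1 * (w1 \<bullet> ?y) + \<beta>2 * (w2 \<bullet> ?y) + q \<bullet> u \<le> B" by (simp add: Beq algebra_simps)
    have "w' \<bullet> q = w' \<bullet> ?y + (q \<bullet> u) * (w' \<bullet> u)"
      by (subst (1) hproj_decomp[of q u]) (simp add: inner_add_right)
    also have "\<dots> = (\<beta>1 * (w1 \<bullet> ?y) + \<beta>2 * (w2 \<bullet> ?y) + q \<bullet> u) / B"
      unfolding w'u unfolding w'y by (simp add: add_divide_distrib)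
    also have "\<dots> \<le> 1" using * Bp by simp
    finally show "w' \<bullet> q \<le> 1" .
  qed
  then have "w' = w" using R.dual_normal_unique x unfolding w top_boundary_def by blast
  then show "w = (a / (w1 \<bullet> u) / B) *\<^sub>R w1 + (b / (w2 \<bullet> u) / B) *\<^sub>R w2" by (simp add: w'_def \<beta>1_def \<beta>2_def)
qed

lemma inner_projection_shadow: "norm u = 1 \<Longrightarrow> inner_projection u (shadow_system u K t) = inner_projection u K"
  by (simp add: inner_projection_def shadow_proj)

text \<open>The inequality holds pointwise. The common projection of \<open>v1\<close> and
  \<open>v2\<close> gives \<open>?v \<bullet> w\<close> as the average of
  \<open>v1 \<bullet> w1\<close> and \<open>v2 \<bullet> w2\<close> with weights \<rho>1, \<rho>2.
  The factor \<open>1 / (w \<bullet> u)\<close> is \<open>B\<close>, and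
  \<open>\<rho>1 * B = a / (w1 \<bullet> u)\<close>,
  \<open>\<rho>2 * B = b / (w2 \<bullet> u)\<close> are the required weights.\<close>

lemma top_energy_shadow_convex:
  assumes u: "norm u = 1" and st: "s \<in> {-1..1}" "t \<in> {-1..1}" and ab: "0 \<le> a" "0 \<le> b" "a + b = 1"
    and p: "p \<ge> 1" and v: "hproj u v1 = hproj u v2"
  shows "top_energy p (shadow_system u K (a * s + b * t)) u (a *\<^sub>R v1 + b *\<^sub>R v2) \<le>
    ennreal a * top_energy p (shadow_system u K s) u v1 + ennreal b * top_energy p (shadow_system u K t) u v2"
proof -
  define r where "r = a * s + b * t"
  have rI: "r \<in> {-1..1}" using convexD[OF convex_real_interval(5), of s "-1" 1 t a b] st ab by (simp add: r_def)
  interpret S: convex_body "shadow_system u K s" by (rule convex_body.intro[OF shadow_system_body[OF u st(1)]])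
  interpret T: convex_body "shadow_system u K t" by (rule convex_body.intro[OF shadow_system_body[OF u st(2)]])
  interpret R: convex_body "shadow_system u K r" by (rule convex_body.intro[OF shadow_system_body[OF u rI]])
  let ?c = "flat_const TYPE('a)" and ?v = "a *\<^sub>R v1 + b *\<^sub>R v2"
  let ?F = "\<lambda>K v y. let x = top_point K u (hproj u y) in if x \<in> top_boundary K u
     then ?c * ennreal (\<bar>v \<bullet> dual_normal K x\<bar> powr p / (dual_normal K x \<bullet> u)) else 0"
  have "top_energy p (shadow_system u K r) u ?v \<le>
      (\<integral>\<^sup>+y. ennreal a * ?F (shadow_system u K s) v1 y + ennreal b * ?F (shadow_system u K t) v2 y \<partial>cone_measure u)"
    unfolding top_energy_def
  proof (rule nn_integral_mono_AE, use S.AE_top_regular[OF u] T.AE_top_regular[OF u] in eventually_elim)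
    fix y
    let ?z = "hproj u y"
    assume S: "?z \<in> inner_projection u (shadow_system u K s) \<longrightarrow> top_point (shadow_system u K s) u ?z \<in> top_boundary (shadow_system u K s) u"
      and T: "?z \<in> inner_projection u (shadow_system u K t) \<longrightarrow> top_point (shadow_system u K t) u ?z \<in> top_boundary (shadow_system u K t) u"
    show "?F (shadow_system u K r) ?v y \<le> ennreal a * ?F (shadow_system u K s) v1 y + ennreal b * ?F (shadow_system u K t) v2 y"
    \<comment> \<open>Where the top of the intermediate body is not in its top boundary, the left
      side is 0. Otherwise the point lies in the relative interior of the common projection, where
      the tops of the other two bodies are regular almost everywhere.\<close>
    proof (cases "top_point (shadow_system u K r) u ?z \<in> top_boundary (shadow_system u K r) u")
      case True
      have hz: "hproj u (top_point (shadow_system u K r) u ?z) = ?z"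
        using u by (simp add: top_point_def hproj_add hproj_scaleR)
      have "?z \<in> inner_projection u K"
        using R.top_boundary_inner_projection[OF u True] unfolding hz inner_projection_shadow[OF u] .
      then have x1: "top_point (shadow_system u K s) u ?z \<in> top_boundary (shadow_system u K s) u"
        and x2: "top_point (shadow_system u K t) u ?z \<in> top_boundary (shadow_system u K t) u"
        using S T unfolding inner_projection_shadow[OF u] by blast+
      have "top_point (shadow_system u K r) u ?z \<in> shadow_system u K r"
        using True R.frontier_in R.regular_frontier unfolding top_boundary_def by blast
      then have z: "?z \<in> hproj u ` K" using hz shadow_proj[OF u, of r] by (metis imageI)
      define w1 where "w1 = dual_normal (shadow_system u K s) (top_point (shadow_system u K s) u ?z)"
      define w2 where "w2 = dual_normal (shadow_system u K t) (top_point (shadow_system u K t) u ?z)"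
      define w where "w = dual_normal (shadow_system u K r) (top_point (shadow_system u K r) u ?z)"
      define B where "B = a / (w1 \<bullet> u) + b / (w2 \<bullet> u)"
      note D = shadow_dual_normal[OF u st ab r_def z x1 x2 True w1_def w2_def w_def B_def]
      define \<rho>1 where "\<rho>1 = a / (w1 \<bullet> u) / B"
      define \<rho>2 where "\<rho>2 = b / (w2 \<bullet> u) / B"
      have "\<rho>1 + \<rho>2 = B / B"
        unfolding \<rho>1_def \<rho>2_def add_divide_distrib[symmetric] B_def[symmetric] ..
      then have \<rho>: "0 \<le> \<rho>1" "0 \<le> \<rho>2" "\<rho>1 + \<rho>2 = 1"
        using ab D(1-3) by (auto simp: \<rho>1_def \<rho>2_def)
      have weq: "w = \<rho>1 *\<^sub>R w1 + \<rho>2 *\<^sub>R w2" using D(4) by (simp add: \<rho>1_def \<rho>2_def)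
      have r1: "\<rho>1 * (w1 \<bullet> u) = a / B" "\<rho>2 * (w2 \<bullet> u) = b / B" using D by (simp_all add: \<rho>1_def \<rho>2_def)
      have wu: "w \<bullet> u = 1 / B" using ab by (simp add: weq inner_add_left r1 add_divide_distrib[symmetric])
      let ?h = "hproj u v1"
      have vw1: "v1 \<bullet> w' = ?h \<bullet> w' + (v1 \<bullet> u) * (w' \<bullet> u)" for w'
        by (simp add: hproj_def inner_diff_left inner_commute[of u])
      have vw2: "v2 \<bullet> w' = ?h \<bullet> w' + (v2 \<bullet> u) * (w' \<bullet> u)" for w'
        unfolding v by (simp add: hproj_def inner_diff_left inner_commute[of u])
      have "?v \<bullet> w = a * (v1 \<bullet> w) + b * (v2 \<bullet> w)" by (simp add: inner_add_left)
      also have "\<dots> = (a + b) * (?h \<bullet> w) + (a * (v1 \<bullet> u) + b * (v2 \<bullet> u)) / B"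
        unfolding vw1[of w] vw2[of w] wu by (simp add: algebra_simps add_divide_distrib)
      also have "\<dots> = \<rho>1 * (?h \<bullet> w1) + \<rho>2 * (?h \<bullet> w2) + (v1 \<bullet> u) * (a / B) + (v2 \<bullet> u) * (b / B)"
        unfolding ab(3) weq by (simp add: inner_add_right add_divide_distrib mult.commute)
      also have "\<dots> = \<rho>1 * (v1 \<bullet> w1) + \<rho>2 * (v2 \<bullet> w2)"
        unfolding vw1[of w1] vw2[of w2] r1[symmetric] by (simp add: algebra_simps)
      finally have vw: "?v \<bullet> w = \<rho>1 * (v1 \<bullet> w1) + \<rho>2 * (v2 \<bullet> w2)" .
      have "\<bar>?v \<bullet> w\<bar> powr p \<le> \<rho>1 * \<bar>v1 \<bullet> w1\<bar> powr p + \<rho>2 * \<bar>v2 \<bullet> w2\<bar> powr p"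
        unfolding vw by (rule abs_powr_convex[OF p \<rho>])
      then have "\<bar>?v \<bullet> w\<bar> powr p / (w \<bullet> u) \<le> (\<rho>1 * \<bar>v1 \<bullet> w1\<bar> powr p + \<rho>2 * \<bar>v2 \<bullet> w2\<bar> powr p) * B"
        unfolding wu using D(3) by (simp add: mult_right_mono)
      also have "\<dots> = a * (\<bar>v1 \<bullet> w1\<bar> powr p / (w1 \<bullet> u)) + b * (\<bar>v2 \<bullet> w2\<bar> powr p / (w2 \<bullet> u))"
        using D(3) by (simp add: \<rho>1_def \<rho>2_def distrib_right)
      finally have main: "\<bar>?v \<bullet> w\<bar> powr p / (w \<bullet> u) \<le> a * (\<bar>v1 \<bullet> w1\<bar> powr p / (w1 \<bullet> u)) + b * (\<bar>v2 \<bullet> w2\<bar> powr p / (w2 \<bullet> u))" .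
      have nn: "0 \<le> \<bar>v1 \<bullet> w1\<bar> powr p / (w1 \<bullet> u)" "0 \<le> \<bar>v2 \<bullet> w2\<bar> powr p / (w2 \<bullet> u)" using D(1,2) by auto
      have "?c * ennreal (\<bar>?v \<bullet> w\<bar> powr p / (w \<bullet> u)) \<le>
          ?c * ennreal (a * (\<bar>v1 \<bullet> w1\<bar> powr p / (w1 \<bullet> u)) + b * (\<bar>v2 \<bullet> w2\<bar> powr p / (w2 \<bullet> u)))"
        by (intro mult_left_mono ennreal_leI main) auto
      also have "\<dots> = ennreal a * (?c * ennreal (\<bar>v1 \<bullet> w1\<bar> powr p / (w1 \<bullet> u))) + ennreal b * (?c * ennreal (\<bar>v2 \<bullet> w2\<bar> powr p / (w2 \<bullet> u)))"
        using nn ab by (simp only: ennreal_plus mult_nonneg_nonneg ennreal_mult distrib_left mult_ac)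
      finally show ?thesis using True x1 x2
        by (simp add: Let_def w1_def w2_def w_def)
    qed (simp add: Let_def)
  qed
  also have "\<dots> = ennreal a * top_energy p (shadow_system u K s) u v1 + ennreal b * top_energy p (shadow_system u K t) u v2"
  proof -
    have m: "?F (shadow_system u K s) v1 \<in> borel_measurable (cone_measure u)" "?F (shadow_system u K t) v2 \<in> borel_measurable (cone_measure u)"
      using S.measurable_top_integrand[OF u] T.measurable_top_integrand[OF u]
      by (simp_all add: measurable_cong_sets[OF sets_cone_measure refl])
    show ?thesis unfolding top_energy_def
      by (subst nn_integral_add, (intro borel_measurable_times_ennreal m measurable_const; simp),
          (intro borel_measurable_times_ennreal m measurable_const; simp),
          subst nn_integral_cmult[OF m(1)], subst nn_integral_cmult[OF m(2)], rule refl)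
  qed
  finally show ?thesis unfolding r_def .
qed

theorem Lp_energy_shadow_convex:
  assumes u: "norm u = 1" and st: "s \<in> {-1..1}" "t \<in> {-1..1}" and ab: "0 \<le> a" "0 \<le> b" "a + b = 1"
    and p: "p \<ge> 1" and v: "hproj u v1 = hproj u v2"
  shows "Lp_energy p (shadow_system u K (a * s + b * t)) (a *\<^sub>R v1 + b *\<^sub>R v2) \<le>
    ennreal a * Lp_energy p (shadow_system u K s) v1 + ennreal b * Lp_energy p (shadow_system u K t) v2"
proof -
  define r where "r = a * s + b * t"
  have rI: "r \<in> {-1..1}" using convexD[OF convex_real_interval(5), of s "-1" 1 t a b] st ab by (simp add: r_def)
  let ?v = "a *\<^sub>R v1 + b *\<^sub>R v2"
  interpret S: convex_body "shadow_system u K s" by (rule convex_body.intro[OF shadow_system_body[OF u st(1)]])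
  interpret T: convex_body "shadow_system u K t" by (rule convex_body.intro[OF shadow_system_body[OF u st(2)]])
  interpret R: convex_body "shadow_system u K r" by (rule convex_body.intro[OF shadow_system_body[OF u rI]])
  have "hproj u ?v = (a + b) *\<^sub>R hproj u v1" by (simp add: hproj_add hproj_scaleR v scaleR_add_left)
  then have hv: "hproj u ?v = hproj u v1" using ab by simp
  \<comment> \<open>The side energies of the three bodies coincide, and
    \<open>a + b = 1\<close>.\<close>
  have side: "side_energy p (shadow_system u K r) u ?v =
      ennreal a * side_energy p (shadow_system u K s) u v1 + ennreal b * side_energy p (shadow_system u K t) u v2"
  proof -
    have "side_energy p (shadow_system u K r) u ?v = side_energy p (shadow_system u K s) u v1"
      by (rule shadow_side_energy[OF u rI st(1) hv])
    moreover have "side_energy p (shadow_system u K t) u v2 = side_energy p (shadow_system u K s) u v1"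
      by (rule shadow_side_energy[OF u st(2,1) v[symmetric]])
    moreover have "ennreal a + ennreal b = 1" using ab by (simp add: ennreal_plus[symmetric] del: ennreal_plus)
    ultimately show ?thesis by (metis distrib_right mult_1)
  qed
  have top: "top_energy p (shadow_system u K r) u ?v \<le>
      ennreal a * top_energy p (shadow_system u K s) u v1 + ennreal b * top_energy p (shadow_system u K t) u v2"
    unfolding r_def by (rule top_energy_shadow_convex[OF u st ab p v])
  have bot: "top_energy p (shadow_system u K r) (- u) ?v \<le>
      ennreal a * top_energy p (shadow_system u K s) (- u) v1 + ennreal b * top_energy p (shadow_system u K t) (- u) v2"
    using top_energy_shadow_convex[of "- u", OF _ st ab p, of v1 v2] u v unfolding r_def
    by (simp add: shadow_system_uminus)
  show ?thesis
    unfolding r_def[symmetric] S.Lp_energy_decomposition[OF u] T.Lp_energy_decomposition[OF u] R.Lp_energy_decomposition[OF u] side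
    using add_mono[OF top bot] by (simp add: distrib_left add_ac add_mono)
qed

end

subsection \<open>Polar projection bodies\<close>

context convex_body
begin

lemma Lp_energy_scale:
  assumes p: "p > 0" shows "Lp_energy p K (c *\<^sub>R v) = ennreal (\<bar>c\<bar> powr p) * Lp_energy p K v"
proof -
  let ?c = "flat_const TYPE('a)"
  let ?F = "\<lambda>v x. if x \<in> K \<and> radial K x \<in> regular_boundary K
     then ?c * ennreal (\<bar>v \<bullet> dual_normal K (radial K x)\<bar> powr p) else 0"
  have m: "?F v \<in> borel_measurable lborel"
    using measurable_radial_weight[of "\<lambda>_. True" "\<lambda>w. ?c * ennreal (\<bar>v \<bullet> w\<bar> powr p)"] by simp
  have "?F (c *\<^sub>R v) x = ennreal (\<bar>c\<bar> powr p) * ?F v x" for x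
    by (simp add: abs_mult powr_mult ennreal_mult mult_ac)
  then show ?thesis unfolding Lp_energy_radial using nn_integral_cmult[OF m, of "ennreal (\<bar>c\<bar> powr p)"] by simp
qed

lemma Lp_energy_convex:
  assumes p: "p \<ge> 1" and ab: "0 \<le> a" "0 \<le> b" "a + b = 1"
  shows "Lp_energy p K (a *\<^sub>R v + b *\<^sub>R w) \<le> ennreal a * Lp_energy p K v + ennreal b * Lp_energy p K w"
proof -
  let ?c = "flat_const TYPE('a)"
  let ?F = "\<lambda>v x. if x \<in> K \<and> radial K x \<in> regular_boundary K
     then ?c * ennreal (\<bar>v \<bullet> dual_normal K (radial K x)\<bar> powr p) else 0"
  have m: "?F v \<in> borel_measurable lborel" for v
    using measurable_radial_weight[of "\<lambda>_. True" "\<lambda>w. ?c * ennreal (\<bar>v \<bullet> w\<bar> powr p)"] by simp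
  have "?F (a *\<^sub>R v + b *\<^sub>R w) x \<le> ennreal a * ?F v x + ennreal b * ?F w x" for x
  proof (cases "x \<in> K \<and> radial K x \<in> regular_boundary K")
    case True
    let ?n = "dual_normal K (radial K x)"
    have "\<bar>(a *\<^sub>R v + b *\<^sub>R w) \<bullet> ?n\<bar> powr p \<le> a * \<bar>v \<bullet> ?n\<bar> powr p + b * \<bar>w \<bullet> ?n\<bar> powr p"
      using abs_powr_convex[OF p ab, of "v \<bullet> ?n" "w \<bullet> ?n"] by (simp add: inner_add_left)
    then have "?c * ennreal (\<bar>(a *\<^sub>R v + b *\<^sub>R w) \<bullet> ?n\<bar> powr p) \<le> ?c * ennreal (a * \<bar>v \<bullet> ?n\<bar> powr p + b * \<bar>w \<bullet> ?n\<bar> powr p)"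
      by (intro mult_left_mono ennreal_leI) auto
    also have "\<dots> = ennreal a * (?c * ennreal (\<bar>v \<bullet> ?n\<bar> powr p)) + ennreal b * (?c * ennreal (\<bar>w \<bullet> ?n\<bar> powr p))"
      using ab by (simp only: ennreal_plus mult_nonneg_nonneg powr_ge_zero ennreal_mult distrib_left mult_ac)
    finally show ?thesis using True by simp
  next
    case False
    then show ?thesis unfolding if_not_P[OF False] by simp
  qed
  then have "Lp_energy p K (a *\<^sub>R v + b *\<^sub>R w) \<le> (\<integral>\<^sup>+x. ennreal a * ?F v x + ennreal b * ?F w x \<partial>lborel)"
    unfolding Lp_energy_radial by (intro nn_integral_mono)
  also have "\<dots> = ennreal a * Lp_energy p K v + ennreal b * Lp_energy p K w"
    unfolding Lp_energy_radial
    by (subst nn_integral_add, (intro borel_measurable_times_ennreal m measurable_const; simp),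
          (intro borel_measurable_times_ennreal m measurable_const; simp),
          subst nn_integral_cmult[OF m], subst nn_integral_cmult[OF m], rule refl)
  finally show ?thesis .
qed

end

section \<open>Support functions and sublinearity\<close>

lemma compact_convex_eq_if_support_eq:
  fixes L M :: "'a::euclidean_space set"
  assumes L: "convex L" "compact L" "L \<noteq> {}" and M: "convex M" "compact M" "M \<noteq> {}"
    and eq: "\<And>v. v \<in> sphere 0 1 \<Longrightarrow> support_function L v = support_function M v"
  shows "L = M"
proof -
  have "L \<subseteq> M"
    if L: "compact L" "L \<noteq> {}" and M: "convex M" "compact M" "M \<noteq> {}"
      and eq: "\<And>v. v \<in> sphere 0 1 \<Longrightarrow> support_function L v = support_function M v" for L M :: "'a set"
  proof (rule subsetI, rule ccontr)
    fix x assume x: "x \<in> L" "x \<notin> M"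
    then obtain a b where ab: "a \<bullet> x < b" "\<And>y. y \<in> M \<Longrightarrow> a \<bullet> y > b"
      using separating_hyperplane_closed_point[OF M(1) compact_imp_closed[OF M(2)]] by blast
    have a0: "a \<noteq> 0" using ab M(3) by auto
    let ?v = "- a /\<^sub>R norm a"
    have v: "?v \<in> sphere 0 1" using a0 by simp
    obtain y where y: "y \<in> M" "?v \<bullet> y = support_function M ?v" using support_function_attained[OF M(2,3), of ?v] by blast
    have "?v \<bullet> x \<le> support_function L ?v" using support_function_attained[OF L, of ?v] x(1) by blast
    also have "\<dots> = ?v \<bullet> y" using eq[OF v] y(2) by simp
    finally have "(a \<bullet> y) / norm a \<le> (a \<bullet> x) / norm a" by (simp add: divide_inverse mult.commute)
    then have "a \<bullet> y \<le> a \<bullet> x" using a0 by (simp add: divide_le_cancel)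
    with ab(1) ab(2)[OF y(1)] show False by simp
  qed
  from this[OF L(2,3) M eq] this[OF M(2,3) L eq[symmetric]] show ?thesis by blast
qed

text \<open>The epigraph \<open>E\<close> is a closed convex cone. A hyperplane separating it from a
  point \<open>(v0, s)\<close> below the graph is not vertical, and its normalised gradient is an
  element of \<open>L\<close> whose value at \<open>v0\<close> exceeds \<open>s\<close>.\<close>

lemma sublinear_is_support_function:
  fixes h :: "'a::euclidean_space \<Rightarrow> real"
  assumes hom: "\<And>c v. c \<ge> 0 \<Longrightarrow> h (c *\<^sub>R v) = c * h v"
    and sub: "\<And>v w. h (v + w) \<le> h v + h w" and cont: "continuous_on UNIV h"
  obtains L where "convex L" "compact L" "L \<noteq> {}" "\<And>v. support_function L v = h v"
proof -
  define L where "L = {x. \<forall>v. v \<bullet> x \<le> h v}"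
  have h0: "h 0 = 0" using hom[of 0 0] by simp
  have key: "\<exists>x\<in>L. s < v0 \<bullet> x" if s: "s < h v0" for v0 s
  proof -
    define E where "E = {p::'a \<times> real. h (fst p) \<le> snd p}"
    have cE: "closed E" unfolding E_def
      by (intro closed_Collect_le continuous_on_compose2[OF cont] continuous_intros) auto
    have E0: "(0, 0) \<in> E" by (simp add: E_def h0)
    have Ec: "(c *\<^sub>R v, c * r) \<in> E" if "(v, r) \<in> E" "c \<ge> 0" for c v r
      using that hom by (auto simp: E_def intro: mult_left_mono)
    have vE: "convex E"
    proof (rule convexI)
      fix p q :: "'a \<times> real" and a b :: real assume pq: "p \<in> E" "q \<in> E" and ab: "0 \<le> a" "0 \<le> b" "a + b = 1"
      have "h (a *\<^sub>R fst p + b *\<^sub>R fst q) \<le> a * h (fst p) + b * h (fst q)"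
        using sub[of "a *\<^sub>R fst p" "b *\<^sub>R fst q"] hom ab by simp
      also have "\<dots> \<le> a * snd p + b * snd q" using pq ab by (intro add_mono mult_left_mono) (auto simp: E_def)
      finally show "a *\<^sub>R p + b *\<^sub>R q \<in> E" by (simp add: E_def)
    qed
    have "(v0, s) \<notin> E" using s by (simp add: E_def)
    then obtain A b where A: "A \<bullet> (v0, s) < b" "\<And>q. q \<in> E \<Longrightarrow> A \<bullet> q > b"
      using separating_hyperplane_closed_point[OF vE cE] by blast
    obtain a \<beta> where Aeq: "A = (a, \<beta>)" by (cases A)
    have b0: "b < 0" using A(2)[OF E0] by (simp add: Aeq)
    \<comment> \<open>If the functional were negative somewhere on the cone, the multiple with
      factor \<open>b / ?k\<close> would take the value \<open>b\<close>, which separation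
      forbids.\<close>
    have pos: "a \<bullet> v + \<beta> * r \<ge> 0" if q: "(v, r) \<in> E" for v r
    proof (rule ccontr)
      assume neg: "\<not> ?thesis"
      let ?k = "a \<bullet> v + \<beta> * r"
      have "b / ?k \<ge> 0" using neg b0 by (simp add: divide_nonpos_neg)
      then have "(a, \<beta>) \<bullet> ((b / ?k) *\<^sub>R v, (b / ?k) * r) > b" using A(2)[OF Ec[OF q]] unfolding Aeq by blast
      moreover have "(a, \<beta>) \<bullet> (c *\<^sub>R v, c * r) = c * ?k" for c by (simp add: algebra_simps)
      ultimately have "(b / ?k) * ?k > b" by metis
      then show False using neg by simp
    qed
    have neg0: "a \<bullet> v0 + \<beta> * s < 0" using A(1) b0 by (simp add: Aeq)
    have "(0, 1) \<in> E" by (simp add: E_def h0)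
    then have \<beta>: "\<beta> \<ge> 0" using pos by fastforce
    \<comment> \<open>A vertical hyperplane would require \<open>a \<bullet> v\<close> to be
      nonnegative for all \<open>v\<close>, hence \<open>a = 0\<close>.\<close>
    have "\<beta> \<noteq> 0"
    proof
      assume \<beta>0: "\<beta> = 0"
      have "(- a, h (- a)) \<in> E" by (simp add: E_def)
      then have "a \<bullet> a \<le> 0" using pos[of "- a" "h (- a)"] \<beta>0 by simp
      then have "a = 0" using inner_ge_zero[of a] by (metis antisym inner_eq_zero_iff)
      then show False using neg0 \<beta>0 by simp
    qed
    then have \<beta>p: "\<beta> > 0" using \<beta> by simp
    let ?x = "- (a /\<^sub>R \<beta>)"
    have "?x \<in> L" unfolding L_def
    proof safe
      fix v
      have "a \<bullet> v + \<beta> * h v \<ge> 0" by (rule pos) (simp add: E_def)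
      then show "v \<bullet> ?x \<le> h v" using \<beta>p by (simp add: field_simps inner_commute)
    qed
    moreover have "s < v0 \<bullet> ?x" using neg0 \<beta>p by (simp add: field_simps inner_commute)
    ultimately show ?thesis by blast
  qed
  have ne: "L \<noteq> {}" using key[of "-1" 0] h0 by auto
  have eqL: "L = (\<Inter>v. {x. v \<bullet> x \<le> h v})" by (auto simp: L_def)
  have "closed L" unfolding eqL by (intro closed_INT ballI closed_Collect_le continuous_intros)
  moreover have "bounded L"
  proof -
    have "\<forall>x\<in>L. norm x \<le> (\<Sum>b\<in>Basis. max (h b) (h (- b)))"
    proof
      fix x assume x: "x \<in> L"
      have "\<bar>x \<bullet> b\<bar> \<le> max (h b) (h (- b))" for b
      proof -
        have "b \<bullet> x \<le> h b" "(- b) \<bullet> x \<le> h (- b)" using x unfolding L_def by blast+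
        then have "x \<bullet> b \<le> h b" "- (x \<bullet> b) \<le> h (- b)" by (simp_all add: inner_commute)
        then show ?thesis by linarith
      qed
      then show "norm x \<le> (\<Sum>b\<in>Basis. max (h b) (h (- b)))"
        by (intro order_trans[OF norm_le_l1] sum_mono)
    qed
    then show ?thesis by (auto simp: bounded_iff)
  qed
  ultimately have cL: "compact L" by (simp add: compact_eq_bounded_closed)
  have vL: "convex L" unfolding eqL by (intro convex_INT ballI convex_halfspace_le)
  have "support_function L v = h v" for v
  proof (rule antisym)
    obtain y where y: "y \<in> L" "v \<bullet> y = support_function L v" using support_function_attained[OF cL ne, of v] by blast
    moreover have "v \<bullet> y \<le> h v" using y(1) unfolding L_def by blast
    ultimately show "support_function L v \<le> h v" by simp
    show "h v \<le> support_function L v"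
    proof (rule ccontr)
      assume "\<not> ?thesis"
      then obtain x where x: "x \<in> L" "support_function L v < v \<bullet> x" using key by (meson not_le)
      moreover have "v \<bullet> x \<le> support_function L v" using support_function_attained[OF cL ne, of v] x(1) by blast
      ultimately show False by simp
    qed
  qed
  with vL cL ne show thesis by (rule that)
qed

text \<open>The root is the gauge of the convex set where \<Phi> is at most 1: divide
  \<open>v\<close> by \<alpha> and \<open>w\<close> by \<beta> to enter that set, then combine them
  with weights proportional to \<alpha> and \<beta>. The added \<open>e / 2\<close> keeps the
  divisors positive where the root vanishes.\<close>

lemma root_of_convex_homogeneous_subadditive:
  fixes \<Phi> :: "'a::real_vector \<Rightarrow> real"
  assumes p: "p > 0" and nn: "\<And>v. \<Phi> v \<ge> 0" and hom: "\<And>c v. c > 0 \<Longrightarrow> \<Phi> (c *\<^sub>R v) = c powr p * \<Phi> v"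
    and conv: "convex_on UNIV \<Phi>"
  shows "\<Phi> (v + w) powr (1 / p) \<le> \<Phi> v powr (1 / p) + \<Phi> w powr (1 / p)"
proof (rule field_le_epsilon)
  fix e :: real assume e: "e > 0"
  let ?h = "\<lambda>v. \<Phi> v powr (1 / p)"
  define \<alpha> where "\<alpha> = ?h v + e / 2"
  define \<beta> where "\<beta> = ?h w + e / 2"
  have pos: "\<alpha> > 0" "\<beta> > 0" using e by (auto simp: \<alpha>_def \<beta>_def intro: add_nonneg_pos)
  have one: "\<Phi> ((1 / \<gamma>) *\<^sub>R x) \<le> 1" if \<gamma>: "\<gamma> > 0" "?h x \<le> \<gamma>" for x \<gamma>
  proof -
    have "\<Phi> x = ?h x powr p" using nn[of x] p by (simp add: powr_powr)
    also have "\<dots> \<le> \<gamma> powr p" using \<gamma> p by (intro powr_mono2) auto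
    finally have "\<Phi> x \<le> \<gamma> powr p" .
    then show ?thesis using \<gamma>(1) hom[of "1 / \<gamma>" x] by (simp add: powr_divide)
  qed
  let ?a = "\<alpha> / (\<alpha> + \<beta>)" and ?b = "\<beta> / (\<alpha> + \<beta>)"
  have ab: "?a \<ge> 0" "?b \<ge> 0" "?a + ?b = 1" using pos by (auto simp: add_divide_distrib[symmetric])
  have "\<Phi> ((1 / (\<alpha> + \<beta>)) *\<^sub>R (v + w)) = \<Phi> (?a *\<^sub>R ((1 / \<alpha>) *\<^sub>R v) + ?b *\<^sub>R ((1 / \<beta>) *\<^sub>R w))"
    using pos by (simp add: scaleR_add_right)
  also have "\<dots> \<le> ?a * \<Phi> ((1 / \<alpha>) *\<^sub>R v) + ?b * \<Phi> ((1 / \<beta>) *\<^sub>R w)"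
    using conv ab unfolding convex_on_def by blast
  also have "\<dots> \<le> ?a * 1 + ?b * 1"
    using ab one[OF pos(1), of v] one[OF pos(2), of w] e by (intro add_mono mult_left_mono) (auto simp: \<alpha>_def \<beta>_def)
  finally have "\<Phi> ((1 / (\<alpha> + \<beta>)) *\<^sub>R (v + w)) \<le> 1" using ab(3) by simp
  then have "\<Phi> (v + w) \<le> (\<alpha> + \<beta>) powr p"
    using pos hom[of "1 / (\<alpha> + \<beta>)" "v + w"] by (simp add: powr_divide)
  then have "?h (v + w) \<le> ((\<alpha> + \<beta>) powr p) powr (1 / p)" using nn p by (intro powr_mono2) auto
  also have "\<dots> = \<alpha> + \<beta>" using pos p by (simp add: powr_powr)
  finally show "?h (v + w) \<le> ?h v + ?h w + e" by (simp add: \<alpha>_def \<beta>_def)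
qed

definition Lp_projection_constant :: "real \<Rightarrow> 'a::euclidean_space itself \<Rightarrow> real" where
  "Lp_projection_constant p _ =
     real DIM('a) * unit_ball_vol (real DIM('a)) * Lp_const (real DIM('a) - 2) p"

lemma Lp_projection_constant_pos:
  assumes "DIM('a::euclidean_space) \<ge> 2" "p > 1" shows "Lp_projection_constant p TYPE('a) > 0"
proof -
  \<comment> \<open>The index n-2 of the normalising constant must be nonnegative for its ball
    volume to be positive.\<close>
  have "real DIM('a) - 2 \<ge> 0" using assms(1) by simp
  then show ?thesis using assms(2) unfolding Lp_projection_constant_def Lp_const_def
    by (intro mult_pos_pos divide_pos_pos unit_ball_vol_pos) auto
qed

context convex_body
begin

text \<open>The body is given by a definite description, so it must first be shown that
  \<open>Lp_projection_function\<close> is the support function of exactly one compact convex set.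
  Its polar is then the set where the function is at most 1, that is, a sublevel set of the
  energy.\<close>

lemma polar_Lp_projection_body:
  assumes n: "DIM('a) \<ge> 2" and p: "p > 1"
  shows "polar_body (Lp_projection_body p K) = {v. Lp_energy p K v \<le> ennreal (Lp_projection_constant p TYPE('a))}"
    and "closed (polar_body (Lp_projection_body p K))" and "convex (polar_body (Lp_projection_body p K))"
proof -
  define C where "C = Lp_projection_constant p TYPE('a)"
  have C: "C > 0" unfolding C_def by (rule Lp_projection_constant_pos[OF n p])
  define \<Phi> where "\<Phi> v = 1 / C * enn2real (Lp_energy p K v)" for v
  define h where "h v = \<Phi> v powr (1 / p)" for v
  \<comment> \<open>Finiteness keeps \<open>enn2real\<close> faithful; an infinite energy would be
    turned into 0.\<close>
  have fin: "Lp_energy p K v < top" for v using p by (intro Lp_energy_finite) simp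
  have \<Phi>nn: "\<Phi> v \<ge> 0" for v using C by (simp add: \<Phi>_def)
  have \<Phi>E: "ennreal (C * \<Phi> v) = Lp_energy p K v" for v using fin[of v] C by (simp add: \<Phi>_def less_top)
  have hom\<Phi>: "\<Phi> (c *\<^sub>R v) = c powr p * \<Phi> v" if "c > 0" for c v
    using p that by (simp add: \<Phi>_def Lp_energy_scale enn2real_mult)
  have conv: "convex_on UNIV \<Phi>"
  proof (rule convex_onI)
    fix t :: real and x y :: 'a assume t: "0 < t" "t < 1"
    have "ennreal (C * \<Phi> ((1 - t) *\<^sub>R x + t *\<^sub>R y)) \<le> ennreal (1 - t) * ennreal (C * \<Phi> x) + ennreal t * ennreal (C * \<Phi> y)"
      unfolding \<Phi>E using t p by (intro Lp_energy_convex) auto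
    also have "\<dots> = ennreal ((1 - t) * (C * \<Phi> x) + t * (C * \<Phi> y))"
      using t C \<Phi>nn by (simp add: ennreal_mult ennreal_plus)
    finally have "C * \<Phi> ((1 - t) *\<^sub>R x + t *\<^sub>R y) \<le> (1 - t) * (C * \<Phi> x) + t * (C * \<Phi> y)"
      using t C \<Phi>nn by (subst (asm) ennreal_le_iff) auto
    also have "\<dots> = C * ((1 - t) * \<Phi> x + t * \<Phi> y)" by (simp add: algebra_simps)
    finally show "\<Phi> ((1 - t) *\<^sub>R x + t *\<^sub>R y) \<le> (1 - t) * \<Phi> x + t * \<Phi> y" using C by simp
  qed simp
  have \<Phi>0: "\<Phi> 0 = 0" using p Lp_energy_scale[of p 0 0] by (simp add: \<Phi>_def)
  have homh: "h (c *\<^sub>R v) = c * h v" if "c \<ge> 0" for c v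
  proof (cases "c = 0")
    case False
    then show ?thesis using that p by (simp add: h_def hom\<Phi> powr_mult powr_powr)
  qed (simp add: h_def \<Phi>0)
  have subh: "h (v + w) \<le> h v + h w" for v w
    unfolding h_def by (rule root_of_convex_homogeneous_subadditive[OF _ \<Phi>nn hom\<Phi> conv]) (use p in auto)
  have "continuous_on UNIV \<Phi>" using convex_on_continuous[OF open_UNIV conv] .
  then have conth: "continuous_on UNIV h"
    unfolding h_def using p \<Phi>nn by (intro continuous_on_powr') auto
  obtain L where L: "convex L" "compact L" "L \<noteq> {}" "\<And>v. support_function L v = h v"
    using sublinear_is_support_function[OF homh subh conth] by blast
  have h_eq: "Lp_projection_function p K v = h v" for v
    unfolding Lp_projection_function_def Lp_integral_eq_energy h_def \<Phi>_def C_def Lp_projection_constant_def ..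
  have "Lp_projection_body p K = L"
    unfolding Lp_projection_body_def
  proof (rule the_equality)
    show "convex L \<and> compact L \<and> L \<noteq> {} \<and> (\<forall>v\<in>sphere 0 1. support_function L v = Lp_projection_function p K v)"
      using L h_eq by simp
    fix M assume M: "convex M \<and> compact M \<and> M \<noteq> {} \<and> (\<forall>v\<in>sphere 0 1. support_function M v = Lp_projection_function p K v)"
    then show "M = L" using L h_eq by (intro compact_convex_eq_if_support_eq) auto
  qed
  moreover have "polar_body L = {v. h v \<le> 1}"
  proof (rule set_eqI)
    fix v
    obtain x where x: "x \<in> L" "v \<bullet> x = support_function L v" "\<And>y. y \<in> L \<Longrightarrow> v \<bullet> y \<le> support_function L v"
      using support_function_attained[OF L(2,3), of v] by blast
    show "v \<in> polar_body L \<longleftrightarrow> v \<in> {v. h v \<le> 1}"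
      using x L(4) unfolding polar_body_def by (auto intro: order_trans)
  qed
  moreover have "h v \<le> 1 \<longleftrightarrow> Lp_energy p K v \<le> ennreal C" for v
  proof -
    have "h v \<le> 1 \<longleftrightarrow> \<Phi> v \<le> 1"
    proof
      assume "h v \<le> 1"
      then have "h v powr p \<le> 1 powr p" using p by (intro powr_mono2) (auto simp: h_def)
      then show "\<Phi> v \<le> 1" using p \<Phi>nn[of v] by (simp add: h_def powr_powr)
    next
      assume "\<Phi> v \<le> 1"
      then have "\<Phi> v powr (1 / p) \<le> 1 powr (1 / p)" using p \<Phi>nn by (intro powr_mono2) auto
      then show "h v \<le> 1" by (simp add: h_def)
    qed
    also have "\<dots> \<longleftrightarrow> C * \<Phi> v \<le> C" using C by simp
    also have "\<dots> \<longleftrightarrow> Lp_energy p K v \<le> ennreal C" unfolding \<Phi>E[symmetric] using C \<Phi>nn by (subst ennreal_le_iff) auto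
    finally show ?thesis .
  qed
  ultimately show eq: "polar_body (Lp_projection_body p K) = {v. Lp_energy p K v \<le> ennreal C}" by simp
  have "polar_body (Lp_projection_body p K) = (\<Inter>x\<in>Lp_projection_body p K. {y. y \<bullet> x \<le> 1})" by (auto simp: polar_body_def)
  then show "closed (polar_body (Lp_projection_body p K))" "convex (polar_body (Lp_projection_body p K))"
    by (auto intro!: closed_INT convex_INT closed_Collect_le continuous_intros simp: inner_commute[of _ "_ :: 'a"] convex_halfspace_le)
qed

end

text \<open>In an interval with ends \<alpha> and \<beta> pair \<open>r\<close> with its mirror
  image \<open>\<alpha> + \<beta> - r\<close>: then
  \<open>a * r - b * (\<alpha> + \<beta> - r)\<close> is
  \<open>r - b * (\<alpha> + \<beta>)\<close>, so \<open>J\<close> contains a translate of the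
  interval. The set \<open>I\<close> may be unbounded and is exhausted by the truncations
  \<open>In n\<close>.\<close>

lemma emeasure_interval_combination:
  fixes I J :: "real set"
  assumes I: "convex I" "closed I" and J: "J \<in> sets borel"
    and ab: "0 \<le> a" "0 \<le> b" "a + b = 1" and comb: "\<And>r r'. r \<in> I \<Longrightarrow> r' \<in> I \<Longrightarrow> a * r - b * r' \<in> J"
  shows "emeasure lborel I \<le> emeasure lborel J"
proof -
  define In where "In n = I \<inter> {- real n..real n}" for n
  have "emeasure lborel (In n) \<le> emeasure lborel J" for n
  proof (cases "In n = {}")
    case False
    have c: "compact (In n)" unfolding In_def by (rule closed_Int_compact[OF I(2)]) simp
    have v: "convex (In n)" unfolding In_def by (intro convex_Int I convex_real_interval)
    obtain \<alpha> \<beta> where \<alpha>\<beta>: "In n = {\<alpha>..\<beta>}" using connected_compact_interval_1[of "In n"] c v convex_connected by blast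
    have le: "\<alpha> \<le> \<beta>" using False \<alpha>\<beta> by auto
    have "{\<alpha> - b * (\<alpha> + \<beta>)..\<beta> - b * (\<alpha> + \<beta>)} \<subseteq> J"
    proof
      fix x assume x: "x \<in> {\<alpha> - b * (\<alpha> + \<beta>)..\<beta> - b * (\<alpha> + \<beta>)}"
      define r where "r = x + b * (\<alpha> + \<beta>)"
      have "r \<in> In n" "\<alpha> + \<beta> - r \<in> In n" using x by (auto simp: \<alpha>\<beta> r_def)
      then have "a * r - b * (\<alpha> + \<beta> - r) \<in> J" by (intro comb) (auto simp: In_def)
      also have "a * r - b * (\<alpha> + \<beta> - r) = (a + b) * r - b * (\<alpha> + \<beta>)" by (simp add: algebra_simps)
      also have "\<dots> = x" unfolding ab(3) r_def by simp
      finally show "x \<in> J" .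
    qed
    then have "emeasure lborel {\<alpha> - b * (\<alpha> + \<beta>)..\<beta> - b * (\<alpha> + \<beta>)} \<le> emeasure lborel J"
      using J by (intro emeasure_mono) auto
    then show ?thesis unfolding \<alpha>\<beta> using le by simp
  qed simp
  moreover have "(\<Union>n. In n) = I"
  proof -
    have "\<exists>n::nat. - real n \<le> x \<and> x \<le> real n" for x :: real
    proof -
      obtain n :: nat where "\<bar>x\<bar> \<le> real n" using real_arch_simple by blast
      then show ?thesis by (intro exI[of _ n]) linarith
    qed
    then show ?thesis by (auto simp: In_def)
  qed
  moreover have "emeasure lborel (\<Union>n. In n) = (SUP n. emeasure lborel (In n))"
    using I(2) by (intro SUP_emeasure_incseq[symmetric]) (auto simp: In_def incseq_def borel_closed)
  ultimately show ?thesis by (metis SUP_least)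
qed

theorem polar_Lp_projection_body_shadow_system:
  fixes K :: "'a::euclidean_space set"
  assumes n: "DIM('a) \<ge> 2" and p: "p > 1" and K: "K \<in> convex_bodies_o" and u: "norm u = 1"
  defines "V \<equiv> \<lambda>t. emeasure lborel (polar_body (Lp_projection_body p (shadow_system u K t)))"
  shows "t \<in> {-1..1} \<Longrightarrow> V t = V (- t)" and "0 \<le> s \<Longrightarrow> s \<le> t \<Longrightarrow> t \<le> 1 \<Longrightarrow> V t \<le> V s"
proof -
  interpret convex_body K by (rule convex_body.intro[OF K])
  define E where "E t = polar_body (Lp_projection_body p (shadow_system u K t))" for t
  let ?C = "ennreal (Lp_projection_constant p TYPE('a))"
  have E: "E t = {v. Lp_energy p (shadow_system u K t) v \<le> ?C}" "closed (E t)" "convex (E t)" if "t \<in> {-1..1}" for t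
    using convex_body.polar_Lp_projection_body[OF convex_body.intro[OF shadow_system_body[OF u that]] n p]
    by (auto simp: E_def)
  have refl: "reflection u v \<in> E (- t) \<longleftrightarrow> v \<in> E t" if t: "t \<in> {-1..1}" for t v
  proof -
    have t': "- t \<in> {-1..1}" using t by simp
    have "Lp_energy p (shadow_system u K (- t)) (reflection u v) = Lp_energy p (shadow_system u K t) v"
      by (rule Lp_energy_reflection[OF shadow_system_body[OF u t] shadow_system_body[OF u t'] u
            shadow_system_reflection[OF u]])
    then show ?thesis unfolding E(1)[OF t] E(1)[OF t'] by simp
  qed
  show "V t = V (- t)" if t: "t \<in> {-1..1}" for t
  proof -
    have t': "- t \<in> {-1..1}" using t by simp
    have [measurable]: "E t \<in> sets borel" "E (- t) \<in> sets borel" using E(2) t t' by (auto intro: borel_closed)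
    have "emeasure lborel (E (- t)) = (\<integral>\<^sup>+v. indicator (E (- t)) v \<partial>lborel)" by simp
    also have "\<dots> = (\<integral>\<^sup>+v. indicator (E (- t)) (reflection u v) \<partial>lborel)"
      by (rule nn_integral_reflection[OF u, symmetric]) simp
    also have "\<dots> = (\<integral>\<^sup>+v. indicator (E t) v \<partial>lborel)"
      by (intro nn_integral_cong) (simp add: indicator_def refl[OF t])
    also have "\<dots> = emeasure lborel (E t)" by simp
    finally show ?thesis by (simp add: V_def E_def)
  qed
  show "V t \<le> V s" if st: "0 \<le> s" "s \<le> t" "t \<le> 1" for s t
  \<comment> \<open>The weights below divide by \<open>t\<close>; for \<open>t = 0\<close> also
    \<open>s = 0\<close>.\<close>
  proof (cases "t = 0")
    case False
    \<comment> \<open>The weights that write \<open>s\<close> as a convex combination of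
      \<open>t\<close> and \<open>- t\<close>.\<close>
    define a where "a = (t + s) / (2 * t)"
    define b where "b = (t - s) / (2 * t)"
    have t0: "t > 0" using False st by simp
    have ab: "0 \<le> a" "0 \<le> b" "a + b = 1" using st t0 by (auto simp: a_def b_def add_divide_distrib[symmetric])
    have seq: "s = a * t + b * (- t)" using t0 by (simp add: a_def b_def field_simps)
    have I: "t \<in> {-1..1}" "- t \<in> {-1..1}" "s \<in> {-1..1}" using st by auto
    have [measurable]: "E t \<in> sets borel" "E s \<in> sets borel" using E(2) I by (auto intro: borel_closed)
    let ?S = "\<lambda>t x. {r. hproj u x + r *\<^sub>R u \<in> E t}"
    have vol: "emeasure lborel (E q) = (\<integral>\<^sup>+x. indicator {x. 0 \<le> x \<bullet> u \<and> x \<bullet> u < 1} x * emeasure lborel (?S q x) \<partial>lborel)"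
      if [measurable]: "E q \<in> sets borel" for q
    proof -
      have "emeasure lborel (E q) = (\<integral>\<^sup>+v. indicator (E q) v \<partial>lborel)" by simp
      also have "\<dots> = (\<integral>\<^sup>+x. indicator {x. 0 \<le> x \<bullet> u \<and> x \<bullet> u < 1} x * (\<integral>\<^sup>+r. indicator (E q) (hproj u x + r *\<^sub>R u) \<partial>lborel) \<partial>lborel)"
        by (rule nn_integral_slab[OF u]) simp
      also have "\<dots> = (\<integral>\<^sup>+x. indicator {x. 0 \<le> x \<bullet> u \<and> x \<bullet> u < 1} x * emeasure lborel (?S q x) \<partial>lborel)"
      proof (rule nn_integral_cong)
        fix x
        have "(\<integral>\<^sup>+r. indicator (E q) (hproj u x + r *\<^sub>R u) \<partial>lborel) = (\<integral>\<^sup>+r. indicator (?S q x) r \<partial>lborel)"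
          by (intro nn_integral_cong) (simp add: indicator_def)
        also have "\<dots> = emeasure lborel (?S q x)" by (rule nn_integral_indicator) measurable
        finally show "indicator {x. 0 \<le> x \<bullet> u \<and> x \<bullet> u < 1} x * (\<integral>\<^sup>+r. indicator (E q) (hproj u x + r *\<^sub>R u) \<partial>lborel) =
          indicator {x. 0 \<le> x \<bullet> u \<and> x \<bullet> u < 1} x * emeasure lborel (?S q x)" by simp
      qed
      finally show ?thesis .
    qed
    have sec: "emeasure lborel (?S t x) \<le> emeasure lborel (?S s x)" for x
    proof (rule emeasure_interval_combination[OF _ _ _ ab])
      let ?z = "hproj u x"
      show "?S s x \<in> sets borel" by measurable
      have "closed ((\<lambda>r. ?z + r *\<^sub>R u) -` E t)"
        by (intro continuous_closed_vimage E I) (intro continuous_intros)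
      then show "closed (?S t x)" by (simp add: vimage_def)
      show "convex (?S t x)"
      proof (rule convexI)
        fix r r' c d :: real assume r: "r \<in> ?S t x" "r' \<in> ?S t x" and cd: "0 \<le> c" "0 \<le> d" "c + d = 1"
        then have "c *\<^sub>R (?z + r *\<^sub>R u) + d *\<^sub>R (?z + r' *\<^sub>R u) \<in> E t" using convexD[OF E(3)[OF I(1)]] by blast
        also have "c *\<^sub>R (?z + r *\<^sub>R u) + d *\<^sub>R (?z + r' *\<^sub>R u) = (c + d) *\<^sub>R ?z + (c * r + d * r') *\<^sub>R u" by (simp add: algebra_simps)
        finally show "c *\<^sub>R r + d *\<^sub>R r' \<in> ?S t x" using cd(3) by simp
      qed
      fix r r' assume r: "r \<in> ?S t x" "r' \<in> ?S t x"
      let ?v1 = "?z + r *\<^sub>R u" and ?v2 = "?z - r' *\<^sub>R u"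
      \<comment> \<open>The reflected second point belongs to the sublevel set for
        \<open>- t\<close>, over the same point \<open>?z\<close> but at height \<open>- r'\<close>;
        this is the origin of the minus sign in \<open>a * r - b * r'\<close>.\<close>
      have "reflection u (?z + r' *\<^sub>R u) = ?v2"
      proof -
        have "(?z + r' *\<^sub>R u) \<bullet> u = r'" using u by (simp add: inner_add_left dot_square_norm)
        then show ?thesis unfolding reflection_def mult_2 scaleR_add_left by simp
      qed
      then have "?v2 \<in> E (- t)" using refl[OF I(1), of "?z + r' *\<^sub>R u"] r by simp
      then have e2: "Lp_energy p (shadow_system u K (- t)) ?v2 \<le> ?C" using E(1)[OF I(2)] by blast
      have e1: "Lp_energy p (shadow_system u K t) ?v1 \<le> ?C" using r E(1)[OF I(1)] by blast
      have h: "hproj u ?v1 = hproj u ?v2" using u by (simp add: hproj_add hproj_diff hproj_scaleR)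
      have "Lp_energy p (shadow_system u K s) (a *\<^sub>R ?v1 + b *\<^sub>R ?v2) \<le>
          ennreal a * Lp_energy p (shadow_system u K t) ?v1 + ennreal b * Lp_energy p (shadow_system u K (- t)) ?v2"
        unfolding seq using p by (intro Lp_energy_shadow_convex[OF u I(1,2) ab _ h]) simp
      also have "\<dots> \<le> ennreal a * ?C + ennreal b * ?C" by (intro add_mono mult_left_mono e1 e2) auto
      also have "\<dots> = (ennreal a + ennreal b) * ?C" by (simp add: distrib_right)
      also have "ennreal a + ennreal b = 1" using ab by (simp add: ennreal_plus[symmetric] del: ennreal_plus)
      finally have "a *\<^sub>R ?v1 + b *\<^sub>R ?v2 \<in> E s" using E(1)[OF I(3)] by simp
      also have "a *\<^sub>R ?v1 + b *\<^sub>R ?v2 = (a + b) *\<^sub>R ?z + (a * r - b * r') *\<^sub>R u" by (simp add: algebra_simps)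
      finally show "a * r - b * r' \<in> ?S s x" using ab(3) by simp
    qed
    have "emeasure lborel (E t) \<le> emeasure lborel (E s)"
      unfolding vol[OF \<open>E t \<in> sets borel\<close>] vol[OF \<open>E s \<in> sets borel\<close>]
      by (intro nn_integral_mono mult_left_mono sec) auto
    then show ?thesis by (simp add: V_def E_def)
  qed (use st in simp)
qed

theorem theorem5p1:
  fixes K :: "(real ^ 'n) set" and u :: "real ^ 'n" and p :: real
  assumes "CARD('n) \<ge> 2" and "p > 1" and "K \<in> convex_bodies_o" and "u \<in> sphere 0 1"
  shows "(\<forall>t\<in>{-1..1}.
            emeasure lborel (polar_body (Lp_projection_body p (shadow_system u K t))) =
            emeasure lborel (polar_body (Lp_projection_body p (shadow_system u K (- t))))) \<and>
         antimono_on {0..1}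
           (\<lambda>t. emeasure lborel (polar_body (Lp_projection_body p (shadow_system u K t))))"
proof -
  have n: "DIM(real ^ 'n) \<ge> 2" using assms(1) by simp
  have u: "norm u = 1" using assms(4) by simp
  note V = polar_Lp_projection_body_shadow_system[OF n assms(2,3) u]
  show ?thesis
  proof (intro conjI ballI monotone_onI)
    fix t :: real assume "t \<in> {-1..1}"
    then show "emeasure lborel (polar_body (Lp_projection_body p (shadow_system u K t))) =
        emeasure lborel (polar_body (Lp_projection_body p (shadow_system u K (- t))))" by (rule V(1))
  next
    fix s t :: real assume "s \<in> {0..1}" "t \<in> {0..1}" "s \<le> t"
    then show "emeasure lborel (polar_body (Lp_projection_body p (shadow_system u K t))) \<le>
        emeasure lborel (polar_body (Lp_projection_body p (shadow_system u K s)))" by (intro V(2)) auto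
  qed
qed

end
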